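(* Let $N\in\mathbb{N}$ be squarefree. The Hecke algebras $\mathcal H(\Gamma_N,\mathcal G_N)$ and $\mathcal H(\widehat\Gamma_N,\widehat{\mathcal G}_N)$ are commutative and coincide with the tensor product of their primary components, $$\bigotimes_p\mathcal H(\Gamma_N,\mathcal G_{N,p})\quad\text{resp.}\quad\bigotimes_p\mathcal H(\widehat\Gamma_N,\widehat{\mathcal G}_{N,p}),$$ where $p$ runs over all primes.
   Context: For matrices $A,B$ of compatible size, $A[B]:=B'AB$ ($'$ = transpose). $S_N=\begin{pmatrix}0&0&1\\0&-2N&0\\1&0&0\end{pmatrix}$, $\widehat S_N=\begin{pmatrix}0&0&1\\0&S_N&0\\1&0&0\end{pmatrix}$. For $S$ of size $n$ among these, $SO(S;\mathbb{R})=\{K\in SL_n(\mathbb{R}):S[K]=S\}$, $SO_0(S;\mathbb{R})$ its identity component, $SO_0(S;R)=SO_0(S;\mathbb{R})\cap R^{n\times n}$. $\Gamma_N=SO_0(S_N;\mathbb{Z})$, $\widehat\Gamma_N=SO_0(\widehat S_N;\mathbb{Z})$, $\mathcal G_N=SO_0(S_N;\mathbb{Q})$, $\widehat{\mathcal G}_N=SO_0(\widehat S_N;\mathbb{Q})$. For a prime $p$: $\mathcal G_{N,p}=\{p^{-r}K\in\mathcal G_N: K\text{ integral},\ r\in\mathbb{N}_0\}$ and $\widehat{\mathcal G}_{N,p}=\{p^{-r}M\in\widehat{\mathcal G}_N: M\text{ integral},\ r\in\mathbb{N}_0\}$. For a Hecke pair $(U,G)$, $\mathcal H(U,G)$ is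 the Hecke algebra over $\mathbb{Z}$ (free $\mathbb{Z}$-module on the double cosets $UgU$ with the standard multiplication); $\mathcal H(U,G_p)$ for a subgroup $U\le G_p\le G$ is regarded as a subalgebra of $\mathcal H(U,G)$. *)

theory Defs
  imports
    "HOL-Analysis.Analysis"
    "HOL-Algebra.QuotRing"
    "HOL-Algebra.Product_Groups"
    "HOL-Algebra.Free_Abelian_Groups"
    "HOL-Computational_Algebra.Squarefree"
begin

section \<open>Orthogonal groups\<close>

definition quad_subst :: "real^'n^'n \<Rightarrow> real^'n^'n \<Rightarrow> real^'n^'n" where
  "quad_subst A B = transpose B ** A ** B"

definition S_mat :: "nat \<Rightarrow> real^3^3" where
  "S_mat N = vector
    [vector [0, 0, 1],
     vector [0, - 2 * real N, 0],
     vector [1, 0, 0]]"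

definition S_hat_mat :: "nat \<Rightarrow> real^5^5" where
  "S_hat_mat N = vector
    [vector [0, 0, 0, 0, 1],
     vector [0, 0, 0, 1, 0],
     vector [0, 0, - 2 * real N, 0, 0],
     vector [0, 1, 0, 0, 0],
     vector [1, 0, 0, 0, 0]]"

definition SO :: "real^'n^'n \<Rightarrow> (real^'n^'n) set" where
  "SO S = {K. det K = 1 \<and> quad_subst S K = S}"

definition SO0 :: "real^'n^'n \<Rightarrow> (real^'n^'n) set" where
  "SO0 S = connected_component_set (SO S) (mat 1)"

definition mats_over :: "real set \<Rightarrow> (real^'n^'n) set" where
  "mats_over R = {K. \<forall>i j. K $ i $ j \<in> R}"

definition matrix_group :: "(real^'n^'n) set \<Rightarrow> (real^'n^'n) monoid" where
  "matrix_group X = \<lparr>carrier = X, monoid.mult = (**), one = mat 1\<rparr>"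

definition SO0_int :: "real^'n^'n \<Rightarrow> (real^'n^'n) set" where
  "SO0_int S = SO0 S \<inter> mats_over \<int>"

definition SO0_rat :: "real^'n^'n \<Rightarrow> (real^'n^'n) monoid" where
  "SO0_rat S = matrix_group (SO0 S \<inter> mats_over \<rat>)"

definition SO0_primary :: "real^'n^'n \<Rightarrow> nat \<Rightarrow> (real^'n^'n) monoid" where
  "SO0_primary S p = matrix_group
     {M \<in> SO0 S \<inter> mats_over \<rat>.
        \<exists>K \<in> mats_over \<int>. \<exists>r::nat. M = (1 / real p ^ r) *\<^sub>R K}"

section \<open>Hecke algebras over the integers\<close>

definition double_coset :: "('g, 'm) monoid_scheme \<Rightarrow> 'g set \<Rightarrow> 'g \<Rightarrow> 'g set" where
  "double_coset G U g = (U #>\<^bsub>G\<^esub> g) <#>\<^bsub>G\<^esub> U"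

definition right_cosets_in :: "('g, 'm) monoid_scheme \<Rightarrow> 'g set \<Rightarrow> 'g set \<Rightarrow> 'g set set" where
  "right_cosets_in G U A = (\<lambda>a. U #>\<^bsub>G\<^esub> a) ` A"

definition hecke_pair :: "'g set \<Rightarrow> ('g, 'm) monoid_scheme \<Rightarrow> bool" where
  "hecke_pair U G \<longleftrightarrow> group G \<and> subgroup U G \<and>
     (\<forall>g \<in> carrier G. finite (right_cosets_in G U (double_coset G U g)))"

definition rep :: "'g set \<Rightarrow> 'g" where
  "rep C = (SOME g. g \<in> C)"

text \<open>
  If \<open>A\<close> and \<open>B\<close> are the disjoint unions of the cosets \<open>U a\<^sub>i\<close> and \<open>U b\<^sub>j\<close>, and \<open>D = U d U\<close>, the
  coefficient of \<open>D\<close> in \<open>A \<cdot> B\<close> is the number of pairs \<open>(i, j)\<close> with \<open>U a\<^sub>i b\<^sub>j = U d\<close>.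
\<close>

definition hecke_coeff :: "('g, 'm) monoid_scheme \<Rightarrow> 'g set \<Rightarrow> 'g set \<Rightarrow> 'g set \<Rightarrow> 'g set \<Rightarrow> nat" where
  "hecke_coeff G U A B D =
     card {(C, C'). C \<in> right_cosets_in G U A \<and> C' \<in> right_cosets_in G U B \<and>
                    U #>\<^bsub>G\<^esub> (rep C \<otimes>\<^bsub>G\<^esub> rep C') = U #>\<^bsub>G\<^esub> rep D}"

definition double_coset_mult ::
    "('g, 'm) monoid_scheme \<Rightarrow> 'g set \<Rightarrow> 'g set \<Rightarrow> 'g set \<Rightarrow> ('g set \<Rightarrow>\<^sub>0 int)" where
  "double_coset_mult G U A B =
     (\<Sum>D \<in> double_coset G U ` (A <#>\<^bsub>G\<^esub> B). frag_cmul (int (hecke_coeff G U A B D)) (frag_of D))"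

definition hecke_algebra :: "'g set \<Rightarrow> ('g, 'm) monoid_scheme \<Rightarrow> ('g set \<Rightarrow>\<^sub>0 int) ring" where
  "hecke_algebra U G =
     \<lparr>carrier = carrier (free_Abelian_group (double_coset G U ` carrier G)),
      monoid.mult = (\<lambda>x y. frag_extend (\<lambda>A. frag_extend (double_coset_mult G U A) y) x),
      one = frag_of U,
      ring.zero = 0,
      ring.add = (+)\<rparr>"

section \<open>Tensor products of arbitrary families of commutative rings\<close>

definition restricted_product :: "'i set \<Rightarrow> ('i \<Rightarrow> ('a, 'm) ring_scheme) \<Rightarrow> ('i \<Rightarrow> 'a) monoid" where
  "restricted_product I A = (product_group I A)
     \<lparr>carrier := {x \<in> \<Pi>\<^sub>E i\<in>I. carrier (A i). finite {i \<in> I. x i \<noteq> \<one>\<^bsub>A i\<^esub>}}\<rparr>"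

definition monoid_ring :: "('a, 'm) monoid_scheme \<Rightarrow> ('a \<Rightarrow>\<^sub>0 int) ring" where
  "monoid_ring M =
     \<lparr>carrier = carrier (free_Abelian_group (carrier M)),
      monoid.mult = (\<lambda>x y. frag_extend (\<lambda>a. frag_extend (\<lambda>b. frag_of (a \<otimes>\<^bsub>M\<^esub> b)) y) x),
      one = frag_of \<one>\<^bsub>M\<^esub>,
      ring.zero = 0,
      ring.add = (+)\<rparr>"

text \<open>
  The tensor product over the integers is the free abelian group on the families \<open>(x\<^sub>i)\<close> with
  \<open>x\<^sub>i = 1\<close> for almost all \<open>i\<close>, modulo additivity in each component (which entails compatibility
  with integer scalars), with componentwise multiplication; for infinite \<open>I\<close> this is the direct
  limit of the tensor products over the finite subsets of \<open>I\<close>. The relators are stable under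
  multiplication by families, so the ideal generated by them is the subgroup generated by them.
\<close>

definition tensor_relators ::
    "'i set \<Rightarrow> ('i \<Rightarrow> ('a, 'm) ring_scheme) \<Rightarrow> (('i \<Rightarrow> 'a) \<Rightarrow>\<^sub>0 int) set" where
  "tensor_relators I A =
     {frag_of (x(i := a \<oplus>\<^bsub>A i\<^esub> b)) - frag_of (x(i := a)) - frag_of (x(i := b)) | x i a b.
        x \<in> carrier (restricted_product I A) \<and> i \<in> I \<and> a \<in> carrier (A i) \<and> b \<in> carrier (A i)}"

definition tensor_ideal ::
    "'i set \<Rightarrow> ('i \<Rightarrow> ('a, 'm) ring_scheme) \<Rightarrow> (('i \<Rightarrow> 'a) \<Rightarrow>\<^sub>0 int) set" where
  "tensor_ideal I A = Idl\<^bsub>monoid_ring (restricted_product I A)\<^esub> (tensor_relators I A)"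

definition tensor_product ::
    "'i set \<Rightarrow> ('i \<Rightarrow> ('a, 'm) ring_scheme) \<Rightarrow> (('i \<Rightarrow> 'a) \<Rightarrow>\<^sub>0 int) set ring" where
  "tensor_product I A = monoid_ring (restricted_product I A) Quot tensor_ideal I A"

definition pure_tensor ::
    "'i set \<Rightarrow> ('i \<Rightarrow> ('a, 'm) ring_scheme) \<Rightarrow> ('i \<Rightarrow> 'a) \<Rightarrow> (('i \<Rightarrow> 'a) \<Rightarrow>\<^sub>0 int) set" where
  "pure_tensor I A x =
     tensor_ideal I A +>\<^bsub>monoid_ring (restricted_product I A)\<^esub> frag_of x"

text \<open>
  \<open>R\<close> coincides with the tensor product of its subrings \<open>A i\<close>: the canonical map sending the pure
  tensor of \<open>(x\<^sub>i)\<close> to the product of the \<open>x\<^sub>i\<close> in \<open>R\<close> is an isomorphism of rings.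
\<close>

definition coincides_with_tensor_product ::
    "('a, 'k) ring_scheme \<Rightarrow> 'i set \<Rightarrow> ('i \<Rightarrow> ('a, 'm) ring_scheme) \<Rightarrow> bool" where
  "coincides_with_tensor_product R I A \<longleftrightarrow>
     (\<forall>i \<in> I. ring (A i) \<and> (\<lambda>a. a) \<in> ring_hom (A i) R) \<and>
     (\<exists>\<phi> \<in> ring_iso (tensor_product I A) R.
        \<forall>x \<in> carrier (restricted_product I A). \<phi> (pure_tensor I A x) = gfinprod R x I)"

end

theory Submission
  imports Defs
begin

text \<open>
  If \<open>N\<close> is squarefree, every element \<open>g\<close> of the rational group is of the form \<open>u t v\<close> with \<open>u, v\<close>
  in the integral group \<open>U\<close> and \<open>t\<close> diagonal, with entries \<open>1/d, 1, d\<close> respectively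
  \<open>1/d, 1/e, 1, e, d\<close> where \<open>e\<close> divides \<open>d\<close>. If \<open>d\<close> is the least denominator of \<open>g\<close>, one finds a
  primitive isotropic vector \<open>x\<close> such that \<open>d g x\<close> is primitive; \<open>U\<close> acts transitively up to sign on
  primitive isotropic vectors, so \<open>g\<close> may be assumed to map the first basis vector to \<open>\<plusminus>1/d\<close> times
  itself, and squarefreeness makes the remaining unipotent factor integral. The denominators of the
  entries and of the \<open>2 \<times> 2\<close> minors of \<open>g\<close> determine \<open>t\<close>.

  Weyl elements conjugate \<open>t\<close> to its inverse, so \<open>U g U = U g\<^sup>-\<^sup>1 U\<close> for all \<open>g\<close>, which makes the Hecke
  algebra commutative. If \<open>g\<close> and \<open>h\<close> have coprime denominators, then uniqueness of \<open>t\<close> gives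
  \<open>g U h \<subseteq> U g h U\<close>, and since a matrix with two coprime denominators is integral, the
  product of the double cosets of \<open>g\<close> and \<open>h\<close> in the Hecke algebra is exactly \<open>U g h U\<close>, from which
  both factors can be recovered. Splitting the entries of \<open>t\<close> into prime powers therefore identifies
  the double cosets with the families of primary double cosets, i.e. with a basis of the tensor product.
\<close>

section \<open>Hecke algebras of Hecke pairs\<close>

text \<open>The obstacle is the identity component. The reduction to diagonal form uses only that a
  matrix preserves the form, so it leaves signs on the diagonal; these are controlled afterwards by
  polynomials in the entries that have no zero on \<open>SO S\<close> and hence stay positive on
  \<open>SO0 S\<close>. Conversely, membership in \<open>SO0 S\<close> is obtained by placing a
  matrix, or its factors, in connected families of isometries through the identity. The ternary
  formulas come from reading x1 x3 - N x2^2 as the determinant of the symmetric matrix with rows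
  (x1, sqrt N x2), (sqrt N x2, x3), on which 2 x 2 matrices g of determinant 1 act by X -> g X g'.
  Commutativity is Gelfand's trick: inversion reverses products yet fixes every double coset.
  Products within one primary component never have to be computed: for the tensor product it
  suffices that basis elements belonging to distinct primes multiply to a basis element, and that
  every basis element arises from exactly one family.\<close>

lemma lookup_sum_frag: "Poly_Mapping.lookup (sum f I) k = (\<Sum>i\<in>I. Poly_Mapping.lookup (f i) k)"
  by (induction I rule: infinite_finite_induct) (auto simp: lookup_add)

lemma lookup_frag_extend:
  "Poly_Mapping.lookup (frag_extend f x) k
   = (\<Sum>i\<in>Poly_Mapping.keys x. Poly_Mapping.lookup x i * Poly_Mapping.lookup (f i) k)"
  by (simp add: frag_extend_def lookup_sum_frag)

locale hecke = group G + subgroup U G for G (structure) and U +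
  assumes fin: "g \<in> carrier G \<Longrightarrow> finite (right_cosets_in G U (double_coset G U g))"
begin

section \<open>Calculus of double cosets and right cosets\<close>

abbreviation dc :: "'a \<Rightarrow> 'a set" where "dc \<equiv> double_coset G U"
abbreviation RC :: "'a set \<Rightarrow> 'a set set" where "RC \<equiv> right_cosets_in G U"

lemma U_carrier: "u \<in> U \<Longrightarrow> u \<in> carrier G"
  by (rule mem_carrier)

lemma cancel_left [simp]:
  assumes "x \<in> carrier G" "y \<in> carrier G"
  shows "inv x \<otimes> (x \<otimes> y) = y" "x \<otimes> (inv x \<otimes> y) = y"
  using assms by (simp_all add: m_assoc[symmetric])

lemma mem_dc: "x \<in> dc g \<longleftrightarrow> (\<exists>u\<in>U. \<exists>v\<in>U. x = u \<otimes> g \<otimes> v)"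
  by (auto simp: double_coset_def r_coset_def set_mult_def)

lemma dcI: "u \<in> U \<Longrightarrow> v \<in> U \<Longrightarrow> u \<otimes> g \<otimes> v \<in> dc g"
  by (auto simp: mem_dc)

lemma dc_carrier: "x \<in> dc g \<Longrightarrow> g \<in> carrier G \<Longrightarrow> x \<in> carrier G"
  by (auto simp: mem_dc U_carrier)

lemma self_dc: "g \<in> carrier G \<Longrightarrow> g \<in> dc g"
  using dcI[of \<one> \<one> g] by auto

lemma dc_left_mult:
  assumes "x \<in> dc g" "g \<in> carrier G" "u \<in> U"
  shows "u \<otimes> x \<in> dc g"
proof -
  obtain a b where ab: "a \<in> U" "b \<in> U" "x = a \<otimes> g \<otimes> b" using assms mem_dc by auto
  then have "u \<otimes> x = (u \<otimes> a) \<otimes> g \<otimes> b" using assms by (simp add: m_assoc U_carrier)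
  then show ?thesis using ab assms dcI[of "u \<otimes> a" b g] by simp
qed

lemma dc_right_mult:
  assumes "x \<in> dc g" "g \<in> carrier G" "u \<in> U"
  shows "x \<otimes> u \<in> dc g"
proof -
  obtain a b where ab: "a \<in> U" "b \<in> U" "x = a \<otimes> g \<otimes> b" using assms mem_dc by auto
  then have "x \<otimes> u = a \<otimes> g \<otimes> (b \<otimes> u)" using assms by (simp add: m_assoc U_carrier)
  then show ?thesis using ab assms dcI[of a "b \<otimes> u" g] by simp
qed

lemma dc_sym:
  assumes "x \<in> dc g" "g \<in> carrier G"
  shows "g \<in> dc x"
proof -
  obtain a b where ab: "a \<in> U" "b \<in> U" "x = a \<otimes> g \<otimes> b" using assms mem_dc by auto
  then have "g = inv a \<otimes> x \<otimes> inv b" using assms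
    by (simp add: m_assoc U_carrier)
  then show ?thesis using ab dcI[of "inv a" "inv b" x] by simp
qed

lemma dc_subset:
  assumes "x \<in> dc g" "g \<in> carrier G"
  shows "dc x \<subseteq> dc g"
proof
  fix y assume "y \<in> dc x"
  then obtain u v where "u \<in> U" "v \<in> U" "y = u \<otimes> x \<otimes> v" by (auto simp: mem_dc)
  then show "y \<in> dc g" using assms dc_left_mult dc_right_mult by auto
qed

lemma dc_eq_iff:
  assumes "g \<in> carrier G" "h \<in> carrier G"
  shows "dc g = dc h \<longleftrightarrow> g \<in> dc h"
  using assms self_dc dc_subset dc_sym dc_carrier by blast

lemma dc_eqI: "x \<in> dc g \<Longrightarrow> g \<in> carrier G \<Longrightarrow> dc x = dc g"
  using dc_eq_iff dc_carrier by blast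

lemma mem_dc_iff_eq: "x \<in> carrier G \<Longrightarrow> g \<in> carrier G \<Longrightarrow> x \<in> dc g \<longleftrightarrow> dc x = dc g"
  using dc_eq_iff by blast

lemma dc_mult_U:
  assumes "u \<in> U" "v \<in> U" "g \<in> carrier G"
  shows "dc (u \<otimes> g \<otimes> v) = dc g" "dc (u \<otimes> g) = dc g" "dc (g \<otimes> v) = dc g"
  using dc_eqI[OF dcI[OF assms(1,2)] assms(3)] dc_eqI[OF dc_left_mult[OF self_dc] assms(3)]
    dc_eqI[OF dc_right_mult[OF self_dc] assms(3)] assms by blast+

lemma dc_one: "dc \<one> = U"
proof
  show "dc \<one> \<subseteq> U" by (auto simp: mem_dc U_carrier)
  show "U \<subseteq> dc \<one>" using dcI[of _ \<one> \<one>] by (auto simp: U_carrier)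
qed

lemma dc_U: "u \<in> U \<Longrightarrow> dc u = U"
  using dc_mult_U(2)[of u \<one> \<one>] by (simp add: dc_one U_carrier)

lemma mem_RC: "C \<in> RC A \<longleftrightarrow> (\<exists>a\<in>A. C = U #> a)"
  by (auto simp: right_cosets_in_def)

lemma coset_eq_iff:
  assumes "a \<in> carrier G" "b \<in> carrier G"
  shows "U #> a = U #> b \<longleftrightarrow> a \<otimes> inv b \<in> U"
proof
  assume h: "U #> a = U #> b"
  have "a \<in> U #> a" by (rule rcos_self[OF assms(1) subgroup_axioms])
  then have "a \<in> U #> b" by (simp only: h)
  then obtain u where "u \<in> U" "a = u \<otimes> b" unfolding r_coset_def by blast
  then show "a \<otimes> inv b \<in> U" using assms by (simp add: m_assoc U_carrier)
next
  assume h: "a \<otimes> inv b \<in> U"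
  define u where "u = a \<otimes> inv b"
  have u: "u \<in> U" using h by (simp add: u_def)
  have a: "a = u \<otimes> b" using assms unfolding u_def by (simp add: m_assoc)
  have sub: "U #> (v \<otimes> x) \<subseteq> U #> x" if "v \<in> U" "x \<in> carrier G" for v x
  proof
    fix y assume "y \<in> U #> (v \<otimes> x)"
    then obtain w where w: "w \<in> U" "y = w \<otimes> (v \<otimes> x)" by (auto simp: r_coset_def)
    then have "y = (w \<otimes> v) \<otimes> x" using that by (simp add: m_assoc U_carrier)
    moreover have "w \<otimes> v \<in> U" using w that by simp
    ultimately show "y \<in> U #> x" unfolding r_coset_def by blast
  qed
  have "inv u \<otimes> a = b" using u assms a by (simp add: U_carrier)
  then show "U #> a = U #> b" using sub[OF u assms(2)] sub[OF m_inv_closed[OF u] assms(1)]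
    unfolding a[symmetric] by (simp only: subset_antisym)
qed

lemma coset_eq_mult: 
  assumes "u \<in> U" "a \<in> carrier G" shows "U #> (u \<otimes> a) = U #> a"
  using assms coset_eq_iff[of "u \<otimes> a" a] by (simp add: m_assoc U_carrier)

lemma rep_coset:
  assumes "a \<in> carrier G"
  shows "\<exists>u\<in>U. rep (U #> a) = u \<otimes> a"
proof -
  have "a \<in> U #> a" using assms by (metis rcos_self subgroup_axioms)
  then have "rep (U #> a) \<in> U #> a" unfolding rep_def by (rule someI)
  then show ?thesis by (auto simp: r_coset_def)
qed

lemma rep_dc:
  assumes "g \<in> carrier G"
  shows "rep (dc g) \<in> dc g"
  using self_dc[OF assms] unfolding rep_def by (rule someI)

lemma rcosets_rep:
  assumes "C \<in> rcosets U"
  shows "rep C \<in> carrier G" "U #> rep C = C"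
proof -
  obtain a where a: "a \<in> carrier G" "C = U #> a" using assms by (auto simp: RCOSETS_def)
  then obtain u where "u \<in> U" "rep C = u \<otimes> a" using rep_coset by blast
  then show "rep C \<in> carrier G" "U #> rep C = C" using a by (auto simp: U_carrier coset_eq_mult)
qed

lemma RC_rcosets: "g \<in> carrier G \<Longrightarrow> RC (dc g) \<subseteq> rcosets U"
  using dc_carrier by (fastforce simp: mem_RC RCOSETS_def)

lemma coset_shift:
  assumes "a \<in> carrier G" "b \<in> carrier G" "c \<in> carrier G"
  shows "U #> (a \<otimes> b) = U #> c \<longleftrightarrow> U #> a = U #> (c \<otimes> inv b)"
  using assms by (simp add: coset_eq_iff inv_mult_group m_assoc)

lemma RC_iff:
  assumes "C \<in> rcosets U" "g \<in> carrier G"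
  shows "C \<in> RC (dc g) \<longleftrightarrow> rep C \<in> dc g"
proof
  assume "C \<in> RC (dc g)"
  then obtain a where a: "a \<in> dc g" "C = U #> a" by (auto simp: mem_RC)
  then obtain u where "u \<in> U" "rep C = u \<otimes> a" using rep_coset dc_carrier assms by blast
  then show "rep C \<in> dc g" using a assms dc_left_mult by auto
next
  assume "rep C \<in> dc g"
  then show "C \<in> RC (dc g)" using rcosets_rep[OF assms(1)] by (auto simp: mem_RC)
qed

text \<open>These are the functions that descend to right cosets \<open>U #> g\<close>, so that
  their value at \<open>rep C\<close> does not depend on the choice made by
  \<open>rep\<close>.\<close>

definition left_inv :: "('a \<Rightarrow> int) \<Rightarrow> bool" where
  "left_inv F \<longleftrightarrow> (\<forall>u\<in>U. \<forall>g\<in>carrier G. F (u \<otimes> g) = F g)"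

lemma left_inv_rep:
  assumes "left_inv F" "a \<in> carrier G"
  shows "F (rep (U #> a)) = F a"
  using assms rep_coset[of a] unfolding left_inv_def by fastforce

lemma rcosets_translate:
  assumes "C \<in> rcosets U" "h \<in> carrier G"
  shows "C #> h = U #> (rep C \<otimes> h)" "C #> h \<in> rcosets U" "(C #> h) #> inv h = C"
proof -
  obtain a where a: "a \<in> carrier G" "C = U #> a" using assms by (auto simp: RCOSETS_def)
  have s: "U \<subseteq> carrier G" using U_carrier by blast
  show "C #> h = U #> (rep C \<otimes> h)"
    using rcosets_rep[OF assms(1)] assms s by (metis coset_mult_assoc)
  show "C #> h \<in> rcosets U" using a assms s by (auto simp: RCOSETS_def coset_mult_assoc)
  show "(C #> h) #> inv h = C" using a assms s by (simp add: coset_mult_assoc m_assoc)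
qed

text \<open>Change of variable in a sum over right cosets: translation by \<open>h\<close> is
  injective on them, and left invariance absorbs the element of \<open>U\<close> between
  \<open>rep (C #> h)\<close> and \<open>rep C \<otimes> h\<close>.\<close>

lemma sum_translate:
  assumes "left_inv F" "h \<in> carrier G" "X \<subseteq> rcosets U"
  shows "(\<Sum>C\<in>(\<lambda>C. C #> h) ` X. F (rep C)) = (\<Sum>C\<in>X. F (rep C \<otimes> h))"
proof -
  have "inj_on (\<lambda>C. C #> h) X"
  proof (rule inj_onI)
    fix C D assume h: "C \<in> X" "D \<in> X" "C #> h = D #> h"
    have "C = C #> h #> inv h" using rcosets_translate(3)[OF subsetD[OF assms(3) h(1)] assms(2)] by (rule sym)
    also have "\<dots> = D" unfolding h(3) by (rule rcosets_translate(3)[OF subsetD[OF assms(3) h(2)] assms(2)])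
    finally show "C = D" .
  qed
  then have "(\<Sum>C\<in>(\<lambda>C. C #> h) ` X. F (rep C)) = (\<Sum>C\<in>X. F (rep (C #> h)))"
    by (simp add: sum.reindex)
  also have "\<dots> = (\<Sum>C\<in>X. F (rep C \<otimes> h))"
    using assms rcosets_translate(1) rcosets_rep left_inv_rep[OF assms(1)]
    by (intro sum.cong) (auto simp: subset_iff)
  finally show ?thesis .
qed

abbreviation H where "H \<equiv> hecke_algebra U G"

text \<open>
  Elements of the Hecke algebra are viewed as \<open>U\<close>-biinvariant functions on \<open>G\<close>; the product
  becomes convolution over the right cosets of \<open>U\<close>.
\<close>

definition val :: "('a set \<Rightarrow>\<^sub>0 int) \<Rightarrow> 'a \<Rightarrow> int" where
  "val x g = Poly_Mapping.lookup x (dc g)"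

text \<open>Right cosets rather than double cosets are collected because convolution sums run over
  right cosets; that this set is finite is the Hecke condition \<open>fin\<close>.\<close>

definition supp :: "('a set \<Rightarrow>\<^sub>0 int) \<Rightarrow> 'a set set" where
  "supp x = (\<Union>B\<in>Poly_Mapping.keys x. RC B)"

lemma carrier_H: "x \<in> carrier H \<longleftrightarrow> Poly_Mapping.keys x \<subseteq> dc ` carrier G"
  by (simp add: hecke_algebra_def)

lemma H_eqI:
  assumes "x \<in> carrier H" "y \<in> carrier H" "\<And>g. g \<in> carrier G \<Longrightarrow> val x g = val y g"
  shows "x = y"
proof (rule poly_mapping_eqI)
  fix k show "Poly_Mapping.lookup x k = Poly_Mapping.lookup y k"
  proof (cases "k \<in> dc ` carrier G")
    case True then show ?thesis using assms(3) by (auto simp: val_def)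
  next
    case False
    then have "k \<notin> Poly_Mapping.keys x" "k \<notin> Poly_Mapping.keys y"
      using assms(1,2) by (auto simp: carrier_H)
    then show ?thesis by (simp add: in_keys_iff)
  qed
qed

lemma val_mult_U:
  assumes "u \<in> U" "v \<in> U" "g \<in> carrier G"
  shows "val x (u \<otimes> g \<otimes> v) = val x g" "val x (u \<otimes> g) = val x g" "val x (g \<otimes> v) = val x g"
  using assms by (simp_all add: val_def dc_mult_U)

lemma finite_supp: "x \<in> carrier H \<Longrightarrow> finite (supp x)"
  by (auto simp: supp_def carrier_H intro!: fin)

lemma supp_rcosets: "x \<in> carrier H \<Longrightarrow> supp x \<subseteq> rcosets U"
  using RC_rcosets unfolding supp_def carrier_H by blast

lemma supp_iff:
  assumes "x \<in> carrier H" "C \<in> rcosets U"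
  shows "C \<in> supp x \<longleftrightarrow> val x (rep C) \<noteq> 0"
proof -
  have r: "rep C \<in> carrier G" using assms rcosets_rep by auto
  have "C \<in> supp x \<longleftrightarrow> (\<exists>B\<in>Poly_Mapping.keys x. rep C \<in> B)"
  proof -
    have "C \<in> RC B \<longleftrightarrow> rep C \<in> B" if "B \<in> Poly_Mapping.keys x" for B
      using that assms(1) RC_iff[OF assms(2)] unfolding carrier_H by auto
    then show ?thesis by (simp add: supp_def)
  qed
  also have "\<dots> \<longleftrightarrow> dc (rep C) \<in> Poly_Mapping.keys x"
    using assms(1) r self_dc mem_dc_iff_eq[OF r] by (fastforce simp: carrier_H)
  finally show ?thesis by (simp add: val_def in_keys_iff)
qed

text \<open>In a pair \<open>(C, C')\<close> counted by \<open>hecke_coeff\<close> the first coset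
  is forced to be \<open>U #> (d \<otimes> inv (rep C'))\<close>, so counting pairs amounts to
  counting second members. The passage from the chosen representative
  \<open>d = u \<otimes> g \<otimes> v\<close> of \<open>dc g\<close> to \<open>g\<close> itself is
  a right translation of cosets by \<open>v\<close>.\<close>

lemma hecke_coeff_eq:
  assumes "a \<in> carrier G" "b \<in> carrier G" "g \<in> carrier G"
  shows "hecke_coeff G U (dc a) (dc b) (dc g) = card {C \<in> RC (dc b). g \<otimes> inv (rep C) \<in> dc a}"
proof -
  define d where "d = rep (dc g)"
  obtain u v where uv: "u \<in> U" "v \<in> U" "d = u \<otimes> g \<otimes> v" using rep_dc[OF assms(3)] mem_dc d_def by auto
  note [simp] = U_carrier[OF uv(1)] U_carrier[OF uv(2)]
  have d: "d \<in> carrier G" using uv assms by simp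
  let ?P = "{(C, C'). C \<in> RC (dc a) \<and> C' \<in> RC (dc b) \<and> U #> (rep C \<otimes> rep C') = U #> d}"
  let ?Q = "{C \<in> RC (dc b). d \<otimes> inv (rep C) \<in> dc a}"
  let ?R = "{C \<in> RC (dc b). g \<otimes> inv (rep C) \<in> dc a}"
  have "bij_betw (\<lambda>C. (U #> (d \<otimes> inv (rep C)), C)) ?Q ?P"
  proof (rule bij_betw_byWitness[where f' = snd])
    show "\<forall>C\<in>?Q. snd (U #> (d \<otimes> inv (rep C)), C) = C" by simp
    show "\<forall>p\<in>?P. (U #> (d \<otimes> inv (rep (snd p))), snd p) = p"
    proof (clarsimp)
      fix C C' assume h: "C \<in> RC (dc a)" "C' \<in> RC (dc b)" "U #> (rep C \<otimes> rep C') = U #> d"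
      have c: "C \<in> rcosets U" "C' \<in> rcosets U" using h RC_rcosets assms by auto
      note r = rcosets_rep[OF c(1)] rcosets_rep[OF c(2)]
      have "U #> rep C = U #> (d \<otimes> inv (rep C'))"
        using h(3) coset_shift[OF r(1,3) d] by blast
      then show "U #> (d \<otimes> inv (rep C')) = C" using r by simp
    qed
    show "(\<lambda>C. (U #> (d \<otimes> inv (rep C)), C)) ` ?Q \<subseteq> ?P"
    proof (clarsimp, intro conjI)
      fix C assume h: "C \<in> RC (dc b)" "d \<otimes> inv (rep C) \<in> dc a"
      have c: "C \<in> rcosets U" using h RC_rcosets assms by auto
      note r = rcosets_rep[OF c]
      show "U #> (d \<otimes> inv (rep C)) \<in> RC (dc a)" using h by (auto simp: mem_RC)
      obtain w where w: "w \<in> U" "rep (U #> (d \<otimes> inv (rep C))) = w \<otimes> (d \<otimes> inv (rep C))"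
        using rep_coset[of "d \<otimes> inv (rep C)"] d r(1) by auto
      show "U #> (rep (U #> (d \<otimes> inv (rep C))) \<otimes> rep C) = U #> d"
        using w d r coset_eq_mult[OF w(1)] by (simp add: m_assoc U_carrier)
    qed
    show "snd ` ?P \<subseteq> ?Q"
    proof (clarsimp)
      fix C C' assume h: "C \<in> RC (dc a)" "C' \<in> RC (dc b)" "U #> (rep C \<otimes> rep C') = U #> d"
      have c: "C \<in> rcosets U" "C' \<in> rcosets U" using h RC_rcosets assms by auto
      note r = rcosets_rep[OF c(1)] rcosets_rep[OF c(2)]
      have dc': "d \<otimes> inv (rep C') \<in> carrier G" using r d by simp
      have e: "U #> (d \<otimes> inv (rep C')) = C"
        using h(3) coset_shift[OF r(1,3) d] r(2) by metis
      obtain w where w: "w \<in> U" "rep C = w \<otimes> (d \<otimes> inv (rep C'))"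
        using rep_coset[OF dc'] unfolding e by blast
      have "d \<otimes> inv (rep C') = inv w \<otimes> rep C" unfolding w(2) using w(1) dc' by (simp add: U_carrier)
      moreover have "rep C \<in> dc a" using h c RC_iff assms by blast
      ultimately show "d \<otimes> inv (rep C') \<in> dc a" using w(1) dc_left_mult[OF _ assms(1) m_inv_closed] by simp
    qed
  qed
  then have 1: "card ?P = card ?Q" by (simp add: bij_betw_same_card)
  have gv: "d \<otimes> inv (rep (C #> v)) \<in> dc a \<longleftrightarrow> g \<otimes> inv (rep C) \<in> dc a" if C: "C \<in> rcosets U" for C
  proof -
    note r = rcosets_rep(1)[OF C]
    obtain w where w: "w \<in> U" "rep (C #> v) = w \<otimes> (rep C \<otimes> v)"
      using rep_coset[of "rep C \<otimes> v"] r rcosets_translate(1)[OF C, of v] by auto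
    note [simp] = U_carrier[OF w(1)]
    have "d \<otimes> inv (w \<otimes> (rep C \<otimes> v)) = u \<otimes> (g \<otimes> inv (rep C)) \<otimes> inv w"
      unfolding uv(3) using r assms(3) by (simp add: inv_mult_group m_assoc)
    then have "dc (d \<otimes> inv (rep (C #> v))) = dc (g \<otimes> inv (rep C))"
      unfolding w(2) using uv(1) w(1) r assms(3) by (simp add: dc_mult_U)
    moreover have "rep (C #> v) \<in> carrier G" unfolding w(2) using r by simp
    ultimately show ?thesis using r assms d by (simp add: mem_dc_iff_eq)
  qed
  have rb: "C #> w \<in> RC (dc b)" if C: "C \<in> RC (dc b)" and w: "w \<in> U" for C w
  proof -
    have c: "C \<in> rcosets U" using C RC_rcosets assms by auto
    have "rep C \<otimes> w \<in> dc b" using C RC_iff[OF c assms(2)] w dc_right_mult assms by blast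
    then show ?thesis unfolding rcosets_translate(1)[OF c U_carrier[OF w]] mem_RC by blast
  qed
  have "bij_betw (\<lambda>C. C #> v) ?R ?Q"
  proof (rule bij_betw_byWitness[where f' = "\<lambda>C. C #> inv v"])
    have rc: "C \<in> RC (dc b) \<Longrightarrow> C \<in> rcosets U" for C using RC_rcosets assms by auto
    show "\<forall>C\<in>?R. C #> v #> inv v = C" using rcosets_translate(3) rc by simp
    show *: "\<forall>C\<in>?Q. C #> inv v #> v = C" using rcosets_translate(3)[of _ "inv v"] rc by simp
    show "(\<lambda>C. C #> v) ` ?R \<subseteq> ?Q" using rb[OF _ uv(2)] gv[OF rc] by blast
    show "(\<lambda>C. C #> inv v) ` ?Q \<subseteq> ?R"
    proof clarsimp
      fix C assume h: "C \<in> RC (dc b)" "d \<otimes> inv (rep C) \<in> dc a"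
      have h1: "C #> inv v \<in> RC (dc b)" using rb[OF h(1)] uv(2) by simp
      have "C #> inv v #> v = C" using * h by blast
      then show "C #> inv v \<in> RC (dc b) \<and> g \<otimes> inv (rep (C #> inv v)) \<in> dc a"
        using gv[OF rc[OF h1]] h h1 by simp
    qed
  qed
  then have "card ?R = card ?Q" by (simp add: bij_betw_same_card)
  then show ?thesis using 1 by (simp add: hecke_coeff_def d_def)
qed

text \<open>Without finiteness the sum that defines \<open>double_coset_mult\<close> would be 0 by
  convention. In a product \<open>x \<otimes> y\<close> the unit that turns \<open>y\<close> into
  the representative of its coset is moved over to \<open>x\<close>, so finitely many pairs of
  representatives meet all double cosets.\<close>

lemma set_mult_dc_finite:
  assumes "a \<in> carrier G" "b \<in> carrier G"
  shows "finite (dc ` (dc a <#> dc b))"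
proof (rule finite_subset)
  show "finite ((\<lambda>(C, C'). dc (rep C \<otimes> rep C')) ` (RC (dc a) \<times> RC (dc b)))"
    using fin assms by auto
  show "dc ` (dc a <#> dc b) \<subseteq> (\<lambda>(C, C'). dc (rep C \<otimes> rep C')) ` (RC (dc a) \<times> RC (dc b))"
  proof
    fix D assume "D \<in> dc ` (dc a <#> dc b)"
    then obtain x y where xy: "x \<in> dc a" "y \<in> dc b" "D = dc (x \<otimes> y)" by (auto simp: set_mult_def)
    have c: "x \<in> carrier G" "y \<in> carrier G" using xy dc_carrier assms by auto
    obtain u where u: "u \<in> U" "rep (U #> y) = u \<otimes> y" using rep_coset c by blast
    have xu: "x \<otimes> inv u \<in> dc a" using xy u dc_right_mult assms by auto
    obtain w where w: "w \<in> U" "rep (U #> (x \<otimes> inv u)) = w \<otimes> (x \<otimes> inv u)"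
      using rep_coset[of "x \<otimes> inv u"] c U_carrier[OF u(1)] by auto
    have "rep (U #> (x \<otimes> inv u)) \<otimes> rep (U #> y) = w \<otimes> (x \<otimes> y)"
      using u w c by (simp add: U_carrier m_assoc)
    then have "dc (rep (U #> (x \<otimes> inv u)) \<otimes> rep (U #> y)) = D" using w c xy dc_mult_U by simp
    moreover have "U #> (x \<otimes> inv u) \<in> RC (dc a)" "U #> y \<in> RC (dc b)" using xu xy by (auto simp: mem_RC)
    ultimately show "D \<in> (\<lambda>(C, C'). dc (rep C \<otimes> rep C')) ` (RC (dc a) \<times> RC (dc b))" by force
  qed
qed

lemma lookup_dcm:
  assumes "a \<in> carrier G" "b \<in> carrier G" "g \<in> carrier G"
  shows "Poly_Mapping.lookup (double_coset_mult G U (dc a) (dc b)) (dc g)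
    = int (card {C \<in> RC (dc b). g \<otimes> inv (rep C) \<in> dc a})"
proof -
  have "Poly_Mapping.lookup (double_coset_mult G U (dc a) (dc b)) (dc g)
    = (\<Sum>D\<in>dc ` (dc a <#> dc b). if D = dc g then int (hecke_coeff G U (dc a) (dc b) D) else 0)"
    unfolding double_coset_mult_def by (auto simp: lookup_sum_frag intro!: sum.cong)
  also have "\<dots> = (if dc g \<in> dc ` (dc a <#> dc b) then int (hecke_coeff G U (dc a) (dc b) (dc g)) else 0)"
    using set_mult_dc_finite assms by (simp add: sum.delta')
  also have "\<dots> = int (card {C \<in> RC (dc b). g \<otimes> inv (rep C) \<in> dc a})"
  proof (cases "{C \<in> RC (dc b). g \<otimes> inv (rep C) \<in> dc a} = {}")
    case True then show ?thesis using hecke_coeff_eq[OF assms] by (simp only: True card.empty of_nat_0 if_cancel)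
  next
    case False
    then obtain C where C: "C \<in> RC (dc b)" "g \<otimes> inv (rep C) \<in> dc a" by auto
    then have c: "C \<in> rcosets U" using RC_rcosets assms by auto
    have "g = (g \<otimes> inv (rep C)) \<otimes> rep C" using rcosets_rep[OF c] assms by (simp add: m_assoc)
    moreover have "rep C \<in> dc b" using C c RC_iff assms by auto
    ultimately have "g \<in> dc a <#> dc b" using C by (auto simp: set_mult_def)
    then show ?thesis using hecke_coeff_eq assms by auto
  qed
  finally show ?thesis .
qed

lemma keys_dcm:
  assumes "a \<in> carrier G" "b \<in> carrier G"
  shows "Poly_Mapping.keys (double_coset_mult G U (dc a) (dc b)) \<subseteq> dc ` carrier G"
proof -
  have "double_coset_mult G U (dc a) (dc b) \<in> carrier (free_Abelian_group (dc ` carrier G))"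
    unfolding double_coset_mult_def
  proof (rule sum_closed_free_Abelian_group)
    fix D assume "D \<in> dc ` (dc a <#> dc b)"
    then have "D \<in> dc ` carrier G" using assms dc_carrier by (force simp: set_mult_def)
    then show "frag_cmul (int (hecke_coeff G U (dc a) (dc b) D)) (frag_of D)
       \<in> carrier (free_Abelian_group (dc ` carrier G))"
      using keys_cmul by fastforce
  qed
  then show ?thesis by simp
qed

section \<open>Convolution and the ring axioms\<close>

lemma mult_H: "x \<otimes>\<^bsub>H\<^esub> y = frag_extend (\<lambda>A. frag_extend (double_coset_mult G U A) y) x"
  by (simp add: hecke_algebra_def)

lemma mult_H_closed:
  assumes "x \<in> carrier H" "y \<in> carrier H"
  shows "x \<otimes>\<^bsub>H\<^esub> y \<in> carrier H"
proof -
  have "Poly_Mapping.keys (x \<otimes>\<^bsub>H\<^esub> y) \<subseteq>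
     (\<Union>A\<in>Poly_Mapping.keys x. \<Union>B\<in>Poly_Mapping.keys y. Poly_Mapping.keys (double_coset_mult G U A B))"
    unfolding mult_H by (intro order_trans[OF keys_frag_extend] UN_mono order_refl)
  also have "\<dots> \<subseteq> dc ` carrier G"
    using assms keys_dcm unfolding carrier_H by (fastforce simp: subset_iff image_iff)
  finally show ?thesis by (simp add: carrier_H)
qed

text \<open>The convolution formula: the value of \<open>x y\<close> at \<open>g\<close> is the sum
  of \<open>x(g c^-1) y(c)\<close>. The index set \<open>X\<close> may exceed the support of
  \<open>y\<close>, because several such sums must later be taken over one common set of
  cosets.\<close>

lemma val_mult:
  assumes x: "x \<in> carrier H" and y: "y \<in> carrier H" and g: "g \<in> carrier G"
    and X: "finite X" "X \<subseteq> rcosets U" "supp y \<subseteq> X"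
  shows "val (x \<otimes>\<^bsub>H\<^esub> y) g = (\<Sum>C\<in>X. val x (g \<otimes> inv (rep C)) * val y (rep C))"
proof -
  let ?l = "Poly_Mapping.lookup" and ?k = "Poly_Mapping.keys"
  have kx: "A \<in> ?k x \<Longrightarrow> \<exists>a\<in>carrier G. A = dc a" for A using x by (auto simp: carrier_H)
  have ky: "A \<in> ?k y \<Longrightarrow> \<exists>a\<in>carrier G. A = dc a" for A using y by (auto simp: carrier_H)
  have fRC: "B \<in> ?k y \<Longrightarrow> finite (RC B)" for B using ky fin by auto
  have cRC: "B \<in> ?k y \<Longrightarrow> C \<in> RC B \<Longrightarrow> C \<in> rcosets U" for B C using ky RC_rcosets by blast
  have vx: "(\<Sum>A\<in>?k x. ?l x A * (if h \<in> A then 1 else 0)) = val x h" if h: "h \<in> carrier G" for h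
  proof -
    have "(\<Sum>A\<in>?k x. ?l x A * (if h \<in> A then 1 else 0)) = (\<Sum>A\<in>?k x. if A = dc h then ?l x A else 0)"
      using kx h mem_dc_iff_eq by (intro sum.cong) fastforce+
    also have "\<dots> = val x h" by (simp add: sum.delta' val_def in_keys_iff)
    finally show ?thesis .
  qed
  have "val (x \<otimes>\<^bsub>H\<^esub> y) g = (\<Sum>A\<in>?k x. \<Sum>B\<in>?k y. ?l x A * (?l y B * ?l (double_coset_mult G U A B) (dc g)))"
    unfolding val_def mult_H lookup_frag_extend by (simp add: sum_distrib_left)
  also have "\<dots> = (\<Sum>A\<in>?k x. \<Sum>B\<in>?k y. \<Sum>C\<in>RC B. ?l x A * (?l y B * (if g \<otimes> inv (rep C) \<in> A then 1 else 0)))"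
  proof (intro sum.cong refl)
    fix A B assume AB: "A \<in> ?k x" "B \<in> ?k y"
    obtain a b where "a \<in> carrier G" "A = dc a" "b \<in> carrier G" "B = dc b"
      using kx[OF AB(1)] ky[OF AB(2)] by blast
    then have "?l (double_coset_mult G U A B) (dc g) = int (card {C \<in> RC B. g \<otimes> inv (rep C) \<in> A})"
      using lookup_dcm g by simp
    also have "\<dots> = (\<Sum>C\<in>RC B. if g \<otimes> inv (rep C) \<in> A then 1 else 0)"
      using fRC[OF AB(2)] by (simp add: sum.If_cases Int_def)
    finally show "?l x A * (?l y B * ?l (double_coset_mult G U A B) (dc g)) = (\<Sum>C\<in>RC B. ?l x A * (?l y B * (if g \<otimes> inv (rep C) \<in> A then 1 else 0)))"
      by (simp add: sum_distrib_left)
  qed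
  also have "\<dots> = (\<Sum>B\<in>?k y. \<Sum>C\<in>RC B. \<Sum>A\<in>?k x. ?l x A * (?l y B * (if g \<otimes> inv (rep C) \<in> A then 1 else 0)))"
    by (subst sum.swap, rule sum.cong[OF refl], subst sum.swap, rule refl)
  also have "\<dots> = (\<Sum>B\<in>?k y. \<Sum>C\<in>RC B. val x (g \<otimes> inv (rep C)) * val y (rep C))"
  proof (intro sum.cong refl)
    fix B C assume BC: "B \<in> ?k y" "C \<in> RC B"
    have c: "C \<in> rcosets U" using BC cRC by auto
    note r = rcosets_rep[OF c]
    have "dc (rep C) = B" using ky[OF BC(1)] BC c RC_iff dc_eqI by blast
    then have "?l y B = val y (rep C)" by (simp add: val_def)
    then have "(\<Sum>A\<in>?k x. ?l x A * (?l y B * (if g \<otimes> inv (rep C) \<in> A then 1 else 0)))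
       = val y (rep C) * (\<Sum>A\<in>?k x. ?l x A * (if g \<otimes> inv (rep C) \<in> A then 1 else 0))"
      by (simp add: sum_distrib_left mult_ac)
    then show "(\<Sum>A\<in>?k x. ?l x A * (?l y B * (if g \<otimes> inv (rep C) \<in> A then 1 else 0)))
       = val x (g \<otimes> inv (rep C)) * val y (rep C)" using vx r g by simp
  qed
  also have "\<dots> = (\<Sum>C\<in>supp y. val x (g \<otimes> inv (rep C)) * val y (rep C))"
    unfolding supp_def
  proof (rule sum.UNION_disjoint[symmetric])
    show "\<forall>B\<in>?k y. \<forall>B'\<in>?k y. B \<noteq> B' \<longrightarrow> RC B \<inter> RC B' = {}"
    proof (intro ballI impI equals0I)
      fix B B' C assume h: "B \<in> ?k y" "B' \<in> ?k y" "B \<noteq> B'" "C \<in> RC B \<inter> RC B'"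
      then have c: "C \<in> rcosets U" using cRC by auto
      obtain b b' where b: "b \<in> carrier G" "B = dc b" "b' \<in> carrier G" "B' = dc b'"
        using ky[OF h(1)] ky[OF h(2)] by blast
      have "rep C \<in> dc b" "rep C \<in> dc b'"
        using h(4) RC_iff[OF c b(1)] RC_iff[OF c b(3)] b by simp_all
      then have "dc (rep C) = B" "dc (rep C) = B'"
        unfolding b(2,4) using dc_eqI b(1,3) by metis+
      then show False using h(3) by simp
    qed
  qed (use fRC in auto)
  also have "\<dots> = (\<Sum>C\<in>X. val x (g \<otimes> inv (rep C)) * val y (rep C))"
    using X supp_iff[OF y] by (intro sum.mono_neutral_left) auto
  finally show ?thesis .
qed

lemma val_one: "g \<in> carrier G \<Longrightarrow> val (frag_of U) g = (if g \<in> U then 1 else 0)"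
  using dc_U self_dc by (auto simp: val_def)

lemma one_H: "\<one>\<^bsub>H\<^esub> = frag_of U" and zero_H: "\<zero>\<^bsub>H\<^esub> = 0" and add_H: "x \<oplus>\<^bsub>H\<^esub> y = x + y"
  by (simp_all add: hecke_algebra_def)

lemma frag_of_U_closed: "frag_of U \<in> carrier H"
  using dc_one by (fastforce simp: carrier_H)

lemma U_rcosets: "U \<in> rcosets U"
proof -
  have "U #> \<one> = U" using coset_mult_one[of U] U_carrier by blast
  then show ?thesis unfolding RCOSETS_def by blast
qed

lemma mult_H_assoc:
  assumes x: "x \<in> carrier H" and y: "y \<in> carrier H" and z: "z \<in> carrier H"
  shows "x \<otimes>\<^bsub>H\<^esub> y \<otimes>\<^bsub>H\<^esub> z = x \<otimes>\<^bsub>H\<^esub> (y \<otimes>\<^bsub>H\<^esub> z)"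
proof (rule H_eqI)
  show "x \<otimes>\<^bsub>H\<^esub> y \<otimes>\<^bsub>H\<^esub> z \<in> carrier H" "x \<otimes>\<^bsub>H\<^esub> (y \<otimes>\<^bsub>H\<^esub> z) \<in> carrier H"
    using assms mult_H_closed by auto
  fix g assume g: "g \<in> carrier G"
  define tr where "tr C = (\<lambda>B. B #> rep C) ` supp y" for C
  \<comment> \<open>\<open>X\<close> contains the support of \<open>y z\<close>, for the outer
    convolution, and for each \<open>C\<close> in the support of \<open>z\<close> the translate of
    the support of \<open>y\<close> by \<open>rep C\<close>, for the substitution in
    \<open>inner\<close>.\<close>
  define X where "X = supp (y \<otimes>\<^bsub>H\<^esub> z) \<union> (\<Union>C\<in>supp z. tr C)"
  note Z = finite_supp[OF z] supp_rcosets[OF z]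
  note Y = finite_supp[OF y] supp_rcosets[OF y]
  have zr: "C \<in> supp z \<Longrightarrow> rep C \<in> carrier G" for C using Z rcosets_rep by auto
  have Xf: "finite X" using Z Y mult_H_closed[OF y z] finite_supp by (auto simp: X_def tr_def)
  have tr_r: "C \<in> supp z \<Longrightarrow> tr C \<subseteq> rcosets U" for C
    using Y zr rcosets_translate(2) unfolding tr_def by blast
  have Xr: "X \<subseteq> rcosets U"
    using tr_r supp_rcosets[OF mult_H_closed[OF y z]] unfolding X_def by blast
  have Xrep: "E \<in> X \<Longrightarrow> rep E \<in> carrier G" for E using Xr rcosets_rep by auto
  have inner: "(\<Sum>E\<in>X. val x (g \<otimes> inv (rep E)) * val y (rep E \<otimes> inv (rep C)))
      = (\<Sum>B\<in>supp y. val x (g \<otimes> inv (rep C) \<otimes> inv (rep B)) * val y (rep B))"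
    if C: "C \<in> supp z" for C
  proof -
    define F where "F e = val x (g \<otimes> inv e) * val y (e \<otimes> inv (rep C))" for e
    have c: "rep C \<in> carrier G" using zr C by auto
    have lF: "left_inv F" unfolding left_inv_def F_def
    proof (intro ballI)
      fix u e assume u: "u \<in> U" and e: "e \<in> carrier G"
      have "g \<otimes> inv (u \<otimes> e) = (g \<otimes> inv e) \<otimes> inv u" "u \<otimes> e \<otimes> inv (rep C) = u \<otimes> (e \<otimes> inv (rep C))"
        using u e c g by (simp_all add: U_carrier inv_mult_group m_assoc)
      then show "val x (g \<otimes> inv (u \<otimes> e)) * val y (u \<otimes> e \<otimes> inv (rep C)) = val x (g \<otimes> inv e) * val y (e \<otimes> inv (rep C))"
        using u e c g by (simp add: val_mult_U)
    qed
    have "(\<Sum>E\<in>X. F (rep E)) = (\<Sum>E\<in>tr C. F (rep E))"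
    proof (rule sum.mono_neutral_right[OF Xf])
      show "tr C \<subseteq> X" using C by (auto simp: X_def)
      show "\<forall>E\<in>X - tr C. F (rep E) = 0"
      proof
        fix E assume E: "E \<in> X - tr C"
        then have Er: "E \<in> rcosets U" using Xr by auto
        note e = rcosets_rep[OF Er] rcosets_translate[OF Er, of "inv (rep C)"]
        have "E #> inv (rep C) \<notin> supp y"
        proof
          assume "E #> inv (rep C) \<in> supp y"
          moreover have "E = (E #> inv (rep C)) #> rep C" using e c by simp
          ultimately have "E \<in> tr C" by (auto simp: tr_def)
          then show False using E by auto
        qed
        then have "val y (rep (E #> inv (rep C))) = 0" using supp_iff[OF y] e c by auto
        moreover have "val y (rep (E #> inv (rep C))) = val y (rep E \<otimes> inv (rep C))"
          unfolding e(3)[OF inv_closed[OF c]]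
          by (rule left_inv_rep) (use e c val_mult_U in \<open>auto simp: left_inv_def\<close>)
        ultimately show "F (rep E) = 0" by (simp add: F_def)
      qed
    qed
    also have "\<dots> = (\<Sum>B\<in>supp y. F (rep B \<otimes> rep C))"
      unfolding tr_def using sum_translate[OF lF c Y(2)] .
    also have "\<dots> = (\<Sum>B\<in>supp y. val x (g \<otimes> inv (rep C) \<otimes> inv (rep B)) * val y (rep B))"
      using Y rcosets_rep c g by (intro sum.cong) (auto simp: F_def inv_mult_group m_assoc subset_iff)
    finally show ?thesis by (simp add: F_def)
  qed
  have "val (x \<otimes>\<^bsub>H\<^esub> (y \<otimes>\<^bsub>H\<^esub> z)) g = (\<Sum>E\<in>X. val x (g \<otimes> inv (rep E)) * val (y \<otimes>\<^bsub>H\<^esub> z) (rep E))"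
    by (rule val_mult[OF x mult_H_closed[OF y z] g Xf Xr]) (auto simp: X_def)
  also have "\<dots> = (\<Sum>E\<in>X. \<Sum>C\<in>supp z. val x (g \<otimes> inv (rep E)) * (val y (rep E \<otimes> inv (rep C)) * val z (rep C)))"
    using Xrep by (intro sum.cong) (auto simp: val_mult[OF y z _ Z order_refl] sum_distrib_left)
  also have "\<dots> = (\<Sum>C\<in>supp z. (\<Sum>E\<in>X. val x (g \<otimes> inv (rep E)) * val y (rep E \<otimes> inv (rep C))) * val z (rep C))"
    by (subst sum.swap) (simp add: sum_distrib_right mult.assoc)
  also have "\<dots> = (\<Sum>C\<in>supp z. val (x \<otimes>\<^bsub>H\<^esub> y) (g \<otimes> inv (rep C)) * val z (rep C))"
    using zr g by (intro sum.cong) (auto simp: inner val_mult[OF x y _ Y order_refl])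
  also have "\<dots> = val (x \<otimes>\<^bsub>H\<^esub> y \<otimes>\<^bsub>H\<^esub> z) g"
    using val_mult[OF mult_H_closed[OF x y] z g Z order_refl] by simp
  finally show "val (x \<otimes>\<^bsub>H\<^esub> y \<otimes>\<^bsub>H\<^esub> z) g = val (x \<otimes>\<^bsub>H\<^esub> (y \<otimes>\<^bsub>H\<^esub> z)) g" by simp
qed

lemma mult_H_one:
  assumes x: "x \<in> carrier H"
  shows "frag_of U \<otimes>\<^bsub>H\<^esub> x = x" "x \<otimes>\<^bsub>H\<^esub> frag_of U = x"
proof -
  note X = finite_supp[OF x] supp_rcosets[OF x]
  show "frag_of U \<otimes>\<^bsub>H\<^esub> x = x"
  proof (rule H_eqI[OF mult_H_closed[OF frag_of_U_closed x] x])
    fix g assume g: "g \<in> carrier G"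
    have gr: "U #> g \<in> rcosets U" using g by (auto simp: RCOSETS_def)
    have Xi: "finite (insert (U #> g) (supp x))" "insert (U #> g) (supp x) \<subseteq> rcosets U"
      "supp x \<subseteq> insert (U #> g) (supp x)" using X gr by auto
    have lx: "left_inv (val x)" using val_mult_U by (auto simp: left_inv_def)
    have "val (frag_of U \<otimes>\<^bsub>H\<^esub> x) g
       = (\<Sum>C\<in>insert (U #> g) (supp x). val (frag_of U) (g \<otimes> inv (rep C)) * val x (rep C))"
      by (rule val_mult[OF frag_of_U_closed x g Xi])
    also have "\<dots> = (\<Sum>C\<in>insert (U #> g) (supp x). if C = U #> g then val x (rep C) else 0)"
    proof (intro sum.cong refl)
      fix C assume "C \<in> insert (U #> g) (supp x)"
      then have c: "C \<in> rcosets U" using Xi by auto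
      note r = rcosets_rep[OF c]
      have "g \<otimes> inv (rep C) \<in> U \<longleftrightarrow> C = U #> g"
        using coset_eq_iff[OF g r(1)] r(2) by auto
      then show "val (frag_of U) (g \<otimes> inv (rep C)) * val x (rep C) = (if C = U #> g then val x (rep C) else 0)"
        using g r by (simp add: val_one)
    qed
    also have "\<dots> = val x (rep (U #> g))" using Xi(1) by (simp add: sum.delta')
    also have "\<dots> = val x g" by (rule left_inv_rep[OF lx g])
    finally show "val (frag_of U \<otimes>\<^bsub>H\<^esub> x) g = val x g" .
  qed
  show "x \<otimes>\<^bsub>H\<^esub> frag_of U = x"
  proof (rule H_eqI[OF mult_H_closed[OF x frag_of_U_closed] x])
    fix g assume g: "g \<in> carrier G"
    have sU: "supp (frag_of U) \<subseteq> {U}"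
    proof
      fix C assume "C \<in> supp (frag_of U)"
      then obtain a where "a \<in> U" "C = U #> a" by (auto simp: supp_def mem_RC)
      then show "C \<in> {U}" using coset_join2[of a U] U_carrier subgroup_axioms by auto
    qed
    obtain u where u: "u \<in> U" "rep U = u" using rep_coset[of \<one>] U_carrier coset_mult_one[of U]
      by (auto simp: subset_iff)
    have "val (x \<otimes>\<^bsub>H\<^esub> frag_of U) g = (\<Sum>C\<in>{U}. val x (g \<otimes> inv (rep C)) * val (frag_of U) (rep C))"
      by (rule val_mult[OF x frag_of_U_closed g]) (use sU U_rcosets in auto)
    also have "\<dots> = val x g" using u g val_mult_U(3)[of "\<one>" "inv u" g x] by (simp add: val_one U_carrier)
    finally show "val (x \<otimes>\<^bsub>H\<^esub> frag_of U) g = val x g" .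
  qed
qed

lemma ring_H: "ring H"
proof (rule ringI)
  show "abelian_group H"
  proof (rule abelian_groupI)
    fix x assume x: "x \<in> carrier H"
    have "- x \<in> carrier H" using x by (simp add: carrier_H)
    then show "\<exists>y\<in>carrier H. y \<oplus>\<^bsub>H\<^esub> x = \<zero>\<^bsub>H\<^esub>" by (auto simp: add_H zero_H intro!: bexI[of _ "-x"])
  next
    fix x y assume "x \<in> carrier H" "y \<in> carrier H"
    then show "x \<oplus>\<^bsub>H\<^esub> y \<in> carrier H" using keys_add[of x y] by (auto simp: add_H carrier_H)
  qed (auto simp: add_H zero_H carrier_H algebra_simps)
  show "monoid H"
    by (rule monoidI) (auto simp: one_H mult_H_closed mult_H_assoc mult_H_one frag_of_U_closed)
  fix x y z assume "x \<in> carrier H" "y \<in> carrier H" "z \<in> carrier H"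
  show "(x \<oplus>\<^bsub>H\<^esub> y) \<otimes>\<^bsub>H\<^esub> z = x \<otimes>\<^bsub>H\<^esub> z \<oplus>\<^bsub>H\<^esub> y \<otimes>\<^bsub>H\<^esub> z"
    by (simp add: mult_H add_H frag_extend_add)
  show "z \<otimes>\<^bsub>H\<^esub> (x \<oplus>\<^bsub>H\<^esub> y) = z \<otimes>\<^bsub>H\<^esub> x \<oplus>\<^bsub>H\<^esub> z \<otimes>\<^bsub>H\<^esub> y"
    unfolding mult_H add_H frag_extend_add frag_extend_def[of _ z]
    by (simp add: frag_cmul_distrib2 sum.distrib)
qed

text \<open>Every element of the algebra is invariant under inversion of its argument. The
  substitution \<open>c -> c g\<close> turns the convolution sum for \<open>x y\<close> at
  \<open>g\<close> into the one for \<open>y x\<close> at \<open>inv g\<close>.\<close>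

lemma cring_H:
  assumes inv: "\<And>g. g \<in> carrier G \<Longrightarrow> inv g \<in> dc g"
  shows "cring H"
proof (rule cringI)
  show "abelian_group H" using ring_H ring.is_abelian_group by blast
  have vi: "val x (inv g) = val x g" if "g \<in> carrier G" for x g
    using dc_eqI[OF inv[OF that] that] by (simp add: val_def)
  have comm: "x \<otimes>\<^bsub>H\<^esub> y = y \<otimes>\<^bsub>H\<^esub> x" if x: "x \<in> carrier H" and y: "y \<in> carrier H" for x y
  proof (rule H_eqI[OF mult_H_closed[OF x y] mult_H_closed[OF y x]])
    fix g assume g: "g \<in> carrier G"
    \<comment> \<open>This set must cover the support of \<open>x\<close>, for the last convolution,
      and its translate by \<open>g\<close> must cover the support of \<open>y\<close>, for the
      first.\<close>
    let ?X = "supp x \<union> (\<lambda>C. C #> inv g) ` supp y"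
    note X = finite_supp[OF x] supp_rcosets[OF x] finite_supp[OF y] supp_rcosets[OF y]
    have Xf: "finite ?X" using X by auto
    have Xr: "?X \<subseteq> rcosets U" using X rcosets_translate(2) g by auto
    have Yf: "finite ((\<lambda>C. C #> g) ` ?X)" using Xf by auto
    have Yr: "(\<lambda>C. C #> g) ` ?X \<subseteq> rcosets U" using Xr rcosets_translate(2) g by blast
    have Ys: "supp y \<subseteq> (\<lambda>C. C #> g) ` ?X"
    proof
      fix C assume C: "C \<in> supp y"
      then have "C #> inv g #> g = C" using rcosets_translate(3)[of C "inv g"] X g by auto
      then show "C \<in> (\<lambda>C. C #> g) ` ?X" using C by (metis Un_iff image_eqI)
    qed
    let ?F = "\<lambda>c. val x (g \<otimes> inv c) * val y c"
    have lF: "left_inv ?F" unfolding left_inv_def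
      using g val_mult_U by (simp add: U_carrier inv_mult_group m_assoc[symmetric])
    have "val (x \<otimes>\<^bsub>H\<^esub> y) g = (\<Sum>C\<in>(\<lambda>C. C #> g) ` ?X. ?F (rep C))"
      by (rule val_mult[OF x y g Yf Yr Ys])
    also have "\<dots> = (\<Sum>C\<in>?X. ?F (rep C \<otimes> g))" by (rule sum_translate[OF lF g Xr])
    also have "\<dots> = (\<Sum>C\<in>?X. val y (inv g \<otimes> inv (rep C)) * val x (rep C))"
    proof (intro sum.cong refl)
      fix C assume "C \<in> ?X"
      then have c: "rep C \<in> carrier G" using Xr rcosets_rep by auto
      have "g \<otimes> inv (rep C \<otimes> g) = inv (rep C)" using c g by (simp add: inv_mult_group m_assoc[symmetric])
      moreover have "val y (rep C \<otimes> g) = val y (inv g \<otimes> inv (rep C))"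
        using vi[of "rep C \<otimes> g" y] c g by (simp add: inv_mult_group)
      ultimately show "?F (rep C \<otimes> g) = val y (inv g \<otimes> inv (rep C)) * val x (rep C)"
        using vi c by simp
    qed
    also have "\<dots> = val (y \<otimes>\<^bsub>H\<^esub> x) (inv g)"
      using val_mult[OF y x _ Xf Xr] g by simp
    finally show "val (x \<otimes>\<^bsub>H\<^esub> y) g = val (y \<otimes>\<^bsub>H\<^esub> x) g" using vi g by simp
  qed
  show "comm_monoid H"
    using ring_H comm by (intro monoid.monoid_comm_monoidI ring.is_monoid)
  fix x y z assume "x \<in> carrier H" "y \<in> carrier H" "z \<in> carrier H"
  then show "(x \<oplus>\<^bsub>H\<^esub> y) \<otimes>\<^bsub>H\<^esub> z = x \<otimes>\<^bsub>H\<^esub> z \<oplus>\<^bsub>H\<^esub> y \<otimes>\<^bsub>H\<^esub> z"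
    using ring.ring_simprules(13)[OF ring_H] by blast
qed

end

section \<open>Tensor products of rings with compatible bases\<close>

lemma frag_extend_fun_diff:
  "frag_extend (\<lambda>a. f a - g a) z = frag_extend f z - frag_extend g z"
  using subset_UNIV
  by (induction z rule: frag_induction) (auto simp: frag_extend_diff)

lemma frag_extend_fun_add:
  "frag_extend (\<lambda>a. f a + g a) z = frag_extend f z + frag_extend g z"
  using subset_UNIV
  by (induction z rule: frag_induction) (auto simp: frag_extend_diff)

section \<open>Integral monoid rings and restricted products\<close>

lemma carrier_monoid_ring: "z \<in> carrier (monoid_ring M) \<longleftrightarrow> Poly_Mapping.keys z \<subseteq> carrier M"
  by (simp add: monoid_ring_def)

lemma monoid_ring_simps:
  "x \<oplus>\<^bsub>monoid_ring M\<^esub> y = x + y" "\<zero>\<^bsub>monoid_ring M\<^esub> = 0" "\<one>\<^bsub>monoid_ring M\<^esub> = frag_of \<one>\<^bsub>M\<^esub>"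
  by (simp_all add: monoid_ring_def)

lemma monoid_ring_mult_frag: "frag_of a \<otimes>\<^bsub>monoid_ring M\<^esub> frag_of b = frag_of (a \<otimes>\<^bsub>M\<^esub> b)"
  by (simp add: monoid_ring_def)

lemma monoid_ring_mult_linear:
  "(x - y) \<otimes>\<^bsub>monoid_ring M\<^esub> z = x \<otimes>\<^bsub>monoid_ring M\<^esub> z - y \<otimes>\<^bsub>monoid_ring M\<^esub> z"
  "z \<otimes>\<^bsub>monoid_ring M\<^esub> (x - y) = z \<otimes>\<^bsub>monoid_ring M\<^esub> x - z \<otimes>\<^bsub>monoid_ring M\<^esub> y"
  "(x + y) \<otimes>\<^bsub>monoid_ring M\<^esub> z = x \<otimes>\<^bsub>monoid_ring M\<^esub> z + y \<otimes>\<^bsub>monoid_ring M\<^esub> z"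
  "z \<otimes>\<^bsub>monoid_ring M\<^esub> (x + y) = z \<otimes>\<^bsub>monoid_ring M\<^esub> x + z \<otimes>\<^bsub>monoid_ring M\<^esub> y"
  "0 \<otimes>\<^bsub>monoid_ring M\<^esub> z = 0" "z \<otimes>\<^bsub>monoid_ring M\<^esub> 0 = 0"
  by (simp_all add: monoid_ring_def frag_extend_diff frag_extend_fun_diff frag_extend_add
      frag_extend_fun_add frag_extend_eq_0)

lemma monoid_ring_mult_closed:
  assumes "monoid M" "Poly_Mapping.keys x \<subseteq> carrier M" "Poly_Mapping.keys y \<subseteq> carrier M"
  shows "Poly_Mapping.keys (x \<otimes>\<^bsub>monoid_ring M\<^esub> y) \<subseteq> carrier M"
  using assms(2)
proof (rule free_Abelian_group_induct)
  interpret monoid M by fact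
  show "Poly_Mapping.keys (0 \<otimes>\<^bsub>monoid_ring M\<^esub> y) \<subseteq> carrier M"
    by (simp add: monoid_ring_mult_linear)
  fix a b assume "Poly_Mapping.keys (a \<otimes>\<^bsub>monoid_ring M\<^esub> y) \<subseteq> carrier M" "Poly_Mapping.keys (b \<otimes>\<^bsub>monoid_ring M\<^esub> y) \<subseteq> carrier M"
  then show "Poly_Mapping.keys ((a - b) \<otimes>\<^bsub>monoid_ring M\<^esub> y) \<subseteq> carrier M"
    unfolding monoid_ring_mult_linear by (intro order_trans[OF keys_diff] Un_least)
next
  interpret monoid M by fact
  fix a assume a: "a \<in> carrier M"
  show "Poly_Mapping.keys (frag_of a \<otimes>\<^bsub>monoid_ring M\<^esub> y) \<subseteq> carrier M"
    using assms(3)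
  proof (rule free_Abelian_group_induct)
    fix x y assume "Poly_Mapping.keys (frag_of a \<otimes>\<^bsub>monoid_ring M\<^esub> x) \<subseteq> carrier M"
      "Poly_Mapping.keys (frag_of a \<otimes>\<^bsub>monoid_ring M\<^esub> y) \<subseteq> carrier M"
    then show "Poly_Mapping.keys (frag_of a \<otimes>\<^bsub>monoid_ring M\<^esub> (x - y)) \<subseteq> carrier M"
      unfolding monoid_ring_mult_linear by (intro order_trans[OF keys_diff] Un_least)
  qed (use a in \<open>auto simp: monoid_ring_mult_linear monoid_ring_mult_frag\<close>)
qed

lemma ring_monoid_ring:
  assumes "monoid M"
  shows "ring (monoid_ring M)"
proof -
  interpret monoid M by fact
  let ?R = "monoid_ring M"
  show ?thesis
  proof (rule ringI)
    show "abelian_group ?R"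
    proof (rule abelian_groupI)
      fix x assume x: "x \<in> carrier ?R"
      then show "\<exists>y\<in>carrier ?R. y \<oplus>\<^bsub>?R\<^esub> x = \<zero>\<^bsub>?R\<^esub>"
        by (auto simp: monoid_ring_simps carrier_monoid_ring intro!: bexI[of _ "-x"])
    next
      fix x y assume "x \<in> carrier ?R" "y \<in> carrier ?R"
      then show "x \<oplus>\<^bsub>?R\<^esub> y \<in> carrier ?R"
        using keys_add[of x y] by (auto simp: monoid_ring_simps carrier_monoid_ring)
    qed (auto simp: monoid_ring_simps carrier_monoid_ring algebra_simps)
    show "monoid ?R"
    proof (rule monoidI)
      fix x y z assume "x \<in> carrier ?R" "y \<in> carrier ?R" "z \<in> carrier ?R"
      then have k: "Poly_Mapping.keys x \<subseteq> carrier M" "Poly_Mapping.keys y \<subseteq> carrier M" "Poly_Mapping.keys z \<subseteq> carrier M"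
        by (auto simp: carrier_monoid_ring)
      have 1: "frag_of a \<otimes>\<^bsub>?R\<^esub> frag_of b \<otimes>\<^bsub>?R\<^esub> z = frag_of a \<otimes>\<^bsub>?R\<^esub> (frag_of b \<otimes>\<^bsub>?R\<^esub> z)"
        if "a \<in> carrier M" "b \<in> carrier M" for a b
        using k(3) by (rule free_Abelian_group_induct)
          (use that in \<open>auto simp: monoid_ring_mult_linear monoid_ring_mult_frag m_assoc\<close>)
      have 2: "frag_of a \<otimes>\<^bsub>?R\<^esub> y \<otimes>\<^bsub>?R\<^esub> z = frag_of a \<otimes>\<^bsub>?R\<^esub> (y \<otimes>\<^bsub>?R\<^esub> z)"
        if "a \<in> carrier M" for a
        using k(2) by (rule free_Abelian_group_induct)
          (use that 1 in \<open>auto simp: monoid_ring_mult_linear\<close>)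
      show "x \<otimes>\<^bsub>?R\<^esub> y \<otimes>\<^bsub>?R\<^esub> z = x \<otimes>\<^bsub>?R\<^esub> (y \<otimes>\<^bsub>?R\<^esub> z)"
        using k(1) by (rule free_Abelian_group_induct)
          (use 2 in \<open>auto simp: monoid_ring_mult_linear\<close>)
    next
      fix x y assume "x \<in> carrier ?R" "y \<in> carrier ?R"
      then show "x \<otimes>\<^bsub>?R\<^esub> y \<in> carrier ?R"
        using monoid_ring_mult_closed[OF assms] by (auto simp: carrier_monoid_ring)
    next
      fix x assume "x \<in> carrier ?R"
      then have k: "Poly_Mapping.keys x \<subseteq> carrier M" by (auto simp: carrier_monoid_ring)
      show "\<one>\<^bsub>?R\<^esub> \<otimes>\<^bsub>?R\<^esub> x = x"
        using k by (rule free_Abelian_group_induct)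
          (auto simp: monoid_ring_simps monoid_ring_mult_linear monoid_ring_mult_frag)
      show "x \<otimes>\<^bsub>?R\<^esub> \<one>\<^bsub>?R\<^esub> = x"
        using k by (rule free_Abelian_group_induct)
          (auto simp: monoid_ring_simps monoid_ring_mult_linear monoid_ring_mult_frag)
    qed (auto simp: monoid_ring_simps carrier_monoid_ring)
  qed (auto simp: monoid_ring_simps monoid_ring_mult_linear)
qed

lemma carrier_restricted_product:
  "x \<in> carrier (restricted_product I A) \<longleftrightarrow>
    x \<in> (\<Pi>\<^sub>E i\<in>I. carrier (A i)) \<and> finite {i \<in> I. x i \<noteq> \<one>\<^bsub>A i\<^esub>}"
  by (simp add: restricted_product_def)

lemma mult_restricted_product: "x \<otimes>\<^bsub>restricted_product I A\<^esub> y = (\<lambda>i\<in>I. x i \<otimes>\<^bsub>A i\<^esub> y i)"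
  and one_restricted_product: "\<one>\<^bsub>restricted_product I A\<^esub> = (\<lambda>i\<in>I. \<one>\<^bsub>A i\<^esub>)"
  by (simp_all add: restricted_product_def)

lemma monoid_restricted_product:
  assumes "\<And>i. i \<in> I \<Longrightarrow> monoid (A i)"
  shows "monoid (restricted_product I A)"
proof (rule monoidI)
  fix x y assume x: "x \<in> carrier (restricted_product I A)" and y: "y \<in> carrier (restricted_product I A)"
  have "{i \<in> I. x i \<otimes>\<^bsub>A i\<^esub> y i \<noteq> \<one>\<^bsub>A i\<^esub>} \<subseteq> {i \<in> I. x i \<noteq> \<one>\<^bsub>A i\<^esub>} \<union> {i \<in> I. y i \<noteq> \<one>\<^bsub>A i\<^esub>}"
    using assms by (auto simp: monoid.l_one monoid.one_closed)
  then have "finite {i \<in> I. x i \<otimes>\<^bsub>A i\<^esub> y i \<noteq> \<one>\<^bsub>A i\<^esub>}"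
    using x y by (auto simp: carrier_restricted_product intro: finite_subset)
  then show "x \<otimes>\<^bsub>restricted_product I A\<^esub> y \<in> carrier (restricted_product I A)"
    using x y assms
    by (auto simp: carrier_restricted_product mult_restricted_product PiE_iff monoid.m_closed cong: conj_cong)
qed (use assms in \<open>auto simp: carrier_restricted_product mult_restricted_product one_restricted_product
      PiE_iff extensional_def monoid.m_assoc monoid.l_one monoid.r_one intro!: ext\<close>)

text \<open>All rings are free abelian with a common unit basis element \<open>e\<close>. The last
  two assumptions say that a family of basis elements multiplies to a single element of
  \<open>S\<close> and that \<open>S\<close> is thereby matched bijectively with such families; they
  stand in for any knowledge of the products inside one \<open>A i\<close>.\<close>

locale tensor_basis =
  fixes R :: "('b \<Rightarrow>\<^sub>0 int) ring" and I :: "'i set" and A :: "'i \<Rightarrow> ('b \<Rightarrow>\<^sub>0 int) ring"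
    and S :: "'b set" and T :: "'i \<Rightarrow> 'b set" and e :: 'b and m :: "('i \<Rightarrow> 'b) \<Rightarrow> 'b"
  assumes cring_R: "cring R" and ring_A: "\<And>i. i \<in> I \<Longrightarrow> ring (A i)"
    and carrier_R: "carrier R = carrier (free_Abelian_group S)"
    and carrier_A: "\<And>i. i \<in> I \<Longrightarrow> carrier (A i) = carrier (free_Abelian_group (T i))"
    and add_R: "add R = (+)" and add_A: "\<And>i. i \<in> I \<Longrightarrow> add (A i) = (+)"
    and zero_R: "\<zero>\<^bsub>R\<^esub> = 0"
    and mult_A: "\<And>i. i \<in> I \<Longrightarrow> monoid.mult (A i) = monoid.mult R"
    and one_R: "\<one>\<^bsub>R\<^esub> = frag_of e" and one_A: "\<And>i. i \<in> I \<Longrightarrow> \<one>\<^bsub>A i\<^esub> = frag_of e"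
    and T_S: "\<And>i. i \<in> I \<Longrightarrow> T i \<subseteq> S"
    and prod_basis: "\<And>D. D \<in> (\<Pi>\<^sub>E i\<in>I. T i) \<Longrightarrow> finite {i \<in> I. D i \<noteq> e} \<Longrightarrow>
       gfinprod R (\<lambda>i. frag_of (D i)) I = frag_of (m D)"
    and bij: "bij_betw m {D \<in> (\<Pi>\<^sub>E i\<in>I. T i). finite {i \<in> I. D i \<noteq> e}} S"
begin

abbreviation "P \<equiv> restricted_product I A"
abbreviation "M \<equiv> monoid_ring P"
abbreviation "J \<equiv> tensor_ideal I A"

definition basis_fams where "basis_fams = (\<lambda>D. \<lambda>i\<in>I. frag_of (D i)) ` {D \<in> (\<Pi>\<^sub>E i\<in>I. T i). finite {i \<in> I. D i \<noteq> e}}"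

definition eval_fam where "eval_fam x = gfinprod R x I"

sublocale R: cring R by (rule cring_R)

lemma carrier_P: "x \<in> carrier P \<longleftrightarrow> x \<in> extensional I \<and> (\<forall>i\<in>I. Poly_Mapping.keys (x i) \<subseteq> T i) \<and> finite {i \<in> I. x i \<noteq> \<one>\<^bsub>R\<^esub>}"
  using carrier_A one_A
  by (auto simp: carrier_restricted_product PiE_iff one_R cong: conj_cong)

lemma P_R: "x \<in> carrier P \<Longrightarrow> i \<in> I \<Longrightarrow> x i \<in> carrier R"
  using T_S by (force simp: carrier_P carrier_R)

lemma e_T: "i \<in> I \<Longrightarrow> e \<in> T i"
  using ring.ring_simprules(6)[OF ring_A] carrier_A one_A by fastforce

lemma monoid_P: "monoid P"
  by (rule monoid_restricted_product) (rule ring.is_monoid[OF ring_A])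

lemma ring_M: "ring M"
  by (rule ring_monoid_ring[OF monoid_P])

lemma eval_fam_closed: "x \<in> carrier P \<Longrightarrow> eval_fam x \<in> carrier R"
  unfolding eval_fam_def using P_R by (intro R.gfinprod_closed) auto

lemma eval_fam_mult:
  assumes "x \<in> carrier P" "y \<in> carrier P"
  shows "eval_fam (x \<otimes>\<^bsub>P\<^esub> y) = eval_fam x \<otimes>\<^bsub>R\<^esub> eval_fam y"
proof -
  have "eval_fam (x \<otimes>\<^bsub>P\<^esub> y) = gfinprod R (\<lambda>i. x i \<otimes>\<^bsub>R\<^esub> y i) I"
    unfolding eval_fam_def mult_restricted_product
    by (rule R.gfinprod_cong) (use assms P_R mult_A in \<open>auto simp: simp_implies_def\<close>)
  also have "\<dots> = eval_fam x \<otimes>\<^bsub>R\<^esub> eval_fam y"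
    unfolding eval_fam_def by (rule R.gfinprod_distrib) (use assms P_R in \<open>auto simp: carrier_P\<close>)
  finally show ?thesis .
qed

lemma eval_fam_one: "eval_fam \<one>\<^bsub>P\<^esub> = \<one>\<^bsub>R\<^esub>"
proof -
  have "{i \<in> I. \<one>\<^bsub>P\<^esub> i \<noteq> \<one>\<^bsub>R\<^esub>} = {}" using one_A one_R by (auto simp: one_restricted_product)
  then show ?thesis unfolding eval_fam_def gfinprod_def by (simp only: finite.emptyI if_True R.finprod_empty)
qed

lemma P_upd: "x \<in> carrier P \<Longrightarrow> i \<in> I \<Longrightarrow> Poly_Mapping.keys a \<subseteq> T i \<Longrightarrow> x(i := a) \<in> carrier P"
proof -
  assume x: "x \<in> carrier P" "i \<in> I" "Poly_Mapping.keys a \<subseteq> T i"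
  have "{j \<in> I. (x(i := a)) j \<noteq> \<one>\<^bsub>R\<^esub>} \<subseteq> insert i {j \<in> I. x j \<noteq> \<one>\<^bsub>R\<^esub>}" by auto
  then have "finite {j \<in> I. (x(i := a)) j \<noteq> \<one>\<^bsub>R\<^esub>}"
    by (rule finite_subset) (use x in \<open>simp add: carrier_P\<close>)
  then show ?thesis using x unfolding carrier_P by (auto simp: extensional_def)
qed

text \<open>Isolates one coordinate as a factor, so that distributivity in \<open>R\<close> shows
  the evaluation to be additive in it and to kill the relators.\<close>

lemma eval_fam_upd:
  assumes x: "x \<in> carrier P" "i \<in> I" "Poly_Mapping.keys a \<subseteq> T i"
  shows "eval_fam (x(i := a)) = a \<otimes>\<^bsub>R\<^esub> gfinprod R x (I - {i})"
proof -
  have I: "I = insert i (I - {i})" using x by auto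
  have u: "x(i := a) \<in> carrier P" by (rule P_upd[OF x])
  have fin: "finite {j \<in> I - {i}. (x(i := a)) j \<noteq> \<one>\<^bsub>R\<^esub>}"
    by (rule finite_subset[of _ "{j \<in> I. x j \<noteq> \<one>\<^bsub>R\<^esub>}"]) (use x in \<open>auto simp: carrier_P\<close>)
  have "eval_fam (x(i := a)) = gfinprod R (x(i := a)) (insert i (I - {i}))" unfolding eval_fam_def using I by simp
  also have "\<dots> = (x(i := a)) i \<otimes>\<^bsub>R\<^esub> gfinprod R (x(i := a)) (I - {i})"
  proof -
    have "x(i := a) \<in> I - {i} \<rightarrow> carrier R" "(x(i := a)) i \<in> carrier R" using P_R[OF u] x(2) by blast+
    from R.gfinprod_insert[OF fin this] show ?thesis by (simp only: Diff_iff singleton_iff simp_thms if_False)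
  qed
  also have "gfinprod R (x(i := a)) (I - {i}) = gfinprod R x (I - {i})"
    by (rule R.gfinprod_cong) (use P_R[OF x(1)] P_R[OF u] in \<open>auto simp: simp_implies_def\<close>)
  finally show ?thesis by (simp only: fun_upd_same)
qed

text \<open>Freeness gives an additive extension of \<open>eval_fam\<close>; by induction in each
  argument its multiplicativity reduces to that of \<open>eval_fam\<close> on families.\<close>

lemma hom_exists:
  obtains h where "h \<in> ring_hom M R" "\<And>x. x \<in> carrier P \<Longrightarrow> h (frag_of x) = eval_fam x"
proof -
  have cg: "comm_group (add_monoid R)" using R.a_comm_group by simp
  obtain h where h: "h \<in> hom (free_Abelian_group (carrier P)) (add_monoid R)"
     and hf: "\<And>x. x \<in> carrier P \<Longrightarrow> h (frag_of x) = eval_fam x"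
    using comm_group.free_Abelian_group_universal[OF cg, of eval_fam "carrier P"] eval_fam_closed by auto
  have hc: "h z \<in> carrier R" if "Poly_Mapping.keys z \<subseteq> carrier P" for z
    using hom_in_carrier[OF h, of z] that by auto
  have ha: "h (x + y) = h x + h y" if "Poly_Mapping.keys x \<subseteq> carrier P" "Poly_Mapping.keys y \<subseteq> carrier P" for x y
    using hom_mult[OF h, of x y] that by (simp add: add_R)
  have hd: "h (x - y) = h x - h y" if "Poly_Mapping.keys x \<subseteq> carrier P" "Poly_Mapping.keys y \<subseteq> carrier P" for x y
  proof -
    have "Poly_Mapping.keys (x - y) \<subseteq> carrier P" using that keys_diff[of x y] by blast
    then show ?thesis using ha[of "x - y" y] that by simp
  qed
  have h0: "h 0 = 0" using ha[of 0 0] by simp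
  have lin: "(a - b) \<otimes>\<^bsub>R\<^esub> c = a \<otimes>\<^bsub>R\<^esub> c - b \<otimes>\<^bsub>R\<^esub> c" "c \<otimes>\<^bsub>R\<^esub> (a - b) = c \<otimes>\<^bsub>R\<^esub> a - c \<otimes>\<^bsub>R\<^esub> b"
    if "a \<in> carrier R" "b \<in> carrier R" "c \<in> carrier R" for a b c
  proof -
    have d: "a - b \<in> carrier R" using that keys_diff[of a b] by (auto simp: carrier_R)
    show "(a - b) \<otimes>\<^bsub>R\<^esub> c = a \<otimes>\<^bsub>R\<^esub> c - b \<otimes>\<^bsub>R\<^esub> c" "c \<otimes>\<^bsub>R\<^esub> (a - b) = c \<otimes>\<^bsub>R\<^esub> a - c \<otimes>\<^bsub>R\<^esub> b"
      using R.l_distr[OF d that(2,3)] R.r_distr[OF d that(2,3)] by (simp_all add: add_R)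
  qed
  have hm: "h (x \<otimes>\<^bsub>M\<^esub> y) = h x \<otimes>\<^bsub>R\<^esub> h y" if x: "Poly_Mapping.keys x \<subseteq> carrier P" and y: "Poly_Mapping.keys y \<subseteq> carrier P" for x y
    using x
  proof (rule free_Abelian_group_induct)
    show "h (0 \<otimes>\<^bsub>M\<^esub> y) = h 0 \<otimes>\<^bsub>R\<^esub> h y"
      using R.l_null[OF hc[OF y]] by (simp add: monoid_ring_mult_linear h0 zero_R)
    fix a b assume "Poly_Mapping.keys a \<subseteq> carrier P" "Poly_Mapping.keys b \<subseteq> carrier P"
      "h (a \<otimes>\<^bsub>M\<^esub> y) = h a \<otimes>\<^bsub>R\<^esub> h y" "h (b \<otimes>\<^bsub>M\<^esub> y) = h b \<otimes>\<^bsub>R\<^esub> h y"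
    then show "h ((a - b) \<otimes>\<^bsub>M\<^esub> y) = h (a - b) \<otimes>\<^bsub>R\<^esub> h y"
      using y monoid_ring_mult_closed[OF monoid_P] by (simp add: monoid_ring_mult_linear hd lin hc)
  next
    fix a assume a: "a \<in> carrier P"
    show "h (frag_of a \<otimes>\<^bsub>M\<^esub> y) = h (frag_of a) \<otimes>\<^bsub>R\<^esub> h y"
      using y
    proof (rule free_Abelian_group_induct)
      show "h (frag_of a \<otimes>\<^bsub>M\<^esub> 0) = h (frag_of a) \<otimes>\<^bsub>R\<^esub> h 0"
        using R.r_null[OF eval_fam_closed[OF a]] by (simp add: monoid_ring_mult_linear h0 zero_R hf[OF a])
    next
      fix x y assume "Poly_Mapping.keys x \<subseteq> carrier P" "Poly_Mapping.keys y \<subseteq> carrier P"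
      "h (frag_of a \<otimes>\<^bsub>M\<^esub> x) = h (frag_of a) \<otimes>\<^bsub>R\<^esub> h x" "h (frag_of a \<otimes>\<^bsub>M\<^esub> y) = h (frag_of a) \<otimes>\<^bsub>R\<^esub> h y"
      then show "h (frag_of a \<otimes>\<^bsub>M\<^esub> (x - y)) = h (frag_of a) \<otimes>\<^bsub>R\<^esub> h (x - y)"
        using a monoid_ring_mult_closed[OF monoid_P, of "frag_of a"]
        by (simp add: monoid_ring_mult_linear hd lin hc)
    next
      fix b assume b: "b \<in> carrier P"
      then show "h (frag_of a \<otimes>\<^bsub>M\<^esub> frag_of b) = h (frag_of a) \<otimes>\<^bsub>R\<^esub> h (frag_of b)"
        using a monoid.m_closed[OF monoid_P a b] by (simp add: monoid_ring_mult_frag hf eval_fam_mult)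
    qed
  qed
  have "h \<in> ring_hom M R"
    by (rule ring_hom_memI)
      (use hc ha hm hf eval_fam_one monoid.one_closed[OF monoid_P] in \<open>auto simp: carrier_monoid_ring monoid_ring_simps add_R\<close>)
  then show ?thesis using that hf by blast
qed

lemma relators_M: "tensor_relators I A \<subseteq> carrier M"
proof
  fix z assume "z \<in> tensor_relators I A"
  then obtain x i a b where z: "z = frag_of (x(i := a \<oplus>\<^bsub>A i\<^esub> b)) - frag_of (x(i := a)) - frag_of (x(i := b))"
    "x \<in> carrier P" "i \<in> I" "a \<in> carrier (A i)" "b \<in> carrier (A i)" by (auto simp: tensor_relators_def)
  have k: "Poly_Mapping.keys a \<subseteq> T i" "Poly_Mapping.keys b \<subseteq> T i" "Poly_Mapping.keys (a + b) \<subseteq> T i"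
    using z carrier_A[OF z(3)] keys_add[of a b] by auto
  have "Poly_Mapping.keys z \<subseteq> {x(i := a + b), x(i := a), x(i := b)}"
    unfolding z(1) add_A[OF z(3)] by (intro order_trans[OF keys_diff] Un_least) auto
  then show "z \<in> carrier M" using P_upd[OF z(2,3)] k unfolding carrier_monoid_ring by blast
qed

lemma ideal_J: "ideal J M"
  unfolding tensor_ideal_def by (rule ring.genideal_ideal[OF ring_M relators_M])

lemma J_diff: "x \<in> J \<Longrightarrow> y \<in> J \<Longrightarrow> x - y \<in> J" and J_zero: "0 \<in> J" and J_sub: "J \<subseteq> carrier M"
proof -
  interpret ideal J M by (rule ideal_J)
  show z: "0 \<in> J" using additive_subgroup.zero_closed[OF is_additive_subgroup] by (simp add: monoid_ring_simps)
  show sub: "J \<subseteq> carrier M" using a_subset by auto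
  show "x - y \<in> J" if "x \<in> J" "y \<in> J"
  proof -
    have yk: "y \<in> carrier M" using sub that by auto
    have "\<ominus>\<^bsub>M\<^esub> y \<in> J" using that by (simp add: a_inv_closed)
    moreover have "\<ominus>\<^bsub>M\<^esub> y = - y"
      by (rule abelian_group.minus_equality[OF ring.is_abelian_group[OF ring_M]])
        (use yk in \<open>auto simp: monoid_ring_simps carrier_monoid_ring\<close>)
    ultimately have "x \<oplus>\<^bsub>M\<^esub> (- y) \<in> J"
      using additive_subgroup.a_closed[OF is_additive_subgroup that(1), of "- y"] by simp
    then show ?thesis by (simp add: monoid_ring_simps)
  qed
qed

lemma J_uminus: "x \<in> J \<Longrightarrow> - x \<in> J"
  using J_diff[OF J_zero, of x] by simp

lemma J_add: "x \<in> J \<Longrightarrow> y \<in> J \<Longrightarrow> x + y \<in> J"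
  using J_diff[of x "- y"] J_uminus[of y] by simp

lemma relator_J:
  assumes "x \<in> carrier P" "i \<in> I" "Poly_Mapping.keys a \<subseteq> T i" "Poly_Mapping.keys b \<subseteq> T i"
  shows "frag_of (x(i := a + b)) - frag_of (x(i := a)) - frag_of (x(i := b)) \<in> J"
proof -
  have "frag_of (x(i := a \<oplus>\<^bsub>A i\<^esub> b)) - frag_of (x(i := a)) - frag_of (x(i := b)) \<in> tensor_relators I A"
    unfolding tensor_relators_def using assms carrier_A[OF assms(2)]
    by (intro CollectI exI[of _ x] exI[of _ i] exI[of _ a] exI[of _ b]) simp
  then show ?thesis using ring.genideal_self[OF ring_M relators_M] add_A[OF assms(2)]
    unfolding tensor_ideal_def by auto
qed

lemma basis_fams_P: "basis_fams \<subseteq> carrier P"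
proof
  fix x assume "x \<in> basis_fams"
  then obtain D where D: "D \<in> (\<Pi>\<^sub>E i\<in>I. T i)" "finite {i \<in> I. D i \<noteq> e}" "x = (\<lambda>i\<in>I. frag_of (D i))"
    by (auto simp: basis_fams_def)
  have "{i \<in> I. x i \<noteq> \<one>\<^bsub>R\<^esub>} = {i \<in> I. D i \<noteq> e}" using D by (auto simp: one_R frag_of_eq)
  then show "x \<in> carrier P" using D by (auto simp: carrier_P)
qed

lemma basis_fams_I:
  assumes x: "x \<in> carrier P" and b: "\<forall>i\<in>I. x i \<in> frag_of ` T i"
  shows "x \<in> basis_fams"
proof -
  have "\<forall>i\<in>I. \<exists>d. d \<in> T i \<and> x i = frag_of d" using b by blast
  then obtain D where "\<forall>i\<in>I. D i \<in> T i \<and> x i = frag_of (D i)" by (rule bchoice[THEN exE])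
  then have D: "\<And>i. i \<in> I \<Longrightarrow> D i \<in> T i \<and> x i = frag_of (D i)" by blast
  let ?D = "\<lambda>i\<in>I. D i"
  have "{i \<in> I. ?D i \<noteq> e} = {i \<in> I. x i \<noteq> \<one>\<^bsub>R\<^esub>}" using D by (auto simp: one_R frag_of_eq)
  then have "finite {i \<in> I. ?D i \<noteq> e}" using x by (simp add: carrier_P)
  moreover have "?D \<in> (\<Pi>\<^sub>E i\<in>I. T i)" using D by auto
  moreover have "x = (\<lambda>i\<in>I. frag_of (?D i))"
    using x D by (auto simp: carrier_P extensional_def intro!: ext)
  ultimately show ?thesis unfolding basis_fams_def by blast
qed

definition spanned where "spanned z \<longleftrightarrow> (\<exists>w. Poly_Mapping.keys w \<subseteq> basis_fams \<and> z - w \<in> J)"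

lemma spanned_diff: "spanned x \<Longrightarrow> spanned y \<Longrightarrow> spanned (x - y)"
proof -
  assume "spanned x" "spanned y"
  then obtain v w where vw: "Poly_Mapping.keys v \<subseteq> basis_fams" "x - v \<in> J" "Poly_Mapping.keys w \<subseteq> basis_fams" "y - w \<in> J"
    by (auto simp: spanned_def)
  have "Poly_Mapping.keys (v - w) \<subseteq> basis_fams" using vw keys_diff[of v w] by blast
  moreover have "(x - y) - (v - w) \<in> J" using J_diff[OF vw(2,4)] by (simp add: algebra_simps)
  ultimately show ?thesis unfolding spanned_def by blast
qed

lemma spanned_cong: "spanned x \<Longrightarrow> y - x \<in> J \<Longrightarrow> spanned y"
proof -
  assume "spanned x" and y: "y - x \<in> J"
  then obtain w where w: "Poly_Mapping.keys w \<subseteq> basis_fams" "x - w \<in> J" by (auto simp: spanned_def)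
  have "y - w \<in> J" using J_add[OF y w(2)] by (simp add: algebra_simps)
  then show "spanned y" using w(1) unfolding spanned_def by blast
qed

text \<open>Induction on the number of coordinates that are not single basis elements, which is
  finite because almost all coordinates are the unit \<open>frag_of e\<close>. The additivity
  relators expand one offending coordinate along the basis, and each family with a basis element
  there has fewer offending coordinates.\<close>

lemma spanned_frag: "x \<in> carrier P \<Longrightarrow> spanned (frag_of x)"
proof (induction "card {i \<in> I. x i \<notin> frag_of ` T i}" arbitrary: x rule: less_induct)
  case less
  let ?N = "\<lambda>x. {i \<in> I. x i \<notin> frag_of ` T i}"
  have fin: "finite (?N x)"
    by (rule finite_subset[of _ "{i \<in> I. x i \<noteq> \<one>\<^bsub>R\<^esub>}"]) (use less.prems e_T in \<open>auto simp: carrier_P one_R\<close>)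
  show ?case
  proof (cases "?N x = {}")
    case True
    then have "x \<in> basis_fams" using basis_fams_I[OF less.prems] by auto
    then show ?thesis unfolding spanned_def by (intro exI[of _ "frag_of x"]) (simp add: J_zero)
  next
    case False
    then obtain i where i: "i \<in> I" "x i \<notin> frag_of ` T i" by auto
    have k: "Poly_Mapping.keys (x i) \<subseteq> T i" using less.prems i by (simp add: carrier_P)
    have "spanned (frag_of (x(i := a)))" if "Poly_Mapping.keys a \<subseteq> T i" for a
      using that
    proof (rule free_Abelian_group_induct)
      have "spanned 0" unfolding spanned_def by (intro exI[of _ 0]) (simp add: J_zero)
      \<comment> \<open>The relator for 0 + 0 = 0 is minus the family with coordinate 0.\<close>
      moreover have "frag_of (x(i := 0)) - 0 \<in> J"
        using J_uminus[OF relator_J[OF less.prems i(1), of 0 0]] by simp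
      ultimately show "spanned (frag_of (x(i := 0)))" by (rule spanned_cong)
    next
      fix a b assume h: "Poly_Mapping.keys a \<subseteq> T i" "Poly_Mapping.keys b \<subseteq> T i"
        "spanned (frag_of (x(i := a)))" "spanned (frag_of (x(i := b)))"
      have "Poly_Mapping.keys (a - b) \<subseteq> T i" using h(1,2) by (intro order_trans[OF keys_diff] Un_least)
      \<comment> \<open>Additivity for differences is the relator for (a - b) + b,
        rearranged.\<close>
      then have "- (frag_of (x(i := a - b + b)) - frag_of (x(i := a - b)) - frag_of (x(i := b))) \<in> J"
        by (intro J_uminus relator_J[OF less.prems i(1)] h)
      then have "frag_of (x(i := a - b)) - (frag_of (x(i := a)) - frag_of (x(i := b))) \<in> J"
        by (simp add: algebra_simps)
      then show "spanned (frag_of (x(i := a - b)))" by (rule spanned_cong[OF spanned_diff[OF h(3,4)]])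
    next
      fix t assume t: "t \<in> T i"
      have p: "x(i := frag_of t) \<in> carrier P" using t by (intro P_upd[OF less.prems i(1)]) auto
      have "?N (x(i := frag_of t)) \<subset> ?N x" using i t by (auto split: if_splits)
      then have "card (?N (x(i := frag_of t))) < card (?N x)" by (rule psubset_card_mono[OF fin])
      then show "spanned (frag_of (x(i := frag_of t)))" by (rule less.hyps[OF _ p])
    qed
    from this[OF k] show ?thesis by simp
  qed
qed

lemma spanned_all: "Poly_Mapping.keys z \<subseteq> carrier P \<Longrightarrow> spanned z"
proof (erule free_Abelian_group_induct)
  show "spanned 0" unfolding spanned_def by (intro exI[of _ 0]) (simp add: J_zero)
qed (auto intro: spanned_diff spanned_frag)

lemma eval_fam_basis_fams:
  assumes "D \<in> (\<Pi>\<^sub>E i\<in>I. T i)" "finite {i \<in> I. D i \<noteq> e}"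
  shows "eval_fam (\<lambda>i\<in>I. frag_of (D i)) = frag_of (m D)"
proof -
  have "(\<lambda>i\<in>I. frag_of (D i)) \<in> carrier P" using basis_fams_P assms by (auto simp: basis_fams_def)
  then have "eval_fam (\<lambda>i\<in>I. frag_of (D i)) = gfinprod R (\<lambda>i. frag_of (D i)) I"
    unfolding eval_fam_def using assms(1) T_S
    by (intro R.gfinprod_cong) (auto simp: carrier_R simp_implies_def PiE_iff subset_iff)
  then show ?thesis using prod_basis assms by simp
qed

lemma eval_fam_basis_fams_ex:
  "\<exists>g. inj_on g basis_fams \<and> (\<forall>x\<in>basis_fams. eval_fam x = frag_of (g x)) \<and> g ` basis_fams = S"
proof -
  let ?X = "{D \<in> (\<Pi>\<^sub>E i\<in>I. T i). finite {i \<in> I. D i \<noteq> e}}"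
  let ?c = "\<lambda>D. \<lambda>i\<in>I. frag_of (D i)"
  have inj: "inj_on ?c ?X"
  proof (rule inj_onI)
    fix D D' assume h: "D \<in> ?X" "D' \<in> ?X" "?c D = ?c D'"
    have "D i = D' i" if "i \<in> I" for i using fun_cong[OF h(3), of i] that by (simp add: frag_of_eq)
    then show "D = D'" using h by (intro PiE_ext[of D I T D']) auto
  qed
  define g where "g x = m (inv_into ?X ?c x)" for x
  have gc: "g (?c D) = m D" if "D \<in> ?X" for D unfolding g_def using inv_into_f_f[OF inj that] by simp
  have "inj_on g basis_fams"
  proof (rule inj_onI)
    fix x y assume h: "x \<in> basis_fams" "y \<in> basis_fams" "g x = g y"
    obtain D D' where D: "D \<in> ?X" "x = ?c D" "D' \<in> ?X" "y = ?c D'" using h(1,2) unfolding basis_fams_def by blast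
    have "m D = m D'" using h(3) gc[OF D(1)] gc[OF D(3)] D(2,4) by simp
    then have "D = D'" using bij_betw_imp_inj_on[OF bij] D(1,3) by (meson inj_onD)
    then show "x = y" using D(2,4) by simp
  qed
  moreover have "\<forall>x\<in>basis_fams. eval_fam x = frag_of (g x)"
  proof
    fix x assume "x \<in> basis_fams"
    then obtain D where D: "D \<in> ?X" "x = ?c D" unfolding basis_fams_def by blast
    show "eval_fam x = frag_of (g x)" unfolding D(2) gc[OF D(1)] using eval_fam_basis_fams D(1) by simp
  qed
  moreover have "g ` basis_fams = m ` ?X" unfolding basis_fams_def image_image using gc by (rule image_cong[OF refl])
  moreover have "m ` ?X = S" by (rule bij_betw_imp_surj_on[OF bij])
  ultimately show ?thesis by (intro exI[of _ g]) simp
qed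

text \<open>The kernel of the evaluation is exactly \<open>J\<close>: modulo \<open>J\<close> every
  element is a combination of basis families, and these go to distinct elements of the basis
  \<open>S\<close>, so a combination in the kernel vanishes.\<close>

theorem coincides: "coincides_with_tensor_product R I A"
proof -
  obtain h where h: "h \<in> ring_hom M R" and hf: "\<And>x. x \<in> carrier P \<Longrightarrow> h (frag_of x) = eval_fam x"
    using hom_exists by blast
  interpret h: ring_hom_ring M R h
    by (rule ring_hom_ringI2[OF ring_M R.ring_axioms h])
  obtain g where g: "inj_on g basis_fams" "\<And>x. x \<in> basis_fams \<Longrightarrow> eval_fam x = frag_of (g x)" "g ` basis_fams = S" using eval_fam_basis_fams_ex by blast
  have ha: "h (x + y) = h x + h y" if "Poly_Mapping.keys x \<subseteq> carrier P" "Poly_Mapping.keys y \<subseteq> carrier P" for x y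
    using ring_hom_add[OF h, of x y] that by (simp add: add_R carrier_monoid_ring monoid_ring_simps)
  have hd: "h (x - y) = h x - h y" if "Poly_Mapping.keys x \<subseteq> carrier P" "Poly_Mapping.keys y \<subseteq> carrier P" for x y
  proof -
    have "Poly_Mapping.keys (x - y) \<subseteq> carrier P" using that keys_diff[of x y] by blast
    then show ?thesis using ha[of "x - y" y] that by simp
  qed
  have h0: "h 0 = 0" using ha[of 0 0] by simp
  have ker: "z \<in> a_kernel M R h \<longleftrightarrow> z \<in> carrier M \<and> h z = 0" for z
    unfolding a_kernel_def' zero_R by (rule mem_Collect_eq)
  have relk: "tensor_relators I A \<subseteq> a_kernel M R h"
  proof
    fix z assume zr: "z \<in> tensor_relators I A"
    then obtain x i a b where z: "z = frag_of (x(i := a \<oplus>\<^bsub>A i\<^esub> b)) - frag_of (x(i := a)) - frag_of (x(i := b))"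
      "x \<in> carrier P" "i \<in> I" "a \<in> carrier (A i)" "b \<in> carrier (A i)" by (auto simp: tensor_relators_def)
    have k: "Poly_Mapping.keys a \<subseteq> T i" "Poly_Mapping.keys b \<subseteq> T i" "Poly_Mapping.keys (a + b) \<subseteq> T i"
      using z carrier_A[OF z(3)] keys_add[of a b] by auto
    have gc: "gfinprod R x (I - {i}) \<in> carrier R"
      using P_R[OF z(2)] by (intro R.gfinprod_closed) auto
    have "a \<in> carrier R" "b \<in> carrier R"
      using k(1,2) T_S[OF z(3)] by (auto simp: carrier_R)
    note c = this gc
    note p = P_upd[OF z(2,3)]
    let ?u = "frag_of (x(i := a + b))" and ?v = "frag_of (x(i := a))" and ?w = "frag_of (x(i := b))"
    have "Poly_Mapping.keys ?u \<subseteq> carrier P" "Poly_Mapping.keys ?v \<subseteq> carrier P" "Poly_Mapping.keys ?w \<subseteq> carrier P"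
      using p k by auto
    moreover from this have "Poly_Mapping.keys (?u - ?v) \<subseteq> carrier P" using keys_diff[of ?u ?v] by blast
    ultimately have "h (?u - ?v - ?w) = eval_fam (x(i := a + b)) - eval_fam (x(i := a)) - eval_fam (x(i := b))"
      using p k by (simp add: hd hf)
    also have "\<dots> = 0"
      using R.l_distr[OF c] by (simp add: eval_fam_upd[OF z(2,3)] k add_R)
    finally have "h z = 0" unfolding z(1) add_A[OF z(3)] .
    then show "z \<in> a_kernel M R h" using zr relators_M ker by auto
  qed
  have "J \<subseteq> a_kernel M R h"
    unfolding tensor_ideal_def by (rule ring.genideal_minimal[OF ring_M h.kernel_is_ideal relk])
  moreover have "a_kernel M R h \<subseteq> J"
  proof
    fix z assume "z \<in> a_kernel M R h"
    then have z: "Poly_Mapping.keys z \<subseteq> carrier P" "h z = 0" by (auto simp: ker carrier_monoid_ring)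
    obtain w where w: "Poly_Mapping.keys w \<subseteq> basis_fams" "z - w \<in> J" using spanned_all[OF z(1)] by (auto simp: spanned_def)
    have wP: "Poly_Mapping.keys w \<subseteq> carrier P" using w basis_fams_P by auto
    have "h (z - w) = 0" using w(2) \<open>J \<subseteq> a_kernel M R h\<close> ker by auto
    then have hw: "h w = 0" using hd[OF z(1) wP] z(2) by simp
    have ext: "h w = frag_extend (frag_of \<circ> g) w"
      using w(1)
    proof (rule free_Abelian_group_induct)
      fix x y assume "Poly_Mapping.keys x \<subseteq> basis_fams" "Poly_Mapping.keys y \<subseteq> basis_fams"
        "h x = frag_extend (frag_of \<circ> g) x" "h y = frag_extend (frag_of \<circ> g) y"
      then show "h (x - y) = frag_extend (frag_of \<circ> g) (x - y)"
        using basis_fams_P by (subst hd) (auto simp: frag_extend_diff)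
    qed (use g(2) hf basis_fams_P h0 in auto)
    have "w = 0"
    proof (rule poly_mapping_eqI, rule ccontr)
      fix x assume "Poly_Mapping.lookup w x \<noteq> Poly_Mapping.lookup 0 x"
      then have x: "x \<in> Poly_Mapping.keys w" by (simp add: in_keys_iff)
      \<comment> \<open>Since \<open>g\<close> is injective on the basis families, no other term of
        \<open>w\<close> contributes to the coefficient at \<open>g x\<close>.\<close>
      have "Poly_Mapping.lookup (h w) (g x) = (\<Sum>y\<in>Poly_Mapping.keys w. if y = x then Poly_Mapping.lookup w y else 0)"
        unfolding ext lookup_frag_extend
      proof (intro sum.cong refl)
        fix y assume y: "y \<in> Poly_Mapping.keys w"
        then have "g x = g y \<longleftrightarrow> x = y" using x w(1) g(1) by (meson inj_on_eq_iff subsetD)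
        then show "Poly_Mapping.lookup w y * Poly_Mapping.lookup ((frag_of \<circ> g) y) (g x) = (if y = x then Poly_Mapping.lookup w y else 0)"
          by auto
      qed
      also have "\<dots> = Poly_Mapping.lookup w x" using x by (simp add: sum.delta')
      finally show False using hw x by (simp add: in_keys_iff)
    qed
    then show "z \<in> J" using w(2) by simp
  qed
  ultimately have kJ: "a_kernel M R h = J" by blast
  have surj: "h ` carrier M = carrier R"
  proof
    show "h ` carrier M \<subseteq> carrier R" using h.hom_closed by auto
    show "carrier R \<subseteq> h ` carrier M"
    proof
      fix r assume "r \<in> carrier R"
      then have "Poly_Mapping.keys r \<subseteq> S" by (simp add: carrier_R)
      then show "r \<in> h ` carrier M"
      proof (rule free_Abelian_group_induct)
        show "0 \<in> h ` carrier M" using h0 by (intro image_eqI[of _ _ 0]) (auto simp: carrier_monoid_ring)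
      next
        fix x y assume "x \<in> h ` carrier M" "y \<in> h ` carrier M"
        then obtain u v where u: "Poly_Mapping.keys u \<subseteq> carrier P" "x = h u" "Poly_Mapping.keys v \<subseteq> carrier P" "y = h v"
          by (auto simp: carrier_monoid_ring)
        then have "x - y = h (u - v)" "Poly_Mapping.keys (u - v) \<subseteq> carrier P"
          using hd keys_diff[of u v] by auto
        then show "x - y \<in> h ` carrier M" by (auto simp: carrier_monoid_ring)
      next
        fix s assume "s \<in> S"
        then obtain x where x: "x \<in> basis_fams" "s = g x" using g(3) by auto
        then have "frag_of s = h (frag_of x)" "frag_of x \<in> carrier M" using g(2) hf basis_fams_P by (auto simp: carrier_monoid_ring)
        then show "frag_of s \<in> h ` carrier M" by blast
      qed
    qed
  qed
  have iso: "(\<lambda>X. the_elem (h ` X)) \<in> ring_iso (tensor_product I A) R"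
    using h.FactRing_iso_set[OF surj] unfolding kJ tensor_product_def .
  have pt: "the_elem (h ` pure_tensor I A x) = gfinprod R x I" if "x \<in> carrier P" for x
  proof -
    have "frag_of x \<in> carrier M" using that by (simp add: carrier_monoid_ring)
    from h.the_elem_simp[OF this] show ?thesis using hf[OF that] unfolding kJ pure_tensor_def eval_fam_def by simp
  qed
  have "ring (A i) \<and> (\<lambda>a. a) \<in> ring_hom (A i) R" if i: "i \<in> I" for i
  proof
    show "ring (A i)" by (rule ring_A[OF i])
    show "(\<lambda>a. a) \<in> ring_hom (A i) R"
      by (rule ring_hom_memI) (use carrier_A[OF i] carrier_R T_S[OF i] add_A[OF i] add_R mult_A[OF i] one_A[OF i] one_R in auto)
  qed
  then show ?thesis unfolding coincides_with_tensor_product_def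
    by (intro conjI ballI bexI[OF _ iso] pt) simp_all
qed

end

section \<open>Hecke pairs with a torus of representatives\<close>

text \<open>\<open>GP Q\<close> models the elements whose denominators involve only primes of
  \<open>Q\<close>; \<open>GP_disjoint\<close> for two empty sets gives \<open>GP {} = U\<close>. In
  the applications \<open>T\<close> consists of one diagonal matrix per double coset and is not
  closed under inverses, which is why \<open>T_inv\<close> speaks of a double coset.\<close>

locale hecke_torus = hecke G U for G (structure) and U +
  fixes T :: "'a set" and GP :: "'i set \<Rightarrow> 'a set" and I :: "'i set"
  assumes T_carrier: "T \<subseteq> carrier G"
    and T_rep: "g \<in> carrier G \<Longrightarrow> \<exists>t\<in>T. g \<in> double_coset G U t"
    and T_unique: "s \<in> T \<Longrightarrow> t \<in> T \<Longrightarrow> s \<in> double_coset G U t \<Longrightarrow> s = t"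
    and T_inv: "t \<in> T \<Longrightarrow> inv t \<in> double_coset G U t"
    and GP_subgroup: "Q \<subseteq> I \<Longrightarrow> subgroup (GP Q) G"
    and GP_disjoint: "P \<subseteq> I \<Longrightarrow> Q \<subseteq> I \<Longrightarrow> P \<inter> Q = {} \<Longrightarrow> GP P \<inter> GP Q = U"
    and GP_mono: "P \<subseteq> Q \<Longrightarrow> Q \<subseteq> I \<Longrightarrow> GP P \<subseteq> GP Q"
    and GP_exhaust: "g \<in> carrier G \<Longrightarrow> \<exists>Q. finite Q \<and> Q \<subseteq> I \<and> g \<in> GP Q"
    and T_split: "P \<subseteq> I \<Longrightarrow> Q \<subseteq> I \<Longrightarrow> P \<inter> Q = {} \<Longrightarrow> t \<in> T \<Longrightarrow> t \<in> GP (P \<union> Q) \<Longrightarrow>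
       \<exists>t1\<in>T \<inter> GP P. \<exists>t2\<in>T \<inter> GP Q. t = t1 \<otimes> t2"
begin

lemma GP_carrier: "Q \<subseteq> I \<Longrightarrow> g \<in> GP Q \<Longrightarrow> g \<in> carrier G"
  by (rule subgroup.mem_carrier[OF GP_subgroup])

lemma U_GP: "Q \<subseteq> I \<Longrightarrow> u \<in> U \<Longrightarrow> u \<in> GP Q"
  using GP_disjoint[of Q "{}"] by auto

lemma GP_mult: "Q \<subseteq> I \<Longrightarrow> g \<in> GP Q \<Longrightarrow> h \<in> GP Q \<Longrightarrow> g \<otimes> h \<in> GP Q"
  by (rule subgroup.m_closed[OF GP_subgroup])

lemma GP_inv: "Q \<subseteq> I \<Longrightarrow> g \<in> GP Q \<Longrightarrow> inv g \<in> GP Q"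
  by (rule subgroup.m_inv_closed[OF GP_subgroup])

lemma GP_dc: "Q \<subseteq> I \<Longrightarrow> g \<in> GP Q \<Longrightarrow> x \<in> dc g \<Longrightarrow> x \<in> GP Q"
  unfolding mem_dc using GP_mult[OF _ GP_mult[OF _ U_GP] U_GP] by blast

lemma inv_dc:
  assumes "g \<in> carrier G"
  shows "inv g \<in> dc g"
proof -
  obtain t where t: "t \<in> T" "g \<in> dc t" using T_rep assms by blast
  have tc: "t \<in> carrier G" using t T_carrier by blast
  obtain u v where uv: "u \<in> U" "v \<in> U" "g = u \<otimes> t \<otimes> v" using t mem_dc by blast
  have "inv g = inv v \<otimes> inv t \<otimes> inv u"
    unfolding uv(3) using uv(1,2) tc by (simp add: U_carrier inv_mult_group m_assoc)
  then have "inv g \<in> dc (inv t)" using uv(1,2) dcI[of "inv v" "inv u" "inv t"] by simp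
  moreover have "dc (inv t) = dc g" using dc_eqI[OF T_inv[OF t(1)] tc] dc_eqI[OF t(2) tc] by simp
  ultimately show ?thesis by simp
qed

lemma cring_hecke: "cring H"
  by (rule cring_H[OF inv_dc])

text \<open>From \<open>g u h = a t1 t2 b\<close> it follows that \<open>w = t1^-1 a^-1 g u\<close>
  equals \<open>t2 b h^-1\<close>. The first expression lies in \<open>GP P\<close> and the second
  in \<open>GP Q\<close>, so \<open>w\<close> is in \<open>U\<close>; solving for \<open>g\<close>
  and \<open>h\<close> exhibits their double cosets.\<close>

lemma torus_decomp:
  assumes P: "P \<subseteq> I" "Q \<subseteq> I" "P \<inter> Q = {}" and g: "g \<in> GP P" and h: "h \<in> GP Q" and u: "u \<in> U"
  shows "\<exists>t1\<in>T. \<exists>t2\<in>T. g \<in> dc t1 \<and> h \<in> dc t2 \<and> g \<otimes> u \<otimes> h \<in> dc (t1 \<otimes> t2)"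
proof -
  have PQ: "P \<union> Q \<subseteq> I" using P by auto
  have gc: "g \<in> carrier G" "h \<in> carrier G" "u \<in> carrier G" using GP_carrier P g h u U_carrier by auto
  have x: "g \<otimes> u \<otimes> h \<in> GP (P \<union> Q)"
    using GP_mono[of P "P \<union> Q"] GP_mono[of Q "P \<union> Q"] PQ g h U_GP[OF PQ u] by (intro GP_mult) auto
  obtain t where t: "t \<in> T" "g \<otimes> u \<otimes> h \<in> dc t" using T_rep[of "g \<otimes> u \<otimes> h"] gc by auto
  have tc: "t \<in> carrier G" using t T_carrier by auto
  have "t \<in> GP (P \<union> Q)" using GP_dc[OF PQ x dc_sym[OF t(2) tc]] .
  then obtain t1 t2 where t12: "t1 \<in> T" "t1 \<in> GP P" "t2 \<in> T" "t2 \<in> GP Q" "t = t1 \<otimes> t2"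
    using T_split[OF P t(1)] by blast
  have tc': "t1 \<in> carrier G" "t2 \<in> carrier G" using t12 T_carrier by auto
  obtain a b where ab: "a \<in> U" "b \<in> U" "g \<otimes> u \<otimes> h = a \<otimes> t \<otimes> b" using t(2) mem_dc by blast
  have abc: "a \<in> carrier G" "b \<in> carrier G" using ab U_carrier by auto
  define w where "w = inv t1 \<otimes> (inv a \<otimes> (g \<otimes> u))"
  have wP: "w \<in> GP P" unfolding w_def by (intro GP_mult GP_inv U_GP t12 g u ab P)
  have "w \<otimes> h = inv t1 \<otimes> (inv a \<otimes> (g \<otimes> u \<otimes> h))" unfolding w_def using gc tc' abc by (simp add: m_assoc)
  also have "\<dots> = t2 \<otimes> b" unfolding ab(3) t12(5) using gc tc' abc by (simp add: m_assoc)
  finally have wh: "w \<otimes> h = t2 \<otimes> b" .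
  have wc: "w \<in> carrier G" using wP GP_carrier P by auto
  have "w = (w \<otimes> h) \<otimes> inv h" using wc gc by (simp add: m_assoc)
  also have "\<dots> = t2 \<otimes> b \<otimes> inv h" unfolding wh ..
  also have "\<dots> \<in> GP Q" by (intro GP_mult GP_inv U_GP t12 h ab P)
  finally have wU: "w \<in> U" using wP GP_disjoint[OF P] by auto
  have "g = a \<otimes> t1 \<otimes> (w \<otimes> inv u)" unfolding w_def using gc tc' abc by (simp add: m_assoc)
  then have "g \<in> dc t1" using ab wU u dcI[of a "w \<otimes> inv u" t1] by simp
  moreover have "h = inv w \<otimes> t2 \<otimes> b"
  proof -
    have "h = inv w \<otimes> (w \<otimes> h)" using wc gc by simp
    then show ?thesis unfolding wh using wc tc' abc by (simp add: m_assoc)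
  qed
  then have "h \<in> dc t2" using ab wU dcI[of "inv w" b t2] by simp
  ultimately show ?thesis using t t12 by auto
qed

text \<open>The double coset of \<open>g u h\<close> is that of \<open>t1 t2\<close>, where
  \<open>t1\<close> and \<open>t2\<close> are determined by \<open>g\<close> and \<open>h\<close>
  alone; so the case of a general \<open>u\<close> can be compared with
  \<open>u = \<one>\<close>.\<close>

lemma dc_mult_coprime:
  assumes P: "P \<subseteq> I" "Q \<subseteq> I" "P \<inter> Q = {}" and g: "g \<in> GP P" and h: "h \<in> GP Q" and u: "u \<in> U"
  shows "g \<otimes> u \<otimes> h \<in> dc (g \<otimes> h)"
proof -
  have gc: "g \<in> carrier G" "h \<in> carrier G" using GP_carrier P g h by auto
  obtain t1 t2 where t: "t1 \<in> T" "t2 \<in> T" "g \<in> dc t1" "h \<in> dc t2" "g \<otimes> u \<otimes> h \<in> dc (t1 \<otimes> t2)"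
    using torus_decomp[OF P g h u] by blast
  obtain s1 s2 where s: "s1 \<in> T" "s2 \<in> T" "g \<in> dc s1" "h \<in> dc s2" "g \<otimes> \<one> \<otimes> h \<in> dc (s1 \<otimes> s2)"
    using torus_decomp[OF P g h one_closed] by blast
  have tc: "t1 \<in> carrier G" "t2 \<in> carrier G" "s1 \<in> carrier G" "s2 \<in> carrier G" using t s T_carrier by auto
  have "dc s1 = dc t1" using dc_eqI[OF s(3) tc(3)] dc_eqI[OF t(3) tc(1)] by simp
  then have 1: "s1 = t1" using T_unique[OF s(1) t(1)] self_dc[OF tc(3)] by simp
  have "dc s2 = dc t2" using dc_eqI[OF s(4) tc(4)] dc_eqI[OF t(4) tc(2)] by simp
  then have 2: "s2 = t2" using T_unique[OF s(2) t(2)] self_dc[OF tc(4)] by simp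
  have "dc (g \<otimes> h) = dc (t1 \<otimes> t2)" using dc_eqI[OF s(5)] tc gc unfolding 1 2 by simp
  then show ?thesis using t(5) by simp
qed

lemma dc_split:
  assumes P: "P \<subseteq> I" "Q \<subseteq> I" "P \<inter> Q = {}" and g: "g \<in> GP (P \<union> Q)"
  shows "\<exists>g1\<in>GP P. \<exists>g2\<in>GP Q. dc g = dc (g1 \<otimes> g2)"
proof -
  have PQ: "P \<union> Q \<subseteq> I" using P by auto
  have gc: "g \<in> carrier G" by (rule GP_carrier[OF PQ g])
  obtain t where t: "t \<in> T" "g \<in> dc t" using T_rep gc by blast
  have tc: "t \<in> carrier G" using t T_carrier by auto
  have "t \<in> GP (P \<union> Q)" using GP_dc[OF PQ g dc_sym[OF t(2) tc]] .
  then obtain t1 t2 where "t1 \<in> GP P" "t2 \<in> GP Q" "t = t1 \<otimes> t2"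
    using T_split[OF P t(1)] by blast
  then show ?thesis using dc_eqI[OF t(2) tc] by blast
qed

text \<open>The device of \<open>torus_decomp\<close> again: the element \<open>w\<close> that links
  the two factorisations belongs to both \<open>GP P\<close> and \<open>GP Q\<close>, hence to
  \<open>U\<close>.\<close>

lemma dc_split_unique:
  assumes P: "P \<subseteq> I" "Q \<subseteq> I" "P \<inter> Q = {}" and g: "g \<in> GP P" "g' \<in> GP P" and h: "h \<in> GP Q" "h' \<in> GP Q"
    and eq: "dc (g \<otimes> h) = dc (g' \<otimes> h')"
  shows "dc g = dc g' \<and> dc h = dc h'"
proof -
  have gc: "g \<in> carrier G" "h \<in> carrier G" "g' \<in> carrier G" "h' \<in> carrier G" using GP_carrier P g h by auto
  have "g' \<otimes> h' \<in> dc (g \<otimes> h)" using eq self_dc gc by auto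
  then obtain a b where ab: "a \<in> U" "b \<in> U" "g' \<otimes> h' = a \<otimes> (g \<otimes> h) \<otimes> b" using mem_dc by blast
  have abc: "a \<in> carrier G" "b \<in> carrier G" using ab U_carrier by auto
  define w where "w = inv g \<otimes> (inv a \<otimes> g')"
  have wP: "w \<in> GP P" unfolding w_def by (intro GP_mult GP_inv U_GP g ab P)
  have wc: "w \<in> carrier G" using wP GP_carrier P by auto
  have "w \<otimes> h' = inv g \<otimes> (inv a \<otimes> (g' \<otimes> h'))" unfolding w_def using gc abc by (simp add: m_assoc)
  also have "\<dots> = h \<otimes> b" unfolding ab(3) using gc abc by (simp add: m_assoc)
  finally have wh: "w \<otimes> h' = h \<otimes> b" .
  have "w = (w \<otimes> h') \<otimes> inv h'" using wc gc by (simp add: m_assoc)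
  also have "\<dots> = h \<otimes> b \<otimes> inv h'" unfolding wh ..
  also have "\<dots> \<in> GP Q" by (intro GP_mult GP_inv U_GP h ab P)
  finally have wU: "w \<in> U" using wP GP_disjoint[OF P] by auto
  have "g' = a \<otimes> g \<otimes> w" unfolding w_def using gc abc by (simp add: m_assoc)
  then have 1: "dc g' = dc g" using dc_mult_U(1)[OF ab(1) wU gc(1)] by simp
  have "h' = inv w \<otimes> (w \<otimes> h')" using wc gc by simp
  then have "h' = inv w \<otimes> h \<otimes> b" unfolding wh using wc gc abc by (simp add: m_assoc)
  then have "dc h' = dc h" using dc_mult_U(1)[OF m_inv_closed[OF wU] ab(2) gc(2)] by simp
  with 1 show ?thesis by simp
qed

lemma frag_of_dc_closed: "g \<in> carrier G \<Longrightarrow> frag_of (dc g) \<in> carrier H"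
  by (simp add: carrier_H)

text \<open>The product is supported on one double coset by \<open>dc_mult_coprime\<close>. Its
  coefficient is 1: if \<open>g h c^-1\<close> lies in \<open>dc g\<close> and \<open>c\<close> in
  \<open>dc h\<close>, then \<open>h c^-1\<close> lies in \<open>GP P\<close> and in
  \<open>GP Q\<close>, hence in \<open>U\<close>, so \<open>c\<close> and \<open>h\<close> span the
  same right coset.\<close>

lemma mult_coprime:
  assumes P: "P \<subseteq> I" "Q \<subseteq> I" "P \<inter> Q = {}" and g: "g \<in> GP P" and h: "h \<in> GP Q"
  shows "frag_of (dc g) \<otimes>\<^bsub>H\<^esub> frag_of (dc h) = frag_of (dc (g \<otimes> h))"
proof (rule H_eqI)
  have gc: "g \<in> carrier G" "h \<in> carrier G" "g \<otimes> h \<in> carrier G" using GP_carrier P g h by auto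
  show "frag_of (dc g) \<otimes>\<^bsub>H\<^esub> frag_of (dc h) \<in> carrier H"
    by (intro mult_H_closed frag_of_dc_closed gc)
  show "frag_of (dc (g \<otimes> h)) \<in> carrier H" by (intro frag_of_dc_closed gc)
  fix x assume x: "x \<in> carrier G"
  let ?S = "\<lambda>x. {C \<in> RC (dc h). x \<otimes> inv (rep C) \<in> dc g}"
  have v: "val (frag_of (dc g) \<otimes>\<^bsub>H\<^esub> frag_of (dc h)) y = int (card (?S y))" if "y \<in> carrier G" for y
    using lookup_dcm[OF gc(1,2) that] by (simp add: val_def mult_H)
  show "val (frag_of (dc g) \<otimes>\<^bsub>H\<^esub> frag_of (dc h)) x = val (frag_of (dc (g \<otimes> h))) x"
  proof (cases "dc x = dc (g \<otimes> h)")
    case True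
    have "?S (g \<otimes> h) = {U #> h}"
    proof
      show "{U #> h} \<subseteq> ?S (g \<otimes> h)"
      proof -
        obtain w where w: "w \<in> U" "rep (U #> h) = w \<otimes> h" using rep_coset[OF gc(2)] by blast
        have "g \<otimes> h \<otimes> inv (w \<otimes> h) = g \<otimes> inv w"
          using w(1) gc(1,2) by (simp add: U_carrier inv_mult_group m_assoc)
        then have "g \<otimes> h \<otimes> inv (rep (U #> h)) \<in> dc g"
          unfolding w(2) using w(1) dc_right_mult[OF self_dc[OF gc(1)] gc(1), of "inv w"] by simp
        moreover have "U #> h \<in> RC (dc h)" using self_dc[OF gc(2)] by (auto simp: mem_RC)
        ultimately show ?thesis by simp
      qed
      show "?S (g \<otimes> h) \<subseteq> {U #> h}"
      proof
        fix C assume C: "C \<in> ?S (g \<otimes> h)"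
        then have Cr: "C \<in> rcosets U" using RC_rcosets[OF gc(2)] by blast
        note r = rcosets_rep[OF Cr]
        have c: "rep C \<in> GP Q" using C RC_iff[OF Cr gc(2)] GP_dc[OF P(2) h] by auto
        have "g \<otimes> h \<otimes> inv (rep C) \<in> GP P" using C GP_dc[OF P(1) g] by auto
        then have "inv g \<otimes> (g \<otimes> h \<otimes> inv (rep C)) \<in> GP P"
          by (rule GP_mult[OF P(1) GP_inv[OF P(1) g]])
        then have "h \<otimes> inv (rep C) \<in> GP P" using gc(1,2) r(1) by (simp add: m_assoc)
        moreover have "h \<otimes> inv (rep C) \<in> GP Q" by (intro GP_mult GP_inv h c P)
        ultimately have "h \<otimes> inv (rep C) \<in> U" using GP_disjoint[OF P] by auto
        then have "U #> h = U #> rep C" using coset_eq_iff[OF gc(2) r(1)] by simp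
        then show "C \<in> {U #> h}" using r(2) by simp
      qed
    qed
    then have "val (frag_of (dc g) \<otimes>\<^bsub>H\<^esub> frag_of (dc h)) (g \<otimes> h) = 1" using v[OF gc(3)] by simp
    then show ?thesis using True by (simp add: val_def)
  next
    case False
    have "?S x = {}"
    proof (rule equals0I)
      fix C assume C: "C \<in> ?S x"
      then have Cr: "C \<in> rcosets U" using RC_rcosets[OF gc(2)] by blast
      note r = rcosets_rep[OF Cr]
      have "rep C \<in> dc h" using C RC_iff[OF Cr gc(2)] by auto
      then obtain u1 u2 where u: "u1 \<in> U" "u2 \<in> U" "rep C = u1 \<otimes> h \<otimes> u2" using mem_dc by blast
      obtain a b where ab: "a \<in> U" "b \<in> U" "x \<otimes> inv (rep C) = a \<otimes> g \<otimes> b" using C mem_dc by blast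
      have "x = (x \<otimes> inv (rep C)) \<otimes> rep C" using x r(1) by (simp add: m_assoc)
      also have "\<dots> = a \<otimes> (g \<otimes> (b \<otimes> u1) \<otimes> h) \<otimes> u2"
        unfolding ab(3) unfolding u(3) using ab(1,2) u(1,2) gc(1,2) by (simp add: U_carrier m_assoc)
      finally have xe: "x = a \<otimes> (g \<otimes> (b \<otimes> u1) \<otimes> h) \<otimes> u2" .
      have bu: "b \<otimes> u1 \<in> U" using ab u by simp
      have "dc x = dc (g \<otimes> (b \<otimes> u1) \<otimes> h)"
        unfolding xe by (rule dc_mult_U(1)[OF ab(1) u(2)]) (use gc bu in \<open>simp add: U_carrier\<close>)
      also have "\<dots> = dc (g \<otimes> h)" by (rule dc_eqI[OF dc_mult_coprime[OF P g h bu] gc(3)])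
      finally show False using False by simp
    qed
    then have "val (frag_of (dc g) \<otimes>\<^bsub>H\<^esub> frag_of (dc h)) x = 0" using v[OF x] by (simp only: card.empty of_nat_0)
    then show ?thesis using False by (simp add: val_def)
  qed
qed

section \<open>Products over families of primary double cosets\<close>

definition primary_dcs where "primary_dcs i = dc ` GP {i}"

lemma primary_dcs_closed: "i \<in> I \<Longrightarrow> d \<in> primary_dcs i \<Longrightarrow> frag_of d \<in> carrier H"
  using GP_carrier[of "{i}"] by (auto simp: primary_dcs_def carrier_H)

sublocale HR: cring H by (rule cring_hecke)

lemma fam_prod:
  assumes "finite Q" "Q \<subseteq> I" "\<And>i. i \<in> Q \<Longrightarrow> D i \<in> primary_dcs i"
  shows "\<exists>g\<in>GP Q. finprod H (\<lambda>i. frag_of (D i)) Q = frag_of (dc g)"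
  using assms
proof (induction Q)
  case empty
  have "\<one> \<in> GP {}" using U_GP[of "{}" \<one>] by simp
  then show ?case by (intro bexI[of _ \<one>]) (auto simp: one_H dc_one)
next
  case (insert i Q)
  obtain g where g: "g \<in> GP Q" "finprod H (\<lambda>i. frag_of (D i)) Q = frag_of (dc g)" using insert by auto
  obtain h where h: "h \<in> GP {i}" "D i = dc h" using insert.prems(2)[of i] by (auto simp: primary_dcs_def)
  have c: "(\<lambda>i. frag_of (D i)) \<in> Q \<rightarrow> carrier H" "frag_of (D i) \<in> carrier H"
    using insert.prems primary_dcs_closed by auto
  have "finprod H (\<lambda>i. frag_of (D i)) (insert i Q) = frag_of (dc h) \<otimes>\<^bsub>H\<^esub> frag_of (dc g)"
    using HR.finprod_insert[OF insert.hyps c] g(2) h(2) by simp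
  also have "\<dots> = frag_of (dc (h \<otimes> g))"
    by (rule mult_coprime[of "{i}" Q]) (use insert g h in auto)
  finally have e: "finprod H (\<lambda>i. frag_of (D i)) (insert i Q) = frag_of (dc (h \<otimes> g))" .
  have "h \<otimes> g \<in> GP (insert i Q)"
    using GP_mono[of "{i}" "insert i Q"] GP_mono[of Q "insert i Q"] insert.prems g h by (intro GP_mult) auto
  with e show ?case by blast
qed

lemma fam_inj:
  assumes "finite Q" "Q \<subseteq> I" "\<And>i. i \<in> Q \<Longrightarrow> D i \<in> primary_dcs i" "\<And>i. i \<in> Q \<Longrightarrow> D' i \<in> primary_dcs i"
    "finprod H (\<lambda>i. frag_of (D i)) Q = finprod H (\<lambda>i. frag_of (D' i)) Q"
  shows "\<forall>i\<in>Q. D i = D' i"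
  using assms
proof (induction Q)
  case (insert i Q)
  obtain g where g: "g \<in> GP Q" "finprod H (\<lambda>i. frag_of (D i)) Q = frag_of (dc g)"
    using fam_prod[OF insert.hyps(1), of D] insert.prems(1,2) by blast
  obtain g' where g': "g' \<in> GP Q" "finprod H (\<lambda>i. frag_of (D' i)) Q = frag_of (dc g')"
    using fam_prod[OF insert.hyps(1), of D'] insert.prems(1,3) by blast
  obtain h where h: "h \<in> GP {i}" "D i = dc h" using insert.prems(2)[of i] by (auto simp: primary_dcs_def)
  obtain h' where h': "h' \<in> GP {i}" "D' i = dc h'" using insert.prems(3)[of i] by (auto simp: primary_dcs_def)
  have c: "(\<lambda>i. frag_of (D i)) \<in> Q \<rightarrow> carrier H"
    using insert.prems(1) primary_dcs_closed[OF _ insert.prems(2)] by blast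
  have ci: "frag_of (D i) \<in> carrier H"
    using insert.prems(1) primary_dcs_closed[OF _ insert.prems(2)] by blast
  have c': "(\<lambda>i. frag_of (D' i)) \<in> Q \<rightarrow> carrier H"
    using insert.prems(1) primary_dcs_closed[OF _ insert.prems(3)] by blast
  have ci': "frag_of (D' i) \<in> carrier H"
    using insert.prems(1) primary_dcs_closed[OF _ insert.prems(3)] by blast
  have PQ: "{i} \<subseteq> I" "Q \<subseteq> I" "{i} \<inter> Q = {}" using insert.prems(1) insert.hyps(2) by blast+
  have "frag_of (dc (h \<otimes> g)) = frag_of (dc (h' \<otimes> g'))"
    using insert.prems(4) unfolding HR.finprod_insert[OF insert.hyps c ci] HR.finprod_insert[OF insert.hyps c' ci']
      g(2) g'(2) h(2) h'(2) mult_coprime[OF PQ h(1) g(1)] mult_coprime[OF PQ h'(1) g'(1)] .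
  then have "dc (h \<otimes> g) = dc (h' \<otimes> g')" by (simp add: frag_of_eq)
  then have eq: "dc h = dc h'" "dc g = dc g'" using dc_split_unique[OF PQ h(1) h'(1) g(1) g'(1)] by blast+
  have "\<forall>j\<in>Q. D j = D' j"
  proof (rule insert.IH[OF PQ(2)])
    show "finprod H (\<lambda>i. frag_of (D i)) Q = finprod H (\<lambda>i. frag_of (D' i)) Q"
      unfolding g(2) g'(2) eq(2) ..
  qed (rule insert.prems, blast)+
  moreover have "D i = D' i" unfolding h(2) h'(2) eq(1) ..
  ultimately show ?case by blast
qed simp

lemma fam_surj:
  assumes "finite Q" "Q \<subseteq> I" "g \<in> GP Q"
  shows "\<exists>D. (\<forall>i\<in>Q. D i \<in> primary_dcs i) \<and> finprod H (\<lambda>i. frag_of (D i)) Q = frag_of (dc g)"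
  using assms
proof (induction Q arbitrary: g)
  case empty
  have "g \<in> U" using empty GP_disjoint[of "{}" "{}"] by auto
  then show ?case by (simp add: one_H dc_U)
next
  case (insert i Q)
  have PQ: "{i} \<subseteq> I" "Q \<subseteq> I" "{i} \<inter> Q = {}" using insert by auto
  obtain h k where hk: "h \<in> GP {i}" "k \<in> GP Q" "dc g = dc (h \<otimes> k)"
    using dc_split[OF PQ, of g] insert.prems by auto
  obtain D where D: "\<forall>i\<in>Q. D i \<in> primary_dcs i" "finprod H (\<lambda>i. frag_of (D i)) Q = frag_of (dc k)"
    using insert.IH[OF PQ(2) hk(2)] by blast
  let ?D = "D(i := dc h)"
  have m: "?D j \<in> primary_dcs j" if "j \<in> insert i Q" for j using that D hk by (auto simp: primary_dcs_def)
  have c: "(\<lambda>i. frag_of (?D i)) \<in> Q \<rightarrow> carrier H" "frag_of (?D i) \<in> carrier H"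
    using m primary_dcs_closed insert.prems by blast+
  have "finprod H (\<lambda>i. frag_of (?D i)) Q = finprod H (\<lambda>i. frag_of (D i)) Q"
  proof (rule HR.finprod_cong')
    show "(\<lambda>i. frag_of (D i)) \<in> Q \<rightarrow> carrier H" using D(1) primary_dcs_closed PQ by blast
    show "\<And>j. j \<in> Q \<Longrightarrow> frag_of (?D j) = frag_of (D j)" using insert.hyps by auto
  qed simp
  then have "finprod H (\<lambda>i. frag_of (?D i)) (insert i Q) = frag_of (dc g)"
    using HR.finprod_insert[OF insert.hyps c] mult_coprime[OF PQ hk(1,2)] D(2) hk(3) by simp
  then show ?case using m by blast
qed

abbreviation fams where "fams \<equiv> {D \<in> (\<Pi>\<^sub>E i\<in>I. primary_dcs i). finite {i \<in> I. D i \<noteq> U}}"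

lemma U_primary_dcs: "i \<in> I \<Longrightarrow> U \<in> primary_dcs i"
  using U_GP[of "{i}" \<one>] dc_one unfolding primary_dcs_def by auto

text \<open>\<open>Q\<close> may be larger than the set of nontrivial coordinates, so that two
  families can be compared over one finite index set.\<close>

lemma fams_gfinprod:
  assumes "D \<in> fams" "finite Q" "{i \<in> I. D i \<noteq> U} \<subseteq> Q" "Q \<subseteq> I"
  shows "gfinprod H (\<lambda>i. frag_of (D i)) I = finprod H (\<lambda>i. frag_of (D i)) Q"
proof -
  have c: "(\<lambda>i. frag_of (D i)) \<in> I \<rightarrow> carrier H" using assms(1) primary_dcs_closed by (auto simp: PiE_iff)
  have "gfinprod H (\<lambda>i. frag_of (D i)) Q = gfinprod H (\<lambda>i. frag_of (D i)) I"
    by (rule HR.gfinprod_mono_neutral_cong_left[OF assms(4) _ refl c])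
      (use assms in \<open>auto simp: one_H frag_of_eq\<close>)
  moreover have "(\<lambda>i. frag_of (D i)) \<in> Q \<rightarrow> carrier H" using c assms(4) by auto
  ultimately show ?thesis using HR.gfinprod_eq_finprod[OF assms(2)] by simp
qed

definition fam_dc where "fam_dc D = (THE E. gfinprod H (\<lambda>i. frag_of (D i)) I = frag_of E)"

lemma fam_dc:
  assumes "D \<in> fams"
  shows "gfinprod H (\<lambda>i. frag_of (D i)) I = frag_of (fam_dc D)" "fam_dc D \<in> dc ` carrier G"
proof -
  let ?Q = "{i \<in> I. D i \<noteq> U}"
  have Q: "finite ?Q" "?Q \<subseteq> I" using assms by auto
  obtain g where g: "g \<in> GP ?Q" "finprod H (\<lambda>i. frag_of (D i)) ?Q = frag_of (dc g)"
    using fam_prod[OF Q, of D] assms by (auto simp: PiE_iff)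
  have e: "gfinprod H (\<lambda>i. frag_of (D i)) I = frag_of (dc g)"
    using fams_gfinprod[OF assms Q(1) order_refl Q(2)] g(2) by simp
  then have f: "fam_dc D = dc g" unfolding fam_dc_def by (intro the_equality) (auto simp: frag_of_eq)
  show "gfinprod H (\<lambda>i. frag_of (D i)) I = frag_of (fam_dc D)" using e f by simp
  show "fam_dc D \<in> dc ` carrier G" using f g(1) GP_carrier[OF Q(2)] by auto
qed

lemma bij_fam_dc: "bij_betw fam_dc fams (dc ` carrier G)"
  unfolding bij_betw_def
proof
  show "inj_on fam_dc fams"
  proof (rule inj_onI)
    fix D D' assume D: "D \<in> fams" and D': "D' \<in> fams" and eq: "fam_dc D = fam_dc D'"
    let ?Q = "{i \<in> I. D i \<noteq> U} \<union> {i \<in> I. D' i \<noteq> U}"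
    have Q: "finite ?Q" "?Q \<subseteq> I" using D D' by auto
    have "finprod H (\<lambda>i. frag_of (D i)) ?Q = finprod H (\<lambda>i. frag_of (D' i)) ?Q"
      using fams_gfinprod[OF D Q(1) Un_upper1 Q(2)] fams_gfinprod[OF D' Q(1) Un_upper2 Q(2)]
        fam_dc(1)[OF D] fam_dc(1)[OF D'] eq by simp
    then have "\<forall>i\<in>?Q. D i = D' i"
      by (intro fam_inj[OF Q]) (use D D' in \<open>auto simp: PiE_iff\<close>)
    then have "D i = D' i" if "i \<in> I" for i
    proof (cases "i \<in> ?Q")
      case False
      then have "D i = U" "D' i = U" using that by blast+
      then show ?thesis by (simp only:)
    qed blast
    then show "D = D'" using D D' by (intro PiE_ext[of D I primary_dcs D']) auto
  qed
  show "fam_dc ` fams = dc ` carrier G"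
  proof
    show "fam_dc ` fams \<subseteq> dc ` carrier G" using fam_dc(2) by blast
    show "dc ` carrier G \<subseteq> fam_dc ` fams"
    proof
      fix E assume "E \<in> dc ` carrier G"
      then obtain g where g: "g \<in> carrier G" "E = dc g" by blast
      obtain Q where Q: "finite Q" "Q \<subseteq> I" "g \<in> GP Q" using GP_exhaust g(1) by blast
      obtain D where D: "\<forall>i\<in>Q. D i \<in> primary_dcs i" "finprod H (\<lambda>i. frag_of (D i)) Q = frag_of (dc g)"
        using fam_surj[OF Q] by blast
      let ?D = "\<lambda>i\<in>I. if i \<in> Q then D i else U"
      have s: "{i \<in> I. ?D i \<noteq> U} \<subseteq> Q" by auto
      have "?D \<in> fams" using D(1) U_primary_dcs finite_subset[OF s Q(1)] by auto
      moreover have "finprod H (\<lambda>i. frag_of (?D i)) Q = finprod H (\<lambda>i. frag_of (D i)) Q"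
      proof (rule HR.finprod_cong')
        show "(\<lambda>i. frag_of (D i)) \<in> Q \<rightarrow> carrier H" using D(1) primary_dcs_closed Q by blast
        show "\<And>j. j \<in> Q \<Longrightarrow> frag_of (?D j) = frag_of (D j)" using Q(2) by auto
      qed simp
      ultimately have "frag_of (fam_dc ?D) = frag_of E" "?D \<in> fams"
        using fam_dc(1)[of ?D] fams_gfinprod[of ?D Q] s Q D(2) g(2) by simp_all
      then have "E = fam_dc ?D" by (simp only: frag_of_eq)
      then show "E \<in> fam_dc ` fams" using \<open>?D \<in> fams\<close> by (rule image_eqI)
    qed
  qed
qed

text \<open>Cosets and double cosets are formed from the multiplication alone, so shrinking the
  carrier leaves the finiteness condition as it is.\<close>

lemma hecke_restrict:
  assumes "Q \<subseteq> I"
  shows "hecke (G\<lparr>carrier := GP Q\<rparr>) U"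
proof -
  have s: "subgroup (GP Q) G" by (rule GP_subgroup[OF assms])
  have g: "group (G\<lparr>carrier := GP Q\<rparr>)" by (rule subgroup.subgroup_is_group[OF s is_group])
  have "subgroup U (G\<lparr>carrier := GP Q\<rparr>)"
    using subgroup_incl[OF subgroup_axioms s] U_GP[OF assms] by blast
  then show ?thesis
    unfolding hecke_def hecke_axioms_def using g fin GP_carrier[OF assms]
    by (simp add: right_cosets_in_def double_coset_def r_coset_def set_mult_def)
qed

theorem coincides_with_tensor:
  "coincides_with_tensor_product H I (\<lambda>i. hecke_algebra U (G\<lparr>carrier := GP {i}\<rparr>))"
proof (rule tensor_basis.coincides)
  have dcG: "double_coset (G\<lparr>carrier := X\<rparr>) U = dc" for X
    by (simp add: double_coset_def r_coset_def set_mult_def fun_eq_iff)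
  have ringA: "ring (hecke_algebra U (G\<lparr>carrier := GP {i}\<rparr>))" if "i \<in> I" for i
    by (rule hecke.ring_H[OF hecke_restrict]) (use that in auto)
  have multA: "monoid.mult (hecke_algebra U (G\<lparr>carrier := GP {i}\<rparr>)) = monoid.mult H" for i
  proof -
    have "double_coset_mult (G\<lparr>carrier := GP {i}\<rparr>) U = double_coset_mult G U"
      by (simp add: double_coset_mult_def hecke_coeff_def right_cosets_in_def dcG r_coset_def set_mult_def fun_eq_iff)
    then show ?thesis by (simp add: hecke_algebra_def)
  qed
  show "tensor_basis H I (\<lambda>i. hecke_algebra U (G\<lparr>carrier := GP {i}\<rparr>)) (dc ` carrier G) primary_dcs U fam_dc"
  proof (rule tensor_basis.intro)
    fix i assume i: "i \<in> I"
    show "ring (hecke_algebra U (G\<lparr>carrier := GP {i}\<rparr>))" by (rule ringA[OF i])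
    show "carrier (hecke_algebra U (G\<lparr>carrier := GP {i}\<rparr>)) = carrier (free_Abelian_group (primary_dcs i))"
      by (simp add: hecke_algebra_def dcG primary_dcs_def)
    show "primary_dcs i \<subseteq> dc ` carrier G" using GP_carrier[of "{i}"] i unfolding primary_dcs_def by blast
  next
    fix D assume "D \<in> (\<Pi>\<^sub>E i\<in>I. primary_dcs i)" "finite {i \<in> I. D i \<noteq> U}"
    then show "gfinprod H (\<lambda>i. frag_of (D i)) I = frag_of (fam_dc D)" using fam_dc(1)[of D] by simp
  next
    show "bij_betw fam_dc fams (dc ` carrier G)" by (rule bij_fam_dc)
  qed (use cring_hecke multA in \<open>simp_all add: hecke_algebra_def\<close>)
qed

end

section \<open>The groups attached to an integral form\<close>

lemma mat_scaleR_mult: "(c *\<^sub>R A) ** B = c *\<^sub>R (A ** B)" "A ** (c *\<^sub>R B) = c *\<^sub>R (A ** B)"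
  for A :: "real^'n^'m" and B :: "real^'k^'n"
  by (simp_all add: matrix_matrix_mult_def vec_eq_iff sum_distrib_left algebra_simps)

lemma matrix_add_rdistrib_real: "(A + B) ** C = A ** C + B ** C" for A B :: "real^'n^'m" and C :: "real^'k^'n"
  by (simp add: matrix_matrix_mult_def vec_eq_iff sum.distrib algebra_simps)

lemma mats_IntsE:
  assumes "A \<in> mats_over \<int>" obtains x where "A $ i $ j = of_int x"
proof -
  have "A $ i $ j \<in> \<int>" using assms unfolding mats_over_def by blast
  then show ?thesis using that by (auto elim: Ints_cases)
qed

lemma mats_Ints_mult: "A \<in> mats_over \<int> \<Longrightarrow> B \<in> mats_over \<int> \<Longrightarrow> A ** B \<in> mats_over \<int>"
  by (auto simp: mats_over_def matrix_matrix_mult_def intro!: Ints_sum Ints_mult)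

lemma mats_Rats_mult: "A \<in> mats_over \<rat> \<Longrightarrow> B \<in> mats_over \<rat> \<Longrightarrow> A ** B \<in> mats_over \<rat>"
  by (auto simp: mats_over_def matrix_matrix_mult_def intro!: Rats_sum Rats_mult)

lemma mat_1_mats: "mat 1 \<in> mats_over \<int>" "mat 1 \<in> mats_over \<rat>"
  by (auto simp: mats_over_def mat_def)

lemma mats_Ints_Rats: "A \<in> mats_over \<int> \<Longrightarrow> A \<in> mats_over \<rat>"
  using Ints_subset_Rats by (auto simp: mats_over_def)

lemma mats_Ints_scale: "c \<in> \<int> \<Longrightarrow> A \<in> mats_over \<int> \<Longrightarrow> c *\<^sub>R A \<in> mats_over \<int>"
  by (auto simp: mats_over_def)

lemma mats_Ints_add: "A \<in> mats_over \<int> \<Longrightarrow> B \<in> mats_over \<int> \<Longrightarrow> A + B \<in> mats_over \<int>"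
  by (auto simp: mats_over_def)

lemma mats_Rats_scale_cancel:
  assumes "n > 0" "real n *\<^sub>R A \<in> mats_over \<rat>"
  shows "A \<in> mats_over \<rat>"
  unfolding mats_over_def
proof (intro CollectI allI)
  fix i j
  have "real n * A $ i $ j \<in> \<rat>" using assms(2) by (simp add: mats_over_def)
  then have "(real n * A $ i $ j) / real n \<in> \<rat>" by (rule Rats_divide) simp
  then show "A $ i $ j \<in> \<rat>" using assms(1) by simp
qed

lemma det_Ints:
  fixes A :: "real^'n^'n"
  assumes "A \<in> mats_over \<int>" shows "det A \<in> \<int>"
  using assms unfolding det_def mats_over_def by (intro Ints_sum Ints_mult Ints_prod) auto

lemma det_scaleR: "det (c *\<^sub>R A) = c ^ CARD('n) * det A" for A :: "real^'n^'n"
proof -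
  have "c *\<^sub>R A = (mat c :: real^'n^'n) ** A"
    by (simp add: vec_eq_iff matrix_matrix_mult_def mat_def if_distrib[of "\<lambda>x. x * _"] sum.delta cong: if_cong)
  moreover have "det (mat c :: real^'n^'n) = c ^ CARD('n)"
    by (subst det_diagonal) (auto simp: mat_def)
  ultimately show ?thesis by (simp add: det_mul)
qed

section \<open>Isometries and the identity component\<close>

lemma quad_subst_mult: "quad_subst S (K ** L) = quad_subst (quad_subst S K) L"
  by (simp add: quad_subst_def matrix_transpose_mul matrix_mul_assoc)

lemma quad_subst_1: "quad_subst S (mat 1) = S"
  by (simp add: quad_subst_def transpose_mat)

lemma quad_subst_inverse:
  assumes "quad_subst S K = S" "K ** L = mat 1"
  shows "quad_subst S L = S"
  using assms by (metis quad_subst_1 quad_subst_mult)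

lemma det_quad_subst:
  assumes "quad_subst S K = S" "det S \<noteq> 0"
  shows "det K = 1 \<or> det K = -1"
proof -
  have "det (quad_subst S K) = det K * det S * det K" by (simp add: quad_subst_def det_mul)
  then have "det K * det K = 1" using assms by simp
  then show ?thesis by (simp add: square_eq_1_iff)
qed

lemma SO_inverse:
  assumes "K \<in> SO S"
  obtains L where "L \<in> SO S" "K ** L = mat 1" "L ** K = mat 1"
proof -
  have "invertible K" using assms by (simp add: SO_def invertible_det_nz)
  then obtain L where L: "K ** L = mat 1" "L ** K = mat 1" by (auto simp: invertible_def)
  have "det K * det L = det (mat 1 :: real^'a^'a)" using L(1) by (metis det_mul)
  then have "det L = 1" using assms by (simp add: SO_def)
  then show ?thesis using that L quad_subst_inverse[OF _ L(1)] assms by (auto simp: SO_def)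
qed

lemma SO_mult: "K \<in> SO S \<Longrightarrow> L \<in> SO S \<Longrightarrow> K ** L \<in> SO S"
  by (simp add: SO_def det_mul quad_subst_mult)

lemma one_SO: "mat 1 \<in> SO S"
  by (simp add: SO_def quad_subst_1)

lemma one_SO0: "mat 1 \<in> SO0 S"
  unfolding SO0_def using one_SO by (simp add: connected_component_refl)

lemma SO0_SO: "K \<in> SO0 S \<Longrightarrow> K \<in> SO S"
  unfolding SO0_def using connected_component_subset by blast

lemma SO0_I: "connected T \<Longrightarrow> mat 1 \<in> T \<Longrightarrow> T \<subseteq> SO S \<Longrightarrow> K \<in> T \<Longrightarrow> K \<in> SO0 S"
  unfolding SO0_def using connected_component_maximal by blast

lemma connected_SO0: "connected (SO0 S)"
  by (simp add: SO0_def)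

lemma continuous_on_matrix_mult_left: "continuous_on X (\<lambda>L. (K :: real^'n^'m) ** (L :: real^'k^'n))"
  unfolding matrix_matrix_mult_def by (intro continuous_intros)

lemma connected_translate_SO0: "connected ((\<lambda>L. K ** L) ` SO0 S)"
  by (rule connected_continuous_image[OF continuous_on_matrix_mult_left connected_SO0])

text \<open>The translate of the component by \<open>K\<close> is connected and shares
  \<open>K\<close> with the component, so the union is a connected set through the identity.\<close>

lemma SO0_mult:
  assumes "K \<in> SO0 S" "L \<in> SO0 S"
  shows "K ** L \<in> SO0 S"
proof (rule SO0_I)
  show "connected (SO0 S \<union> (\<lambda>L. K ** L) ` SO0 S)"
  proof (rule connected_Un[OF connected_SO0 connected_translate_SO0])
    have "K \<in> (\<lambda>L. K ** L) ` SO0 S" using one_SO0 by (intro image_eqI[of _ _ "mat 1"]) auto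
    then show "SO0 S \<inter> (\<lambda>L. K ** L) ` SO0 S \<noteq> {}" using assms by blast
  qed
  show "SO0 S \<union> (\<lambda>L. K ** L) ` SO0 S \<subseteq> SO S" using SO0_SO SO_mult assms by blast
qed (use one_SO0 assms in auto)

text \<open>The translate of the component by \<open>L\<close> is connected and contains both
  \<open>L\<close> and \<open>L ** K = mat 1\<close>.\<close>

lemma SO0_inverse:
  assumes "K \<in> SO0 S"
  obtains L where "L \<in> SO0 S" "K ** L = mat 1" "L ** K = mat 1"
proof -
  obtain L where L: "L \<in> SO S" "K ** L = mat 1" "L ** K = mat 1"
    using SO_inverse[OF SO0_SO[OF assms]] by blast
  have "L \<in> SO0 S"
  proof (rule SO0_I[OF connected_translate_SO0[of L]])
    show "mat 1 \<in> (\<lambda>M. L ** M) ` SO0 S" using L(3) assms by (metis image_eqI)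
    show "L \<in> (\<lambda>M. L ** M) ` SO0 S" using one_SO0 by (intro image_eqI[of _ _ "mat 1"]) auto
    show "(\<lambda>M. L ** M) ` SO0 S \<subseteq> SO S" using L(1) SO0_SO SO_mult by blast
  qed
  then show ?thesis using that L by blast
qed

lemma continuous_on_det: "continuous_on X f \<Longrightarrow> continuous_on X (\<lambda>x. det (f x :: real^'n^'n))"
  unfolding det_def by (intro continuous_intros)

text \<open>Isometries have determinant 1 or -1, and connectedness keeps it at the value 1 taken at
  \<open>x0\<close>. Hence only invariance of the form has to be verified along a family.\<close>

lemma SO0_path:
  fixes f :: "'a::topological_space \<Rightarrow> real^'n^'n"
  assumes S: "det S \<noteq> 0" and X: "connected X" "continuous_on X f"
    and x0: "x0 \<in> X" "f x0 = mat 1" and q: "\<And>x. x \<in> X \<Longrightarrow> quad_subst S (f x) = S" and x: "x \<in> X"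
  shows "f x \<in> SO0 S"
proof (rule SO0_I)
  show "connected (f ` X)" by (rule connected_continuous_image[OF X(2,1)])
  show "mat 1 \<in> f ` X" using x0 by (metis image_eqI)
  let ?D = "(\<lambda>x. det (f x)) ` X"
  have "connected ?D" by (rule connected_continuous_image[OF continuous_on_det[OF X(2)] X(1)])
  moreover have sub: "?D \<subseteq> {1, -1}" using det_quad_subst[OF q S] by auto
  ultimately have "\<exists>c. ?D = {c}" using connected_finite_iff_sing[of ?D] finite_subset[OF sub] x0 by auto
  moreover have "1 \<in> ?D" using x0 by (intro image_eqI[of _ _ x0]) simp_all
  ultimately have "?D = {1}" by (metis singletonD)
  then have "\<And>x. x \<in> X \<Longrightarrow> det (f x) = 1" by blast
  then show "f ` X \<subseteq> SO S" using q unfolding SO_def by blast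
  show "f x \<in> f ` X" using x by simp
qed

text \<open>
  Denominators are arbitrary products of elements of \<open>Q\<close>, so that \<open>Q = {p}\<close> gives the primary
  component at \<open>p\<close> for every \<open>p\<close>, prime or not.
\<close>

definition prim :: "real^'n^'n \<Rightarrow> nat set \<Rightarrow> (real^'n^'n) set" where
  "prim S Q = {M \<in> SO0 S \<inter> mats_over \<rat>.
     \<exists>K \<in> mats_over \<int>. \<exists>A. set_mset A \<subseteq> Q \<and> M = (1 / real (prod_mset A)) *\<^sub>R K}"

text \<open>Holding for every \<open>p\<close>, it allows the family of primary Hecke algebras to be
  rewritten as a function of \<open>p\<close>.\<close>

lemma prim_single: "matrix_group (prim S {p}) = SO0_primary S p"
proof -
  have "(\<exists>A. set_mset A \<subseteq> {p} \<and> M = (1 / real (prod_mset A)) *\<^sub>R K) \<longleftrightarrow> (\<exists>r::nat. M = (1 / real p ^ r) *\<^sub>R K)"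
    for M K :: "real^'a^'a"
  proof
    assume "\<exists>A. set_mset A \<subseteq> {p} \<and> M = (1 / real (prod_mset A)) *\<^sub>R K"
    then obtain A where A: "set_mset A \<subseteq> {p}" "M = (1 / real (prod_mset A)) *\<^sub>R K" by blast
    have "A = replicate_mset (size A) p" using A(1) by (metis set_mset_subset_singletonD)
    then have "prod_mset A = p ^ size A" by (metis prod_mset_replicate_mset)
    then show "\<exists>r::nat. M = (1 / real p ^ r) *\<^sub>R K" using A(2) by (auto intro!: exI[of _ "size A"])
  next
    assume "\<exists>r::nat. M = (1 / real p ^ r) *\<^sub>R K"
    then obtain r where "M = (1 / real p ^ r) *\<^sub>R K" by blast
    then show "\<exists>A. set_mset A \<subseteq> {p} \<and> M = (1 / real (prod_mset A)) *\<^sub>R K"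
      by (intro exI[of _ "replicate_mset r p"]) auto
  qed
  then show ?thesis by (simp add: SO0_primary_def prim_def)
qed

lemma prim_iff:
  assumes Q: "Q \<subseteq> {p. prime p}"
  shows "M \<in> prim S Q \<longleftrightarrow> M \<in> SO0 S \<and> (\<exists>n::nat. n > 0 \<and> prime_factors n \<subseteq> Q \<and> real n *\<^sub>R M \<in> mats_over \<int>)"
proof
  assume "M \<in> prim S Q"
  then obtain K A where h: "M \<in> SO0 S" "K \<in> mats_over \<int>" "set_mset A \<subseteq> Q" "M = (1 / real (prod_mset A)) *\<^sub>R K"
    by (auto simp: prim_def)
  have pA: "\<And>p. p \<in># A \<Longrightarrow> prime p" using h(3) Q by auto
  then have pf: "prime_factorization (prod_mset A) = A" by (rule prime_factorization_prod_mset_primes)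
  have n0: "prod_mset A > 0" using pA by (metis not_prime_0 gr0I prod_mset_zero_iff)
  have "real (prod_mset A) \<noteq> 0" using n0 by linarith
  then have "real (prod_mset A) *\<^sub>R M = K" unfolding h(4) by (simp del: of_nat_eq_0_iff)
  then show "M \<in> SO0 S \<and> (\<exists>n::nat. n > 0 \<and> prime_factors n \<subseteq> Q \<and> real n *\<^sub>R M \<in> mats_over \<int>)"
    using h n0 pf by (intro conjI exI[of _ "prod_mset A"]) auto
next
  assume "M \<in> SO0 S \<and> (\<exists>n::nat. n > 0 \<and> prime_factors n \<subseteq> Q \<and> real n *\<^sub>R M \<in> mats_over \<int>)"
  then obtain n :: nat where n: "M \<in> SO0 S" "n > 0" "prime_factors n \<subseteq> Q" "real n *\<^sub>R M \<in> mats_over \<int>" by blast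
  have pn: "prod_mset (prime_factorization n) = n" using n(2) prod_mset_prime_factorization_nat by blast
  have e: "M = (1 / real n) *\<^sub>R (real n *\<^sub>R M)" using n(2) by simp
  have "M \<in> mats_over \<rat>" by (rule mats_Rats_scale_cancel[OF n(2) mats_Ints_Rats[OF n(4)]])
  then show "M \<in> prim S Q" unfolding prim_def using n e pn by (auto intro!: bexI[OF _ n(4)] exI[of _ "prime_factorization n"])
qed

text \<open>Cramer's rule: an entry of the inverse is the determinant of \<open>M\<close> with one
  column replaced by a unit vector, and \<open>n\<close> times that matrix is integral. The exponent
  is crude, but a power of \<open>n\<close> brings in no new primes.\<close>

lemma inverse_denominator:
  fixes M :: "real^'n^'n"
  assumes "det M = 1" "M ** L = mat 1" "real n *\<^sub>R M \<in> mats_over \<int>"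
  shows "real (n ^ CARD('n)) *\<^sub>R L \<in> mats_over \<int>"
  unfolding mats_over_def
proof (intro CollectI allI)
  fix k j
  let ?B = "(\<chi> i l. if l = k then (M *v column j L) $ i else M $ i $ l) :: real^'n^'n"
  have c: "M *v column j L = column j (mat 1 :: real^'n^'n)"
    unfolding assms(2)[symmetric] by (simp add: vec_eq_iff matrix_matrix_mult_def matrix_vector_mult_def column_def)
  have "(real (n ^ CARD('n)) *\<^sub>R L) $ k $ j = real n ^ CARD('n) * det ?B"
    using cramer_lemma[of k M "column j L"] assms(1) by (simp add: column_def)
  also have "\<dots> = det (real n *\<^sub>R ?B)" by (simp add: det_scaleR)
  also have "\<dots> \<in> \<int>"
  proof (rule det_Ints)
    show "real n *\<^sub>R ?B \<in> mats_over \<int>"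
      using assms(3) unfolding c by (auto simp: mats_over_def column_def mat_def)
  qed
  finally show "(real (n ^ CARD('n)) *\<^sub>R L) $ k $ j \<in> \<int>" .
qed

lemma inverse_Ints:
  fixes M :: "real^'n^'n"
  assumes "det M = 1" "M ** L = mat 1" "M \<in> mats_over \<int>"
  shows "L \<in> mats_over \<int>"
  using inverse_denominator[of M L 1] assms by simp

lemma common_denominator:
  fixes M :: "real^'n^'n"
  assumes "M \<in> mats_over \<rat>"
  obtains n :: nat where "n > 0" "real n *\<^sub>R M \<in> mats_over \<int>"
proof -
  have "\<exists>n::nat. n > 0 \<and> real n * M $ i $ j \<in> \<int>" for i j
  proof -
    have "M $ i $ j \<in> \<rat>" using assms by (simp add: mats_over_def)
    then obtain a b :: int where "b > 0" "M $ i $ j = of_int a / of_int b" by (metis Rats_cases')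
    then show ?thesis by (intro exI[of _ "nat b"]) simp
  qed
  then obtain n :: "'n \<Rightarrow> 'n \<Rightarrow> nat" where n: "\<And>i j. n i j > 0" "\<And>i j. real (n i j) * M $ i $ j \<in> \<int>" by metis
  define d where "d = (\<Prod>(i, j)\<in>UNIV. n i j)"
  have "d > 0" unfolding d_def using n(1) by (auto intro!: prod_pos)
  moreover have "real d *\<^sub>R M \<in> mats_over \<int>"
    unfolding mats_over_def
  proof (intro CollectI allI)
    fix i j
    have "n i j dvd d" unfolding d_def by (rule dvd_prodI[of UNIV "(i, j)" "\<lambda>(i, j). n i j", simplified])
    then obtain c where "d = n i j * c" by blast
    then have "(real d *\<^sub>R M) $ i $ j = real c * (real (n i j) * M $ i $ j)" by simp
    then show "(real d *\<^sub>R M) $ i $ j \<in> \<int>" using n(2) by (metis Ints_mult Ints_of_nat)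
  qed
  ultimately show ?thesis using that by blast
qed

lemma group_matrix_group:
  assumes "\<And>K L. K \<in> X \<Longrightarrow> L \<in> X \<Longrightarrow> K ** L \<in> X" "mat 1 \<in> X" "\<And>K. K \<in> X \<Longrightarrow> \<exists>L\<in>X. L ** K = mat 1"
  shows "group (matrix_group X)"
  by (rule groupI) (use assms in \<open>auto simp: matrix_group_def matrix_mul_assoc\<close>)

lemma matrix_group_simps:
  "carrier (matrix_group X) = X" "K \<otimes>\<^bsub>matrix_group X\<^esub> L = K ** L" "\<one>\<^bsub>matrix_group X\<^esub> = mat 1"
  by (simp_all add: matrix_group_def)

lemma SO0_rat_inverse:
  assumes "K \<in> SO0 S \<inter> mats_over \<rat>"
  shows "\<exists>L\<in>SO0 S \<inter> mats_over \<rat>. L ** K = mat 1 \<and> K ** L = mat 1"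
proof -
  obtain L where L: "L \<in> SO0 S" "K ** L = mat 1" "L ** K = mat 1" using SO0_inverse assms by blast
  obtain n where n: "n > 0" "real n *\<^sub>R K \<in> mats_over \<int>" using common_denominator assms by blast
  have "det K = 1" using assms SO0_SO by (auto simp: SO_def)
  from inverse_denominator[OF this L(2) n(2)] have "real (n ^ CARD('a)) *\<^sub>R L \<in> mats_over \<rat>" by (rule mats_Ints_Rats)
  then have "L \<in> mats_over \<rat>" by (rule mats_Rats_scale_cancel[rotated]) (use n(1) in simp)
  then show ?thesis using L by blast
qed

lemma group_SO0_rat: "group (SO0_rat S)"
  unfolding SO0_rat_def
  by (rule group_matrix_group) (use SO0_rat_inverse in \<open>auto simp: SO0_mult mats_Rats_mult one_SO0 mat_1_mats\<close>)

lemma inv_SO0_rat: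
  assumes "K \<in> SO0 S \<inter> mats_over \<rat>" "L \<in> SO0 S \<inter> mats_over \<rat>" "L ** K = mat 1"
  shows "inv\<^bsub>SO0_rat S\<^esub> K = L"
  by (rule group.inv_equality[OF group_SO0_rat]) (use assms in \<open>auto simp: SO0_rat_def matrix_group_simps\<close>)

lemma subgroup_SO0_rat:
  assumes "X \<subseteq> SO0 S \<inter> mats_over \<rat>" "\<And>K L. K \<in> X \<Longrightarrow> L \<in> X \<Longrightarrow> K ** L \<in> X" "mat 1 \<in> X"
    "\<And>K. K \<in> X \<Longrightarrow> \<exists>L\<in>X. L ** K = mat 1"
  shows "subgroup X (SO0_rat S)"
proof (rule group.subgroupI[OF group_SO0_rat])
  show "X \<subseteq> carrier (SO0_rat S)" using assms(1) by (simp add: SO0_rat_def matrix_group_simps)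
  show "X \<noteq> {}" using assms(3) by blast
  fix a b assume a: "a \<in> X" and b: "b \<in> X"
  obtain L where L: "L \<in> X" "L ** a = mat 1" using assms(4)[OF a] by blast
  have "inv\<^bsub>SO0_rat S\<^esub> a = L" by (rule inv_SO0_rat) (use L a assms(1) in auto)
  then show "inv\<^bsub>SO0_rat S\<^esub> a \<in> X" using L by simp
  show "a \<otimes>\<^bsub>SO0_rat S\<^esub> b \<in> X" using assms(2)[OF a b] by (simp add: SO0_rat_def matrix_group_simps)
qed

lemma prime_factors_power_subset:
  assumes "prime_factors m \<subseteq> Q" shows "prime_factors (m ^ k :: nat) \<subseteq> Q"
proof
  fix p assume "p \<in> prime_factors (m ^ k)"
  then have "prime p" "p dvd m ^ k" "m ^ k \<noteq> 0" by (auto simp: in_prime_factors_iff)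
  then have "prime p" "p dvd m" "m \<noteq> 0 \<or> k = 0" using prime_dvd_power_nat by auto
  moreover have "k \<noteq> 0" using \<open>prime p\<close> \<open>p dvd m ^ k\<close> by (cases k) auto
  ultimately have "p \<in> prime_factors m" by (simp add: in_prime_factors_iff)
  then show "p \<in> Q" using assms by blast
qed

lemma subgroup_prim:
  assumes Q: "Q \<subseteq> {p. prime p}"
  shows "subgroup (prim S Q) (SO0_rat S)"
proof (rule subgroup_SO0_rat)
  show "prim S Q \<subseteq> SO0 S \<inter> mats_over \<rat>" by (auto simp: prim_def)
  show "mat 1 \<in> prim S Q" unfolding prim_iff[OF Q] using one_SO0 mat_1_mats by (intro conjI exI[of _ 1]) auto
next
  fix K L assume "K \<in> prim S Q" "L \<in> prim S Q"
  then obtain m n :: nat where h: "K \<in> SO0 S" "m > 0" "prime_factors m \<subseteq> Q" "real m *\<^sub>R K \<in> mats_over \<int>"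
    "L \<in> SO0 S" "n > 0" "prime_factors n \<subseteq> Q" "real n *\<^sub>R L \<in> mats_over \<int>"
    unfolding prim_iff[OF Q] by blast
  have "real (m * n) *\<^sub>R (K ** L) = (real m *\<^sub>R K) ** (real n *\<^sub>R L)" by (simp add: mat_scaleR_mult)
  then have "real (m * n) *\<^sub>R (K ** L) \<in> mats_over \<int>" using mats_Ints_mult[OF h(4,8)] by simp
  moreover have "prime_factors (m * n) \<subseteq> Q" using h by (simp add: prime_factors_product)
  ultimately show "K ** L \<in> prim S Q" unfolding prim_iff[OF Q] using h SO0_mult by (auto intro!: exI[of _ "m * n"])
next
  fix K assume "K \<in> prim S Q"
  then obtain m :: nat where h: "K \<in> SO0 S" "m > 0" "prime_factors m \<subseteq> Q" "real m *\<^sub>R K \<in> mats_over \<int>"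
    unfolding prim_iff[OF Q] by blast
  obtain L where L: "L \<in> SO0 S" "K ** L = mat 1" "L ** K = mat 1" using SO0_inverse[OF h(1)] by blast
  have "det K = 1" using h SO0_SO by (auto simp: SO_def)
  from inverse_denominator[OF this L(2) h(4)] have "real (m ^ CARD('a)) *\<^sub>R L \<in> mats_over \<int>" .
  moreover have "prime_factors (m ^ CARD('a)) \<subseteq> Q" using h(3) prime_factors_power_subset by simp
  ultimately have "L \<in> prim S Q" unfolding prim_iff[OF Q] using L h by (auto intro!: exI[of _ "m ^ CARD('a)"])
  then show "\<exists>L\<in>prim S Q. L ** K = mat 1" using L by blast
qed

lemma prim_empty: "prim S {} = SO0_int S"
  unfolding SO0_int_def using prim_iff[of "{}" _ S] by (auto simp: prim_def dest: mats_Ints_Rats)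

lemma subgroup_SO0_int: "subgroup (SO0_int S) (SO0_rat S)"
  using subgroup_prim[of "{}" S] by (simp add: prim_empty)

lemma prim_mono: "P \<subseteq> Q \<Longrightarrow> prim S P \<subseteq> prim S Q"
  unfolding prim_def by blast

text \<open>The two denominators are coprime, and a Bezout combination of them writes
  \<open>M\<close> as a sum of integral matrices.\<close>

lemma prim_disjoint:
  assumes "P \<subseteq> {p. prime p}" "Q \<subseteq> {p. prime p}" "P \<inter> Q = {}"
  shows "prim S P \<inter> prim S Q = SO0_int S"
proof
  show "SO0_int S \<subseteq> prim S P \<inter> prim S Q" using prim_mono[of "{}"] prim_empty by blast
  show "prim S P \<inter> prim S Q \<subseteq> SO0_int S"
  proof
    fix M assume "M \<in> prim S P \<inter> prim S Q"
    then obtain m n :: nat where h: "M \<in> SO0 S" "m > 0" "prime_factors m \<subseteq> P" "real m *\<^sub>R M \<in> mats_over \<int>"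
      "n > 0" "prime_factors n \<subseteq> Q" "real n *\<^sub>R M \<in> mats_over \<int>"
      using prim_iff[OF assms(1)] prim_iff[OF assms(2)] by blast
    have "coprime m n"
    proof (rule ccontr)
      assume "\<not> coprime m n"
      then obtain p where "prime p" "p dvd m" "p dvd n" using h(2) prime_factor_nat[of "gcd m n"] by (auto simp: coprime_iff_gcd_eq_1)
      then have "p \<in> prime_factors m" "p \<in> prime_factors n" using h(2,5) by (auto simp: in_prime_factors_iff)
      then show False using h assms by blast
    qed
    then have "gcd (int m) (int n) = 1" by (metis coprime_imp_gcd_eq_1 gcd_int_int_eq of_nat_1)
    then obtain a b :: int where ab: "a * int m + b * int n = 1" using bezout_int[of "int m" "int n"] by metis
    have "M = (of_int (a * int m + b * int n)) *\<^sub>R M" using ab by simp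
    also have "\<dots> = of_int a *\<^sub>R (real m *\<^sub>R M) + of_int b *\<^sub>R (real n *\<^sub>R M)" by (simp add: scaleR_left_distrib)
    also have "\<dots> \<in> mats_over \<int>" by (intro mats_Ints_add mats_Ints_scale h(4) h(7)) auto
    finally show "M \<in> SO0_int S" using h by (simp add: SO0_int_def)
  qed
qed

lemma prim_exhaust:
  assumes "M \<in> SO0 S \<inter> mats_over \<rat>"
  shows "\<exists>Q. finite Q \<and> Q \<subseteq> {p. prime p} \<and> M \<in> prim S Q"
proof -
  obtain n where n: "n > 0" "real n *\<^sub>R M \<in> mats_over \<int>" using common_denominator assms by blast
  have Q: "prime_factors n \<subseteq> {p. prime p}" by auto
  have "M \<in> prim S (prime_factors n)" unfolding prim_iff[OF Q] using n assms by auto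
  then show ?thesis using Q by blast
qed

lemma mem_double_coset_matrix:
  "x \<in> double_coset (SO0_rat S) U g \<longleftrightarrow> (\<exists>u\<in>U. \<exists>v\<in>U. x = u ** g ** v)"
  by (auto simp: double_coset_def r_coset_def set_mult_def SO0_rat_def matrix_group_simps)

lemma finite_vec:
  assumes "finite A" shows "finite {x :: 'a^'n. \<forall>j. x $ j \<in> A}"
proof (rule finite_subset)
  show "finite (vec_lambda ` ((UNIV :: 'n set) \<rightarrow>\<^sub>E A))" using assms by (intro finite_imageI finite_PiE) auto
  show "{x :: 'a^'n. \<forall>j. x $ j \<in> A} \<subseteq> vec_lambda ` ((UNIV :: 'n set) \<rightarrow>\<^sub>E A)"
  proof
    fix x :: "'a^'n" assume "x \<in> {x. \<forall>j. x $ j \<in> A}"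
    then have "(\<lambda>j. x $ j) \<in> (UNIV :: 'n set) \<rightarrow>\<^sub>E A" by auto
    moreover have "x = vec_lambda (\<lambda>j. x $ j)" by simp
    ultimately show "x \<in> vec_lambda ` ((UNIV :: 'n set) \<rightarrow>\<^sub>E A)" by (metis rev_image_eqI)
  qed
qed

lemma finite_int_bounded_matrices:
  "finite {A :: real^'n^'n. \<forall>i j. A $ i $ j \<in> real ` {0..<m}}"
proof -
  have "finite (real ` {0..<m})" by simp
  then have "finite {x :: real^'n. \<forall>j. x $ j \<in> real ` {0..<m}}" by (rule finite_vec)
  from finite_vec[OF this] show ?thesis by simp
qed

text \<open>Multipliers \<open>d\<close> and \<open>e\<close> that clear the denominators of
  \<open>g\<close> and of its inverse do so throughout the double coset. If \<open>d a\<close> and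
  \<open>d b\<close> agree modulo \<open>d e\<close>, then \<open>a = b + e X\<close> with
  \<open>X\<close> integral, so \<open>a b^-1 = 1 + X (e b^-1)\<close> is integral and
  \<open>a\<close>, \<open>b\<close> lie in one coset. Thus there are at most as many cosets as
  matrices of residues modulo \<open>d e\<close>.\<close>

lemma finite_cosets:
  assumes g: "g \<in> SO0 S \<inter> mats_over \<rat>"
  shows "finite (right_cosets_in (SO0_rat S) (SO0_int S) (double_coset (SO0_rat S) (SO0_int S) g))"
proof -
  let ?U = "SO0_int S" and ?G = "SO0_rat S"
  obtain h where h: "h \<in> SO0 S \<inter> mats_over \<rat>" "h ** g = mat 1" "g ** h = mat 1" using SO0_rat_inverse[OF g] by blast
  obtain d where d: "d > 0" "real d *\<^sub>R g \<in> mats_over \<int>" using common_denominator g by blast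
  obtain e where e: "e > 0" "real e *\<^sub>R h \<in> mats_over \<int>" using common_denominator h by blast
  let ?D = "double_coset ?G ?U g"
  have Dd: "real d *\<^sub>R a \<in> mats_over \<int> \<and> a \<in> SO0 S" if a: "a \<in> ?D" for a
  proof -
    obtain u v where uv: "u \<in> ?U" "v \<in> ?U" "a = u ** g ** v"
      using a unfolding mem_double_coset_matrix by blast
    have "real d *\<^sub>R a = u ** (real d *\<^sub>R g) ** v" unfolding uv(3) by (simp add: mat_scaleR_mult)
    then show ?thesis using uv d g by (auto simp: SO0_int_def intro!: mats_Ints_mult SO0_mult)
  qed
  have De: "\<exists>b. b \<in> SO0 S \<and> a ** b = mat 1 \<and> b ** a = mat 1 \<and> real e *\<^sub>R b \<in> mats_over \<int>" if a: "a \<in> ?D" for a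
  proof -
    obtain u v where uv: "u \<in> ?U" "v \<in> ?U" "a = u ** g ** v"
      using a unfolding mem_double_coset_matrix by blast
    obtain u' where u': "u' \<in> SO0 S" "u ** u' = mat 1" "u' ** u = mat 1" using uv SO0_inverse by (auto simp: SO0_int_def)
    obtain v' where v': "v' \<in> SO0 S" "v ** v' = mat 1" "v' ** v = mat 1" using uv SO0_inverse by (auto simp: SO0_int_def)
    have dt: "det u = 1" "det v = 1" using uv SO0_SO by (auto simp: SO0_int_def SO_def)
    have i: "u' \<in> mats_over \<int>" "v' \<in> mats_over \<int>"
      using inverse_Ints[OF dt(1) u'(2)] inverse_Ints[OF dt(2) v'(2)] uv by (auto simp: SO0_int_def)
    let ?b = "v' ** h ** u'"
    have "a ** ?b = u ** (g ** (v ** v') ** h) ** u'" unfolding uv(3) by (simp only: matrix_mul_assoc)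
    then have 1: "a ** ?b = mat 1" using u' v' h by simp
    have 2: "?b ** a = mat 1" using 1 by (simp add: matrix_left_right_inverse)
    have "real e *\<^sub>R ?b = v' ** (real e *\<^sub>R h) ** u'" by (simp add: mat_scaleR_mult)
    then have "real e *\<^sub>R ?b \<in> mats_over \<int>" using e i by (auto intro!: mats_Ints_mult)
    then show ?thesis using 1 2 u' v' h by (intro exI[of _ ?b]) (auto intro!: SO0_mult)
  qed
  define F where "F a = (\<chi> i j. real_of_int (\<lfloor>(real d *\<^sub>R a) $ i $ j\<rfloor> mod int (d * e)))" for a :: "real^'a^'a"
  have key: "?U #>\<^bsub>?G\<^esub> a = ?U #>\<^bsub>?G\<^esub> b" if a: "a \<in> ?D" and b: "b \<in> ?D" and F: "F a = F b" for a b
  proof -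
    obtain b' where b': "b' \<in> SO0 S" "b ** b' = mat 1" "b' ** b = mat 1" "real e *\<^sub>R b' \<in> mats_over \<int>" using De[OF b] by blast
    define X where "X = (1 / real (d * e)) *\<^sub>R (real d *\<^sub>R a - real d *\<^sub>R b)"
    have "X \<in> mats_over \<int>" unfolding mats_over_def
    proof (intro CollectI allI)
      fix i j
      obtain x where x: "(real d *\<^sub>R a) $ i $ j = of_int x" using mats_IntsE Dd[OF a] by blast
      obtain y where y: "(real d *\<^sub>R b) $ i $ j = of_int y" using mats_IntsE Dd[OF b] by blast
      have "F a $ i $ j = F b $ i $ j" using F by simp
      then have "x mod int (d * e) = y mod int (d * e)" by (simp only: F_def vec_lambda_beta x y floor_of_int of_int_eq_iff)
      then obtain c where "x - y = int (d * e) * c" by (metis mod_eq_dvd_iff dvdE)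
      moreover have "X $ i $ j = (1 / real (d * e)) * of_int (x - y)"
        unfolding X_def vector_scaleR_component[of "1 / _"] vector_minus_component x y
        by (simp only: of_int_diff real_scaleR_def)
      ultimately have "X $ i $ j = of_int c" using d e by simp
      then show "X $ i $ j \<in> \<int>" by simp
    qed
    have "a = b + real e *\<^sub>R X" unfolding X_def using d e by (simp add: scaleR_diff_right)
    then have "a ** b' = (b + real e *\<^sub>R X) ** b'" by simp
    also have "\<dots> = mat 1 + X ** (real e *\<^sub>R b')" using b' by (simp add: matrix_add_rdistrib_real mat_scaleR_mult)
    also have "\<dots> \<in> mats_over \<int>" using b' \<open>X \<in> mats_over \<int>\<close> by (intro mats_Ints_add mats_Ints_mult mat_1_mats)
    finally have u: "a ** b' \<in> ?U" using Dd[OF a] b' by (simp add: SO0_int_def SO0_mult)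
    have "a ** b' ** b = a ** (b' ** b)" by (simp only: matrix_mul_assoc)
    then have ab: "a = (a ** b') ** b" using b'(3) by simp
    have G: "a \<in> carrier ?G" "b \<in> carrier ?G" "a ** b' \<in> carrier ?G"
    proof -
      have r: "x \<in> mats_over \<rat>" if "real d *\<^sub>R x \<in> mats_over \<int>" for x :: "real^'a^'a"
        by (rule mats_Rats_scale_cancel[OF d(1) mats_Ints_Rats[OF that]])
      show "a \<in> carrier ?G" "b \<in> carrier ?G" using Dd[OF a] Dd[OF b] r by (auto simp: SO0_rat_def matrix_group_simps)
      show "a ** b' \<in> carrier ?G" using u mats_Ints_Rats by (auto simp: SO0_int_def SO0_rat_def matrix_group_simps)
    qed
    interpret group ?G by (rule group_SO0_rat)
    have "?U #>\<^bsub>?G\<^esub> a = (?U #>\<^bsub>?G\<^esub> (a ** b')) #>\<^bsub>?G\<^esub> b"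
    proof -
      have "(a ** b') \<otimes>\<^bsub>?G\<^esub> b = a" using ab by (simp add: SO0_rat_def matrix_group_simps)
      then show ?thesis using coset_mult_assoc[OF subgroup.subset[OF subgroup_SO0_int] G(3,2)] by simp
    qed
    also have "?U #>\<^bsub>?G\<^esub> (a ** b') = ?U" using coset_join2[OF G(3) subgroup_SO0_int u] .
    finally show ?thesis .
  qed
  have "finite (F ` ?D)"
  proof (rule finite_subset[OF _ finite_int_bounded_matrices[of "d * e"]])
    have "real_of_int (x mod int (d * e)) \<in> real ` {0..<d * e}" for x
    proof (rule image_eqI)
      have "0 \<le> x mod int (d * e)" "x mod int (d * e) < int (d * e)" using d e by simp_all
      then show "nat (x mod int (d * e)) \<in> {0..<d * e}" "real_of_int (x mod int (d * e)) = real (nat (x mod int (d * e)))"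
        by (simp_all add: nat_less_iff)
    qed
    then show "F ` ?D \<subseteq> {A. \<forall>i j. A $ i $ j \<in> real ` {0..<d * e}}" by (auto simp: F_def)
  qed
  define Gf where "Gf y = ?U #>\<^bsub>?G\<^esub> (SOME a. a \<in> ?D \<and> F a = y)" for y
  have "right_cosets_in ?G ?U ?D \<subseteq> Gf ` (F ` ?D)"
  proof
    fix C assume "C \<in> right_cosets_in ?G ?U ?D"
    then obtain a where a: "a \<in> ?D" "C = ?U #>\<^bsub>?G\<^esub> a" by (auto simp: right_cosets_in_def)
    define b where "b = (SOME b. b \<in> ?D \<and> F b = F a)"
    have "b \<in> ?D \<and> F b = F a" unfolding b_def by (rule someI[of _ a]) (use a in simp)
    then have "C = ?U #>\<^bsub>?G\<^esub> b" using key[of b a] a by simp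
    then have "C = Gf (F a)" by (simp add: Gf_def b_def)
    then show "C \<in> Gf ` (F ` ?D)" using a by blast
  qed
  then show ?thesis using \<open>finite (F ` ?D)\<close> finite_subset by blast
qed

section \<open>The ternary form\<close>

text \<open>If \<open>b\<close> is the reduced denominator of \<open>z\<close>, then
  \<open>b^2\<close> divides \<open>N\<close>. In this form squarefreeness makes the unipotent
  factors of the reductions integral.\<close>

lemma squarefree_Rats_Ints:
  assumes "squarefree N" "z \<in> \<rat>" "real N * z\<^sup>2 \<in> \<int>"
  shows "z \<in> \<int>"
proof -
  obtain a b :: int where ab: "b > 0" "coprime a b" "z = of_int a / of_int b" using assms(2) by (rule Rats_cases')
  obtain m :: int where "real N * z\<^sup>2 = of_int m" using assms(3) by (rule Ints_cases)
  then have "real N * (of_int a)\<^sup>2 = of_int m * (of_int b)\<^sup>2" using ab by (simp add: field_simps)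
  then have "of_int (int N * a\<^sup>2) = (of_int (m * b\<^sup>2) :: real)" by simp
  then have e: "int N * a\<^sup>2 = m * b\<^sup>2" by (simp only: of_int_eq_iff)
  have "coprime (b\<^sup>2) (a\<^sup>2)" using ab(2) by (simp add: coprime_commute)
  moreover have "b\<^sup>2 dvd int N * a\<^sup>2" unfolding e by simp
  ultimately have "b\<^sup>2 dvd int N" by (simp add: coprime_dvd_mult_left_iff)
  then have "(nat b)\<^sup>2 dvd N" using ab(1) by (metis int_dvd_int_iff nat_0_le of_nat_power order_less_imp_le)
  then have "is_unit (nat b)" using assms(1) by (rule squarefreeD[rotated])
  then have "b = 1" using ab(1) by simp
  then show ?thesis using ab(3) by simp
qed

lemma squarefree_prime_dvd:
  assumes "squarefree N" "prime (p::int)" "p\<^sup>2 dvd int N * x\<^sup>2"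
  shows "p dvd x"
proof (rule ccontr)
  assume "\<not> p dvd x"
  then have "coprime (p\<^sup>2) (x\<^sup>2)" using assms(2) by (simp add: prime_imp_coprime)
  then have "p\<^sup>2 dvd int N" using assms(3) by (simp add: coprime_dvd_mult_left_iff)
  then have "(nat p)\<^sup>2 dvd N" using prime_gt_0_int[OF assms(2)]
    by (metis int_dvd_int_iff nat_0_le of_nat_power order_less_imp_le)
  then have "is_unit (nat p)" using assms(1) by (rule squarefreeD[rotated])
  then show False using prime_gt_1_int[OF assms(2)] by simp
qed

section \<open>Explicit elements of the ternary group\<close>

lemma vector_3_eq: "(vector [a, b, c] :: 'a::zero^3) = (\<chi> i. if i = 1 then a else if i = 2 then b else c)"
  by (simp add: vec_eq_iff forall_3)

lemma continuous_on_vector_3: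
  fixes f g h :: "'b::topological_space \<Rightarrow> 'a::{zero,topological_space}"
  assumes "continuous_on X f" "continuous_on X g" "continuous_on X h"
  shows "continuous_on X (\<lambda>t. vector [f t, g t, h t] :: 'a^3)"
  unfolding vector_3_eq
proof (rule continuous_on_vec_lambda)
  show "continuous_on X (\<lambda>t. if i = 1 then f t else if i = 2 then g t else h t)" for i :: 3
    by (cases "i = 1"; cases "i = 2"; simp add: assms)
qed

lemma mats_over_3: "(vector [vector [a11, a12, a13], vector [a21, a22, a23], vector [a31, a32, a33]] :: real^3^3) \<in> mats_over R \<longleftrightarrow>
  a11 \<in> R \<and> a12 \<in> R \<and> a13 \<in> R \<and> a21 \<in> R \<and> a22 \<in> R \<and> a23 \<in> R \<and> a31 \<in> R \<and> a32 \<in> R \<and> a33 \<in> R"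
  by (simp add: mats_over_def forall_3)

lemma quad_subst_S_mat:
  "quad_subst (S_mat N) K $ i $ j = K$1$i * K$3$j + K$3$i * K$1$j - 2 * real N * K$2$i * K$2$j"
  by (simp add: quad_subst_def S_mat_def matrix_matrix_mult_def sum_3 transpose_def algebra_simps)

lemma quad_form_subst: "(h *v x) \<bullet> (S *v (h *v x)) = x \<bullet> (quad_subst S h *v x)" for h :: "real^'n^'n"
proof -
  have "x \<bullet> (quad_subst S h *v x) = x \<bullet> (transpose h *v (S *v (h *v x)))"
    by (simp only: quad_subst_def matrix_vector_mul_assoc matrix_mul_assoc)
  also have "\<dots> = (x v* transpose h) \<bullet> (S *v (h *v x))" by (simp only: dot_lmul_matrix)
  finally show ?thesis by simp
qed

lemma quad_form_S_mat: "x \<bullet> (S_mat N *v x) = 2 * (x$1 * x$3 - real N * (x$2)\<^sup>2)"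
  by (simp add: inner_vec_def sum_3 matrix_vector_mult_def S_mat_def power2_eq_square algebra_simps)

lemma det_S_mat: "N > 0 \<Longrightarrow> det (S_mat N) \<noteq> 0"
  by (simp add: S_mat_def det_3)

lemma S_mat_entries: "S_mat N $ 1 $ 1 = 0" "S_mat N $ 1 $ 2 = 0" "S_mat N $ 1 $ 3 = 1"
  "S_mat N $ 2 $ 1 = 0" "S_mat N $ 2 $ 2 = - 2 * real N" "S_mat N $ 2 $ 3 = 0"
  "S_mat N $ 3 $ 1 = 1" "S_mat N $ 3 $ 2 = 0" "S_mat N $ 3 $ 3 = 0"
  by (simp_all add: S_mat_def)

text \<open>The action of the 2 x 2 matrix with rows (1, sqrt N t), (0, 1) on the symmetric matrices
  with rows (x1, sqrt N x2), (sqrt N x2, x3). Its transpose acts by \<open>lower3\<close>, and the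
  diagonal matrix (sqrt t, 1 / sqrt t) by \<open>diag3 t 1 (1 / t)\<close>.\<close>

definition upper3 :: "nat \<Rightarrow> real \<Rightarrow> real^3^3" where
  "upper3 N t = vector [vector [1, 2 * real N * t, real N * t\<^sup>2], vector [0, 1, t], vector [0, 0, 1]]"

definition lower3 :: "nat \<Rightarrow> real \<Rightarrow> real^3^3" where
  "lower3 N t = vector [vector [1, 0, 0], vector [t, 1, 0], vector [real N * t\<^sup>2, 2 * real N * t, 1]]"

definition diag3 :: "real \<Rightarrow> real \<Rightarrow> real \<Rightarrow> real^3^3" where
  "diag3 a b c = vector [vector [a, 0, 0], vector [0, b, 0], vector [0, 0, c]]"

text \<open>The rotations of the plane, acting on the symmetric matrices with rows \<open>(x1, \<surd>N x2)\<close> and \<open>(\<surd>N x2, x3)\<close>.\<close>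

definition rot3 :: "nat \<Rightarrow> real \<Rightarrow> real^3^3" where
  "rot3 N t = vector [vector [(cos t)\<^sup>2, 2 * sqrt (real N) * cos t * sin t, (sin t)\<^sup>2],
     vector [- cos t * sin t / sqrt (real N), (cos t)\<^sup>2 - (sin t)\<^sup>2, cos t * sin t / sqrt (real N)],
     vector [(sin t)\<^sup>2, - 2 * sqrt (real N) * cos t * sin t, (cos t)\<^sup>2]]"

lemma upper3_SO0: "N > 0 \<Longrightarrow> upper3 N t \<in> SO0 (S_mat N)"
proof (rule SO0_path[of _ UNIV "upper3 N" 0])
  show "continuous_on UNIV (upper3 N)"
    unfolding upper3_def by (intro continuous_on_vector_3 continuous_intros)
  show "upper3 N 0 = mat 1" by (simp add: upper3_def vec_eq_iff forall_3 mat_def)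
  show "quad_subst (S_mat N) (upper3 N x) = S_mat N" for x
    unfolding vec_eq_iff forall_3 quad_subst_S_mat S_mat_entries
    by (simp add: upper3_def power2_eq_square algebra_simps)
qed (use det_S_mat in auto)

lemma lower3_SO0: "N > 0 \<Longrightarrow> lower3 N t \<in> SO0 (S_mat N)"
proof (rule SO0_path[of _ UNIV "lower3 N" 0])
  show "continuous_on UNIV (lower3 N)"
    unfolding lower3_def by (intro continuous_on_vector_3 continuous_intros)
  show "lower3 N 0 = mat 1" by (simp add: lower3_def vec_eq_iff forall_3 mat_def)
  show "quad_subst (S_mat N) (lower3 N x) = S_mat N" for x
    unfolding vec_eq_iff forall_3 quad_subst_S_mat S_mat_entries
    by (simp add: lower3_def power2_eq_square algebra_simps)
qed (use det_S_mat in auto)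

lemma diag3_SO0: "N > 0 \<Longrightarrow> t > 0 \<Longrightarrow> diag3 t 1 (1 / t) \<in> SO0 (S_mat N)"
proof (rule SO0_path[of _ "{0<..}" "\<lambda>t. diag3 t 1 (1 / t)" 1])
  show "continuous_on {0<..} (\<lambda>t. diag3 t 1 (1 / t))"
    unfolding diag3_def by (intro continuous_on_vector_3 continuous_intros) auto
  show "diag3 1 1 (1 / 1) = mat 1" by (simp add: diag3_def vec_eq_iff forall_3 mat_def)
  show "quad_subst (S_mat N) (diag3 x 1 (1 / x)) = S_mat N" if "x \<in> {0<..}" for x
    unfolding vec_eq_iff forall_3 quad_subst_S_mat S_mat_entries
    using that by (simp add: diag3_def)
qed (use det_S_mat in auto)

lemma rot3_SO0: "N > 0 \<Longrightarrow> rot3 N t \<in> SO0 (S_mat N)"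
proof (rule SO0_path[of _ UNIV "rot3 N" 0])
  assume N: "N > 0"
  show "continuous_on UNIV (rot3 N)"
    unfolding rot3_def using N by (intro continuous_on_vector_3 continuous_intros) auto
  show "rot3 N 0 = mat 1" by (simp add: rot3_def vec_eq_iff forall_3 mat_def)
  show "quad_subst (S_mat N) (rot3 N x) = S_mat N" for x
  proof -
    define r where "r = sqrt (real N)"
    have r: "r > 0" "real N = r\<^sup>2" using N by (simp_all add: r_def)
    have c: "(cos x)\<^sup>2 = 1 - (sin x)\<^sup>2" by (simp add: cos_squared_eq)
    define s where "s = sin x"
    define k where "k = cos x"
    have ck: "k\<^sup>2 = 1 - s\<^sup>2" using c by (simp add: s_def k_def)
    have q: "(k * k + s * s) * (k * k + s * s) = 1" using ck by (simp add: power2_eq_square)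
    \<comment> \<open>What simplification leaves of the (2, 2) entry, in its normal form: 2 r^2 = 2
      r^2 (k^2 + s^2)^2.\<close>
    have q2: "r * (r * 2) = k * (k * (k * (k * (r * (r * 2))))) +
      (r * (r * (s * (s * (s * (s * 2))))) + k * (k * (r * (r * (s * (s * 4))))))"
    proof -
      have "k * (k * (k * (k * (r * (r * 2))))) + (r * (r * (s * (s * (s * (s * 2))))) + k * (k * (r * (r * (s * (s * 4))))))
        = r * (r * 2) * ((k * k + s * s) * (k * k + s * s))" by (simp add: algebra_simps)
      then show ?thesis using q by simp
    qed
    show ?thesis
      unfolding vec_eq_iff forall_3 quad_subst_S_mat S_mat_entries rot3_def r_def[symmetric] s_def[symmetric] k_def[symmetric] r(2)
      using r(1) q by (simp add: power2_eq_square field_simps, intro q2)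
  qed
qed (use det_S_mat in auto)

text \<open>The quarter turn exchanges the first and third basis vectors and negates the second; it
  is the Weyl element that inverts \<open>diag3 (1 / d) 1 d\<close>.\<close>

lemma diag3_rot: "N > 0 \<Longrightarrow> rot3 N (pi / 2) ** diag3 a 1 c ** rot3 N (- pi / 2) = diag3 c 1 a"
  by (simp add: rot3_def diag3_def vec_eq_iff forall_3 matrix_matrix_mult_def sum_3)

lemma rot3_int: "rot3 N (pi / 2) \<in> mats_over \<int>" "rot3 N (- pi / 2) \<in> mats_over \<int>"
  by (simp_all add: rot3_def mats_over_3)

section \<open>Primitive isotropic vectors of the ternary form\<close>

definition primitive3 :: "int \<Rightarrow> int \<Rightarrow> int \<Rightarrow> bool" where
  "primitive3 x y z \<longleftrightarrow> (\<forall>p::int. prime p \<longrightarrow> \<not> (p dvd x \<and> p dvd y \<and> p dvd z))"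

text \<open>An isotropic vector is a symmetric matrix of rank one, hence of the form v v'.
  Primitivity leads to v = (sqrt a \<alpha>, sqrt c \<gamma>) with a c = N; squarefreeness then
  makes \<open>a * \<alpha>\<close> and \<open>c * \<gamma>\<close> coprime, and a Bezout relation
  completes v to a matrix of determinant 1.\<close>

lemma orbit3_pos:
  assumes N: "squarefree N" "N > 0" and iso: "x1 * x3 = int N * x2\<^sup>2" and prim: "primitive3 x1 x2 x3" and pos: "x1 > 0"
  shows "\<exists>u\<in>SO0_int (S_mat N). column 1 u = vector [of_int x1, of_int x2, of_int x3]"
proof -
  define \<alpha> where "\<alpha> = gcd x1 x2"
  have \<alpha>0: "\<alpha> > 0" using pos by (simp add: \<alpha>_def)
  obtain r \<gamma> where r: "x1 = \<alpha> * r" "x2 = \<alpha> * \<gamma>" "coprime r \<gamma>"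
    unfolding \<alpha>_def by (metis gcd_coprime_exists gcd_eq_0_iff less_irrefl mult.commute pos)
  have "\<alpha> * (r * x3) = \<alpha> * (int N * \<alpha> * \<gamma>\<^sup>2)" using iso r(1,2) by (simp add: power2_eq_square algebra_simps)
  then have rx: "r * x3 = int N * \<alpha> * \<gamma>\<^sup>2" using \<alpha>0 by simp
  have "coprime \<alpha> x3"
  proof (rule ccontr)
    assume "\<not> coprime \<alpha> x3"
    then obtain p where "prime p" "p dvd \<alpha>" "p dvd x3"
      using \<alpha>0 prime_divisor_exists[of "gcd \<alpha> x3"] by (auto simp: coprime_iff_gcd_eq_1)
    then show False using prim r(1,2) by (auto simp: primitive3_def)
  qed
  moreover have "\<alpha> dvd r * x3" unfolding rx by simp
  ultimately have "\<alpha> dvd r" by (simp add: coprime_dvd_mult_left_iff)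
  then obtain a where a: "r = a * \<alpha>" by (metis dvdE mult.commute)
  have a0: "a > 0" using pos \<alpha>0 a r(1) by (simp add: zero_less_mult_iff)
  have "\<alpha> * (a * x3) = \<alpha> * (int N * \<gamma>\<^sup>2)" using rx a by (simp add: algebra_simps)
  then have ax: "a * x3 = int N * \<gamma>\<^sup>2" using \<alpha>0 by simp
  have "coprime a (\<gamma>\<^sup>2)" using r(3) a by simp
  moreover have "a dvd int N * \<gamma>\<^sup>2" using ax by (metis dvd_triv_left)
  ultimately have "a dvd int N" by (simp add: coprime_dvd_mult_left_iff)
  then obtain c where c: "int N = a * c" by blast
  have "a * x3 = a * (c * \<gamma>\<^sup>2)" using ax c by simp
  then have x3: "x3 = c * \<gamma>\<^sup>2" using a0 by simp
  \<comment> \<open>A common prime \<open>p\<close> divides \<open>x1\<close> and \<open>x3\<close>,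
    so \<open>p^2\<close> divides \<open>N x2^2\<close>; by squarefreeness \<open>p\<close> divides
    \<open>x2\<close> too, against primitivity.\<close>
  have "coprime (a * \<alpha>) c"
  proof (rule ccontr)
    assume "\<not> coprime (a * \<alpha>) c"
    then obtain p where p: "prime p" "p dvd a * \<alpha>" "p dvd c"
      using a0 \<alpha>0 prime_divisor_exists[of "gcd (a * \<alpha>) c"] by (auto simp: coprime_iff_gcd_eq_1)
    have d: "p dvd x1" "p dvd x3" using p r(1) a x3 by auto
    then have "p * p dvd x1 * x3" by (rule mult_dvd_mono)
    then have "p dvd x2" using squarefree_prime_dvd[OF N(1) p(1)] iso by (simp add: power2_eq_square)
    then show False using prim p(1) d by (auto simp: primitive3_def)
  qed
  moreover have "coprime (a * \<alpha>) \<gamma>" using r(3) a by simp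
  ultimately have "coprime (a * \<alpha>) (c * \<gamma>)" by simp
  then obtain \<delta> \<beta>' where bz: "\<delta> * (a * \<alpha>) + \<beta>' * (c * \<gamma>) = 1"
    using bezout_int[of "a * \<alpha>" "c * \<gamma>"] by (auto simp: coprime_iff_gcd_eq_1)
  define \<beta> where "\<beta> = - \<beta>'"
  have bz': "a * \<alpha> * \<delta> = 1 + c * \<beta> * \<gamma>" using bz by (simp add: \<beta>_def algebra_simps)
  \<comment> \<open>The Atkin-Lehner matrix with rows \<open>(\<surd>a \<alpha>, \<surd>c \<beta>)\<close> and \<open>(\<surd>c \<gamma>, \<surd>a \<delta>)\<close>, acting on the symmetric
    matrices with rows \<open>(x1, \<surd>N x2)\<close> and \<open>(\<surd>N x2, x3)\<close>.\<close>
  define u :: "real^3^3" where "u = vector [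
     vector [of_int (a * \<alpha>\<^sup>2), of_int (2 * int N * \<alpha> * \<beta>), of_int (c * \<beta>\<^sup>2)],
     vector [of_int (\<alpha> * \<gamma>), of_int (a * \<alpha> * \<delta> + c * \<beta> * \<gamma>), of_int (\<beta> * \<delta>)],
     vector [of_int (c * \<gamma>\<^sup>2), of_int (2 * int N * \<gamma> * \<delta>), of_int (a * \<delta>\<^sup>2)]]"
  have ui: "u \<in> mats_over \<int>" unfolding u_def mats_over_3 by simp
  let ?A = "of_int a :: real" and ?al = "of_int \<alpha> :: real" and ?c = "of_int c :: real" and ?b = "of_int \<beta> :: real"
    and ?g = "of_int \<gamma> :: real" and ?d = "of_int \<delta> :: real"
  have nz: "?A \<noteq> 0" "?al \<noteq> 0" using a0 \<alpha>0 by auto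
  have Nr: "real N = ?A * ?c" using c by (metis of_int_mult of_int_of_nat_eq)
  have "?A * ?al * ?d = 1 + ?c * ?b * ?g" using arg_cong[OF bz', of "of_int :: int \<Rightarrow> real"] by simp
  then have dr: "?d = (1 + ?c * ?b * ?g) / (?A * ?al)" using nz by (simp add: field_simps)
  \<comment> \<open>Gauss factorisation of the 2 x 2 matrix with pivot sqrt a \<alpha>. It places
    \<open>u\<close> in the identity component; the middle factor lies there because
    \<open>a\<close> is positive, which is where \<open>x1 > 0\<close> enters.\<close>
  have "u = lower3 N (?g / (?A * ?al)) ** diag3 (?A * ?al\<^sup>2) 1 (1 / (?A * ?al\<^sup>2)) ** upper3 N (?b / (?A * ?al))"
    unfolding u_def lower3_def diag3_def upper3_def
    using nz by (simp add: vec_eq_iff forall_3 matrix_matrix_mult_def sum_3 Nr dr power2_eq_square field_simps)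
  moreover have "?A * ?al\<^sup>2 > 0" using a0 \<alpha>0 by simp
  ultimately have "u \<in> SO0 (S_mat N)"
    using N(2) by (simp only:) (intro SO0_mult lower3_SO0 diag3_SO0 upper3_SO0)
  then have "u \<in> SO0_int (S_mat N)" using ui by (simp add: SO0_int_def)
  moreover have "column 1 u = vector [of_int x1, of_int x2, of_int x3]"
    unfolding u_def column_def using r(1,2) a x3
    by (simp add: vec_eq_iff forall_3 power2_eq_square algebra_simps)
  ultimately show ?thesis by blast
qed

lemma SO0_int_mult: "K \<in> SO0_int S \<Longrightarrow> L \<in> SO0_int S \<Longrightarrow> K ** L \<in> SO0_int S"
  by (simp add: SO0_int_def SO0_mult mats_Ints_mult)

lemma SO0_int_inverse:
  assumes "K \<in> SO0_int S"
  obtains L where "L \<in> SO0_int S" "K ** L = mat 1" "L ** K = mat 1"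
proof -
  obtain L where L: "L \<in> SO0 S" "K ** L = mat 1" "L ** K = mat 1" using SO0_inverse assms by (auto simp: SO0_int_def)
  have "det K = 1" using assms SO0_SO by (auto simp: SO0_int_def SO_def)
  then have "L \<in> mats_over \<int>" using inverse_Ints L(2) assms by (auto simp: SO0_int_def)
  then show ?thesis using that L by (auto simp: SO0_int_def)
qed

lemma column_mult: "column j (A ** B) = A *v column j B"
  by (simp add: vec_eq_iff column_def matrix_matrix_mult_def matrix_vector_mult_def)

lemma upper3_int: "upper3 N (of_int t) \<in> mats_over \<int>"
  unfolding upper3_def mats_over_3 by (auto intro!: Ints_mult)

text \<open>A sign is unavoidable, since the identity component preserves each half of the cone of
  isotropic vectors.\<close>

lemma orbit3:
  assumes N: "squarefree N" "N > 0" and iso: "x1 * x3 = int N * x2\<^sup>2" and prim: "primitive3 x1 x2 x3"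
  shows "\<exists>u\<in>SO0_int (S_mat N). \<exists>s\<in>{1, -1}. column 1 u = s *\<^sub>R vector [of_int x1, of_int x2, of_int x3]"
proof -
  have nz: "\<exists>u\<in>SO0_int (S_mat N). \<exists>s\<in>{1, -1}. column 1 u = s *\<^sub>R vector [of_int y1, of_int y2, of_int y3]"
    if y: "y1 * y3 = int N * y2\<^sup>2" "primitive3 y1 y2 y3" "y1 \<noteq> 0" for y1 y2 y3
  proof (cases "y1 > 0")
    case True
    from orbit3_pos[OF N y(1,2) True] show ?thesis by force
  next
    case False
    have p: "primitive3 (- y1) (- y2) (- y3)" using y(2) by (simp add: primitive3_def)
    have "\<exists>u\<in>SO0_int (S_mat N). column 1 u = vector [of_int (- y1), of_int (- y2), of_int (- y3)]"
      by (rule orbit3_pos[OF N _ p]) (use y False in auto)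
    moreover have "vector [of_int (- y1), of_int (- y2), of_int (- y3)] = (-1) *\<^sub>R (vector [of_int y1, of_int y2, of_int y3] :: real^3)"
      by (simp add: vec_eq_iff forall_3)
    ultimately show ?thesis by force
  qed
  show ?thesis
  proof (cases "x1 = 0")
    case False then show ?thesis using nz iso prim by blast
  next
    case True
    then have x2: "x2 = 0" using iso N(2) by simp
    \<comment> \<open>\<open>upper3\<close> with parameter 1 maps \<open>(0, 0, x3)\<close> to
      \<open>(N x3, x3, x3)\<close>, to which the case of a nonzero first coordinate applies;
      parameter -1 leads back.\<close>
    have p: "primitive3 (int N * x3) x3 x3" using prim True x2 by (auto simp: primitive3_def)
    have "x3 \<noteq> 0" using p unfolding primitive3_def by (auto dest: spec[of _ 2])
    then have n: "int N * x3 \<noteq> 0" using N(2) by simp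
    obtain u s where u: "u \<in> SO0_int (S_mat N)" "s \<in> {1, -1}"
      "column 1 u = s *\<^sub>R vector [of_int (int N * x3), of_int x3, of_int x3]"
    proof -
      have "int N * x3 * x3 = int N * x3\<^sup>2" by (simp add: power2_eq_square)
      from nz[OF this p n] show ?thesis using that by blast
    qed
    have m: "upper3 N (of_int (-1)) \<in> SO0_int (S_mat N)"
      using upper3_int[of N "-1"] upper3_SO0[OF N(2)] by (simp add: SO0_int_def)
    have "column 1 (upper3 N (of_int (-1)) ** u) = s *\<^sub>R vector [of_int x1, of_int x2, of_int x3]"
      unfolding column_mult u(3) using True x2
      by (simp add: upper3_def vec_eq_iff forall_3 matrix_vector_mult_def sum_3 algebra_simps)
    then show ?thesis using SO0_int_mult[OF m u(1)] u(2) by blast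
  qed
qed

lemma prime_dvd_prod_primes:
  assumes "finite X" "\<And>q. q \<in> X \<Longrightarrow> prime (q::int)" "prime p"
  shows "p dvd \<Prod>X \<longleftrightarrow> p \<in> X"
proof
  assume "p dvd \<Prod>X"
  then obtain q where "q \<in> X" "p dvd q" using prime_dvd_prod_iff[OF assms(1,3), of "\<lambda>x. x"] by auto
  then show "p \<in> X" using primes_dvd_imp_eq assms by metis
qed (use assms in \<open>auto intro: dvd_prodI[of X p "\<lambda>x. x", simplified]\<close>)

text \<open>To be applied with \<open>k\<close> the integral matrix \<open>d h\<close>: the image of
  the vector survives modulo each prime dividing \<open>d\<close>, and \<open>dvd_image_dvd\<close>
  deals with the other primes. Only divisibility of \<open>A\<close> and \<open>C\<close> matters,
  so products of primes replace a Chinese remainder argument.\<close>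

lemma choose3:
  fixes k :: "3 \<Rightarrow> 3 \<Rightarrow> int" and d :: int
  assumes N: "squarefree N" "N > 0" and d: "d \<noteq> 0" and nz: "\<And>p. prime p \<Longrightarrow> p dvd d \<Longrightarrow> \<exists>i j. \<not> p dvd k i j"
  shows "\<exists>x1 x2 x3. x1 * x3 = int N * x2\<^sup>2 \<and> primitive3 x1 x2 x3 \<and>
    (\<forall>p. prime p \<longrightarrow> p dvd d \<longrightarrow> (\<exists>i. \<not> p dvd k i 1 * x1 + k i 2 * x2 + k i 3 * x3))"
proof -
  \<comment> \<open>The vector \<open>(a A\<^sup>2, A C, c C\<^sup>2)\<close> below is a multiple of the third basis vector modulo the primes
    in \<open>X\<close>, of the first one modulo those in \<open>Y\<close>; modulo the others only the second column of \<open>k\<close> matters.\<close>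
  define X where "X = {p \<in> prime_factors d. (\<forall>i. p dvd k i 1) \<and> (\<exists>i. \<not> p dvd k i 3)}"
  define Y where "Y = {p \<in> prime_factors d. \<exists>i. \<not> p dvd k i 1}"
  define A where "A = \<Prod>X"
  define C where "C = \<Prod>Y"
  have fin: "finite X" "finite Y" by (simp_all add: X_def Y_def)
  have pr: "\<And>q. q \<in> X \<Longrightarrow> prime q" "\<And>q. q \<in> Y \<Longrightarrow> prime q" by (auto simp: X_def Y_def)
  have pA: "p dvd A \<longleftrightarrow> p \<in> X" if "prime p" for p
    unfolding A_def using prime_dvd_prod_primes[OF fin(1) pr(1) that] by blast
  have pC: "p dvd C \<longleftrightarrow> p \<in> Y" if "prime p" for p
    unfolding C_def using prime_dvd_prod_primes[OF fin(2) pr(2) that] by blast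
  have XY: "X \<inter> Y = {}" by (auto simp: X_def Y_def)
  \<comment> \<open>The primes that \<open>N\<close> shares with \<open>A\<close> go to
    \<open>a\<close>, the others to \<open>c\<close>. By squarefreeness \<open>a * A\<close> and
    \<open>c * C\<close> then have no common prime, which yields primitivity.\<close>
  define a where "a = gcd (int N) A"
  obtain c where c: "int N = a * c" unfolding a_def by (metis dvdE gcd_dvd1)
  have aA: "a dvd A" by (simp add: a_def)
  have nAC: "\<not> (p dvd a * A \<and> p dvd c * C)" if p: "prime p" for p
  proof
    assume h: "p dvd a * A \<and> p dvd c * C"
    then have "p dvd a \<or> p dvd A" using p prime_dvd_mult_iff by blast
    then have pa: "p dvd A" using aA dvd_trans by blast
    then have "\<not> p dvd C" using pA pC XY p by blast
    then have pc: "p dvd c" using h p prime_dvd_mult_iff by blast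
    then have "p dvd int N" using c by simp
    then have "p dvd a" using pa by (simp add: a_def)
    then have "p\<^sup>2 dvd int N * 1\<^sup>2" using pc unfolding c by (simp add: power2_eq_square mult_dvd_mono)
    then have "p dvd 1" by (rule squarefree_prime_dvd[OF N(1) p])
    then show False using p by auto
  qed
  have iso: "(a * A\<^sup>2) * (c * C\<^sup>2) = int N * (A * C)\<^sup>2" unfolding c by (simp add: power2_eq_square algebra_simps)
  have prim: "primitive3 (a * A\<^sup>2) (A * C) (c * C\<^sup>2)"
    unfolding primitive3_def
  proof (intro allI impI notI)
    fix p :: int assume p: "prime p" and h: "p dvd a * A\<^sup>2 \<and> p dvd A * C \<and> p dvd c * C\<^sup>2"
    then have "p dvd a * A" "p dvd c * C" by (auto simp: prime_dvd_mult_iff power2_eq_square)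
    then show False using nAC p by blast
  qed
  have "\<exists>i. \<not> p dvd k i 1 * (a * A\<^sup>2) + k i 2 * (A * C) + k i 3 * (c * C\<^sup>2)" if p: "prime p" "p dvd d" for p
  proof (rule ccontr)
    assume h: "\<nexists>i. \<not> p dvd k i 1 * (a * A\<^sup>2) + k i 2 * (A * C) + k i 3 * (c * C\<^sup>2)"
    have pf: "p \<in> prime_factors d" using p d by (simp add: in_prime_factors_iff)
    consider "p \<in> Y" | "p \<in> X" | "p \<notin> X" "p \<notin> Y" by blast
    then show False
    proof cases
      case 1
      then have C: "p dvd C" "p dvd c * C" using pC p by auto
      then have aA': "\<not> p dvd a * A" using nAC p by blast
      have "p dvd k i 1" for i
      proof -
        have "p dvd k i 1 * (a * A\<^sup>2) + (k i 2 * (A * C) + k i 3 * (c * C\<^sup>2))" using h by (simp add: add.assoc)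
        moreover have "p dvd k i 2 * (A * C) + k i 3 * (c * C\<^sup>2)" using C by (simp add: power2_eq_square)
        ultimately have "p dvd k i 1 * (a * A\<^sup>2)" using dvd_add_left_iff by blast
        then show ?thesis using aA' p by (auto simp: prime_dvd_mult_iff power2_eq_square)
      qed
      then show False using 1 by (auto simp: Y_def)
    next
      case 2
      then have C: "p dvd A" "p dvd a * A" using pA p by auto
      then have cC: "\<not> p dvd c * C" using nAC p by blast
      have "p dvd k i 3" for i
      proof -
        have "p dvd (k i 1 * (a * A\<^sup>2) + k i 2 * (A * C)) + k i 3 * (c * C\<^sup>2)" using h by simp
        moreover have "p dvd k i 1 * (a * A\<^sup>2) + k i 2 * (A * C)" using C by (simp add: power2_eq_square)
        ultimately have "p dvd k i 3 * (c * C\<^sup>2)" using dvd_add_right_iff by blast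
        then show ?thesis using cC p by (auto simp: prime_dvd_mult_iff power2_eq_square)
      qed
      then show False using 2 by (auto simp: X_def)
    next
      case 3
      then have k1: "p dvd k i 1" "p dvd k i 3" for i using pf by (auto simp: X_def Y_def)
      have AC: "\<not> p dvd A * C" using 3 pA pC p by (simp add: prime_dvd_mult_iff)
      have k2: "p dvd k i 2" for i
      proof -
        have "p dvd k i 2 * (A * C) + (k i 1 * (a * A\<^sup>2) + k i 3 * (c * C\<^sup>2))" using h by (simp add: algebra_simps)
        moreover have "p dvd k i 1 * (a * A\<^sup>2) + k i 3 * (c * C\<^sup>2)" using k1 by simp
        ultimately have "p dvd k i 2 * (A * C)" using dvd_add_left_iff by blast
        then show ?thesis using AC p by (simp add: prime_dvd_mult_iff)
      qed
      obtain i j where "\<not> p dvd k i j" using nz p by blast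
      then show False using k1 k2 exhaust_3[of j] by auto
    qed
  qed
  then show ?thesis using iso prim by blast
qed

text \<open>Denominators of \<open>h\<close> are closed under taking remainders, so the least one
  divides all others; and a prime dividing \<open>d\<close> and all entries of \<open>d h\<close>
  could be cancelled from \<open>d\<close>.\<close>

lemma minimal_denominator:
  fixes h :: "real^'n^'n"
  assumes "h \<in> mats_over \<rat>"
  obtains d :: nat and k :: "'n \<Rightarrow> 'n \<Rightarrow> int" where "d > 0" "\<And>i j. real d * h $ i $ j = of_int (k i j)"
    "\<And>p. prime p \<Longrightarrow> p dvd int d \<Longrightarrow> \<exists>i j. \<not> p dvd k i j"
    "\<And>n. n > 0 \<Longrightarrow> real n *\<^sub>R h \<in> mats_over \<int> \<Longrightarrow> d dvd n"
proof -
  let ?P = "\<lambda>n::nat. n > 0 \<and> real n *\<^sub>R h \<in> mats_over \<int>"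
  define d where "d = (LEAST n. ?P n)"
  have ex: "\<exists>n. ?P n" using common_denominator[OF assms] by blast
  then have d: "?P d" unfolding d_def by (rule LeastI_ex)
  have least: "?P n \<Longrightarrow> d \<le> n" for n unfolding d_def by (rule Least_le)
  have dd: "d dvd n" if n: "?P n" for n
  proof -
    have "real (n mod d) *\<^sub>R h \<in> mats_over \<int>"
    proof -
      have "n = d * (n div d) + n mod d" by simp
      then have "real n = real d * real (n div d) + real (n mod d)" by (metis of_nat_add of_nat_mult)
      then have "real (n mod d) = real n + of_int (- int (n div d)) * real d" by simp
      then have "real (n mod d) *\<^sub>R h = real n *\<^sub>R h + of_int (- int (n div d)) *\<^sub>R (real d *\<^sub>R h)"
        by (simp only: scaleR_left_distrib scaleR_scaleR)
      also have "\<dots> \<in> mats_over \<int>" using n d by (intro mats_Ints_add[OF conjunct2[OF n] mats_Ints_scale[OF _ conjunct2[OF d]]]) simp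
      finally show ?thesis .
    qed
    then have "n mod d > 0 \<Longrightarrow> d \<le> n mod d" using least by blast
    then have "\<not> n mod d > 0" using mod_less_divisor[of d n] d by linarith
    then show ?thesis by auto
  qed
  have "\<forall>i j. \<exists>x. real d * h $ i $ j = of_int x"
  proof (intro allI)
    fix i j
    have "real d * h $ i $ j \<in> \<int>" using d by (simp add: mats_over_def)
    then show "\<exists>x. real d * h $ i $ j = of_int x" by (auto elim: Ints_cases)
  qed
  then obtain k :: "'n \<Rightarrow> 'n \<Rightarrow> int" where k: "\<And>i j. real d * h $ i $ j = of_int (k i j)" by metis
  have "\<exists>i j. \<not> p dvd k i j" if p: "prime p" "p dvd int d" for p
  proof (rule ccontr)
    assume "\<nexists>i j. \<not> p dvd k i j"
    then have a: "\<And>i j. p dvd k i j" by blast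
    have p0: "p > 1" using p(1) prime_gt_1_int by blast
    obtain e where e: "int d = p * e" using p by blast
    have e0: "e > 0" 
    proof -
      have "p * e > 0" unfolding e[symmetric] using d by simp
      then show ?thesis using p0 by (simp add: zero_less_mult_iff)
    qed
    have "real (nat e) *\<^sub>R h \<in> mats_over \<int>" unfolding mats_over_def
    proof (intro CollectI allI)
      fix i j
      obtain c where c: "k i j = p * c" using a by blast
      have "real d = of_int p * of_int e" using e by (metis of_int_mult of_int_of_nat_eq)
      then have "of_int p * (of_int e * h $ i $ j) = of_int p * (of_int c :: real)" using k[of i j] c by simp
      then have "of_int e * h $ i $ j = of_int c" using p0 by simp
      then show "(real (nat e) *\<^sub>R h) $ i $ j \<in> \<int>" using e0 by simp
    qed
    then have "d \<le> nat e" using least[of "nat e"] e0 by simp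
    moreover have "int d > e" using e e0 p0 by simp
    ultimately show False using e0 by simp
  qed
  then show ?thesis using that d k dd by blast
qed

lemma dvd_image_dvd:
  fixes h :: "real^'n^'n" and x w :: "'n \<Rightarrow> int"
  assumes k: "\<And>i j. real d * h $ i $ j = of_int (k i j)" and det: "det h = 1 \<or> det h = -1"
    and p: "prime (p::int)" "\<not> p dvd int d"
    and w: "\<And>i. (\<Sum>j\<in>UNIV. k i j * x j) = p * w i"
  shows "p dvd x j"
proof -
  \<comment> \<open>Cramer's rule: \<open>x j\<close> times the determinant of \<open>k\<close>, a power of \<open>d\<close> up to sign, is a multiple of \<open>p\<close>.\<close>
  let ?K = "(\<chi> i j. of_int (k i j)) :: real^'n^'n" and ?x = "(\<chi> j. of_int (x j)) :: real^'n"
  have K: "?K = real d *\<^sub>R h" using k by (simp add: vec_eq_iff)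
  have Kx: "(?K *v ?x) $ i = of_int p * of_int (w i)" for i
    using arg_cong[OF w[of i], of "of_int :: int \<Rightarrow> real"] by (simp add: matrix_vector_mult_def)
  let ?B = "(\<chi> i l. if l = j then (?K *v ?x) $ i else ?K $ i $ l) :: real^'n^'n"
  let ?C = "(\<chi> i l. if l = j then of_int (w i) else of_int (k i l)) :: real^'n^'n"
  have "det ?B = of_int p * det ?C"
  proof -
    have "transpose ?B = (\<chi> i. if i = j then of_int p *s (\<chi> l. of_int (w l)) else (\<chi> l. of_int (k l i)))"
      unfolding Kx by (simp add: vec_eq_iff transpose_def)
    then have "det (transpose ?B) = of_int p * det (\<chi> i. if i = j then (\<chi> l. of_int (w l)) else (\<chi> l. of_int (k l i)) :: real^'n^'n)"
      by (simp only: det_row_mul)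
    also have "(\<chi> i. if i = j then (\<chi> l. of_int (w l)) else (\<chi> l. of_int (k l i)) :: real^'n^'n) = transpose ?C"
      by (simp add: vec_eq_iff transpose_def)
    finally show ?thesis by (simp only: det_transpose)
  qed
  moreover have "det ?B = of_int (x j) * det ?K" using cramer_lemma[of j ?K ?x] by simp
  moreover have "det ?K = real d ^ CARD('n) * det h" unfolding K by (rule det_scaleR)
  ultimately have e: "of_int (x j) * (real d ^ CARD('n) * det h) = of_int p * det ?C" by simp
  have "?C \<in> mats_over \<int>" by (simp add: mats_over_def)
  then have "det ?C \<in> \<int>" by (rule det_Ints)
  then obtain z where z: "det ?C = of_int z" by (rule Ints_cases)
  have "p dvd x j * int d ^ CARD('n)"
  proof -
    from det have "\<exists>s::int. (s = 1 \<or> s = -1) \<and> det h = of_int s" 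
      by (auto intro: exI[of _ 1] exI[of _ "-1"])
    then obtain s :: int where s: "s = 1 \<or> s = -1" "det h = of_int s" by blast
    have "of_int (x j * int d ^ CARD('n) * s) = (of_int (p * z) :: real)" using e unfolding z s(2) by (simp add: mult.assoc)
    then have "x j * int d ^ CARD('n) * s = p * z" by (simp only: of_int_eq_iff)
    then have "p dvd x j * int d ^ CARD('n) * s" by simp
    then show ?thesis using s(1) by auto
  qed
  then show ?thesis using p prime_dvd_mult_iff prime_dvd_power by blast
qed

text \<open>Only invariance of the form is assumed, because the lemma must also apply to the middle
  block of a quinary matrix, which need not lie in the identity component; hence the signs
  \<open>s\<close> and \<open>t\<close>. The minimality of \<open>d\<close> later yields the
  divisibility between the two quinary parameters.\<close>

lemma reduce3:
  assumes N: "squarefree N" "N > 0" and h: "h \<in> mats_over \<rat>" "quad_subst (S_mat N) h = S_mat N"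
  shows "\<exists>u\<in>SO0_int (S_mat N). \<exists>v\<in>SO0_int (S_mat N). \<exists>d::nat. \<exists>s\<in>{1,-1}. \<exists>t\<in>{1,-1}. d > 0 \<and>
    h = u ** diag3 (s / real d) t (s * real d) ** v \<and> (\<forall>n>0. real n *\<^sub>R h \<in> mats_over \<int> \<longrightarrow> d dvd n)"
proof -
  obtain d :: nat and k :: "3 \<Rightarrow> 3 \<Rightarrow> int" where d: "d > 0" and k: "\<And>i j. real d * h $ i $ j = of_int (k i j)"
    and kp: "\<And>p. prime p \<Longrightarrow> p dvd int d \<Longrightarrow> \<exists>i j. \<not> p dvd k i j"
    and dmin: "\<And>n. n > 0 \<Longrightarrow> real n *\<^sub>R h \<in> mats_over \<int> \<Longrightarrow> d dvd n"
    using minimal_denominator[OF h(1)] by metis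
  obtain x1 x2 x3 where x: "x1 * x3 = int N * x2\<^sup>2" "primitive3 x1 x2 x3"
    "\<And>p. prime p \<Longrightarrow> p dvd int d \<Longrightarrow> \<exists>i. \<not> p dvd k i 1 * x1 + k i 2 * x2 + k i 3 * x3"
    using choose3[OF N, of "int d" k] kp d by auto
  define w where "w i = k i 1 * x1 + k i 2 * x2 + k i 3 * x3" for i
  define X :: "real^3" where "X = vector [of_int x1, of_int x2, of_int x3]"
  have wh: "of_int (w i) = real d * (h *v X) $ i" for i
    unfolding w_def X_def by (simp add: k[symmetric] matrix_vector_mult_def sum_3 algebra_simps)
  have wX: "vector [of_int (w 1), of_int (w 2), of_int (w 3)] = real d *\<^sub>R (h *v X)"
    by (simp add: vec_eq_iff forall_3 wh)
  have qq: "(h *v X)$1 * (h *v X)$3 - real N * ((h *v X)$2)\<^sup>2 = X$1 * X$3 - real N * (X$2)\<^sup>2"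
    using quad_form_subst[of h X "S_mat N"] unfolding h(2) quad_form_S_mat by simp
  have Xiso: "X$1 * X$3 - real N * (X$2)\<^sup>2 = 0"
    using arg_cong[OF x(1), of "of_int :: int \<Rightarrow> real"] by (simp add: X_def)
  have "of_int (w 1 * w 3 - int N * (w 2)\<^sup>2) = (real d)\<^sup>2 * ((h *v X)$1 * (h *v X)$3 - real N * ((h *v X)$2)\<^sup>2)"
    by (simp add: wh power2_eq_square algebra_simps)
  then have "of_int (w 1 * w 3 - int N * (w 2)\<^sup>2) = (0 :: real)" unfolding qq Xiso by simp
  then have wiso: "w 1 * w 3 = int N * (w 2)\<^sup>2" by (simp only: of_int_eq_0_iff right_minus_eq)
  have wprim: "primitive3 (w 1) (w 2) (w 3)"
    unfolding primitive3_def
  proof (intro allI impI notI)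
    fix p :: int assume p: "prime p" and pw: "p dvd w 1 \<and> p dvd w 2 \<and> p dvd w 3"
    then have pwi: "p dvd w i" for i using exhaust_3[of i] by auto
    show False
    proof (cases "p dvd int d")
      case True then show False using x(3)[OF p True] pwi by (auto simp: w_def)
    next
      case False
      have dh: "det h = 1 \<or> det h = -1" using det_quad_subst[OF h(2) det_S_mat[OF N(2)]] .
      define xx :: "3 \<Rightarrow> int" where "xx j = (if j = 1 then x1 else if j = 2 then x2 else x3)" for j
      have "\<forall>i. \<exists>c. w i = p * c" using pwi by (auto elim: dvdE)
      then obtain c where c: "\<And>i. w i = p * c i" by metis
      have "(\<Sum>j\<in>UNIV. k i j * xx j) = p * c i" for i
        unfolding c[symmetric] w_def by (simp add: sum_3 xx_def)
      then have "p dvd xx j" for j by (rule dvd_image_dvd[OF k dh p False])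
      from this[of 1] this[of 2] this[of 3] show False using x(2) p by (auto simp: primitive3_def xx_def)
    qed
  qed
  obtain u s where u: "u \<in> SO0_int (S_mat N)" "s \<in> {1, -1}" "column 1 u = s *\<^sub>R X"
    using orbit3[OF N x(1,2)] unfolding X_def by blast
  obtain v t where v: "v \<in> SO0_int (S_mat N)" "t \<in> {1, -1}" "column 1 v = t *\<^sub>R (real d *\<^sub>R (h *v X))"
    using orbit3[OF N wiso wprim] unfolding wX by blast
  obtain u' where u': "u' \<in> SO0_int (S_mat N)" "u ** u' = mat 1" "u' ** u = mat 1" using SO0_int_inverse[OF u(1)] by blast
  obtain v' where v': "v' \<in> SO0_int (S_mat N)" "v ** v' = mat 1" "v' ** v = mat 1" using SO0_int_inverse[OF v(1)] by blast
  \<comment> \<open>\<open>g\<close> maps the first basis vector to \<open>\<sigma> / d\<close>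
    times itself. The entrywise equations \<open>ee\<close> for invariance of the form then make it
    upper triangular and determine it by \<open>d\<close>, \<open>\<sigma>\<close>,
    \<open>\<tau>\<close> and \<open>z\<close>.\<close>
  define g where "g = v' ** h ** u"
  define \<sigma> where "\<sigma> = s * t"
  have \<sigma>: "\<sigma> \<in> {1, -1}" using u(2) v(2) by (auto simp: \<sigma>_def)
  have qS: "quad_subst (S_mat N) M = S_mat N" if "M \<in> SO0_int (S_mat N)" for M
    using that SO0_SO by (auto simp: SO0_int_def SO_def)
  have gq: "quad_subst (S_mat N) g = S_mat N"
    unfolding g_def quad_subst_mult qS[OF v'(1)] h(2) qS[OF u(1)] ..
  have hX: "h *v X = (1 / real d * t) *\<^sub>R column 1 v"
    unfolding v(3) using v(2) d by auto
  have "column 1 g = v' *v (h *v column 1 u)" unfolding g_def column_mult by (simp add: matrix_vector_mul_assoc)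
  also have "\<dots> = (s * (1 / real d * t)) *\<^sub>R (v' *v column 1 v)"
    unfolding u(3) hX by (simp add: matrix_vector_mult_scaleR hX)
  also have "v' *v column 1 v = column 1 (mat 1)" using v'(3) by (simp flip: column_mult)
  finally have g1: "column 1 g = (\<sigma> / real d) *\<^sub>R column 1 (mat 1)" by (simp add: \<sigma>_def)
  have g11: "g $ 1 $ 1 = \<sigma> / real d" "g $ 2 $ 1 = 0" "g $ 3 $ 1 = 0"
    using g1 by (simp_all add: vec_eq_iff forall_3 column_def mat_def)
  have ee: "g$1$i * g$3$j + g$3$i * g$1$j - 2 * real N * g$2$i * g$2$j = S_mat N $ i $ j" for i j
    using quad_subst_S_mat[of N g i j] gq by simp
  have g32: "g $ 3 $ 2 = 0" using ee[of 1 2] \<sigma> d unfolding g11 S_mat_entries by auto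
  have g33: "g $ 3 $ 3 = \<sigma> * real d"
    using ee[of 1 3] \<sigma> d unfolding g11 S_mat_entries by (auto simp: field_simps)
  have "g $ 2 $ 2 * g $ 2 $ 2 = 1" using ee[of 2 2] N(2) unfolding g32 S_mat_entries by simp
  then have g22: "g $ 2 $ 2 = 1 \<or> g $ 2 $ 2 = -1" by (simp add: square_eq_1_iff)
  define \<tau> where "\<tau> = g $ 2 $ 2"
  define z where "z = g $ 2 $ 3"
  have \<tau>: "\<tau> \<in> {1, -1}" "\<tau> * \<tau> = 1" using g22 by (auto simp: \<tau>_def)
  have e1: "g $ 1 $ 2 * (\<sigma> * real d) = 2 * real N * \<tau> * z" using ee[of 2 3] unfolding g32 g33 S_mat_entries by (simp add: \<tau>_def z_def)
  then have g12: "g $ 1 $ 2 = \<sigma> / real d * (2 * real N * (\<tau> * z))" using \<sigma> d by (auto simp: field_simps)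
  have e2: "g $ 1 $ 3 * (\<sigma> * real d) = real N * z\<^sup>2" 
    using ee[of 3 3] unfolding g33 S_mat_entries by (simp add: z_def power2_eq_square mult_ac)
  then have g13: "g $ 1 $ 3 = \<sigma> / real d * (real N * z\<^sup>2)" using \<sigma> d by (auto simp: field_simps)
  have dg: "real d *\<^sub>R g \<in> mats_over \<int>"
  proof -
    have "real d *\<^sub>R h \<in> mats_over \<int>" using k by (simp add: mats_over_def)
    moreover have "real d *\<^sub>R g = v' ** (real d *\<^sub>R h) ** u" by (simp add: g_def mat_scaleR_mult)
    ultimately show ?thesis using v'(1) u(1) by (auto simp: SO0_int_def intro!: mats_Ints_mult)
  qed
  \<comment> \<open>By \<open>e2\<close>, \<open>N z^2\<close> is up to sign the top right entry of
    the integral matrix \<open>d g\<close>.\<close>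
  have zz: "z \<in> \<int>"
  proof (rule squarefree_Rats_Ints[OF N(1)])
    have "g \<in> mats_over \<rat>" by (rule mats_Rats_scale_cancel[OF d mats_Ints_Rats[OF dg]])
    then show "z \<in> \<rat>" by (simp add: z_def mats_over_def)
    have "real d * g $ 1 $ 3 \<in> \<int>" using dg by (simp add: mats_over_def)
    moreover have "\<sigma> \<in> \<int>" using \<sigma> by auto
    ultimately have "(real d * g $ 1 $ 3) * \<sigma> \<in> \<int>" by (rule Ints_mult)
    then show "real N * z\<^sup>2 \<in> \<int>" using e2 by (simp add: mult_ac)
  qed
  have "\<tau> * z \<in> \<int>" using zz \<tau>(1) by (intro Ints_mult) auto
  then obtain m where m: "\<tau> * z = of_int m" by (rule Ints_cases)
  have zm: "z = \<tau> * of_int m" unfolding m[symmetric] using \<tau>(2) by (simp add: mult.assoc[symmetric])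
  have zm2: "z\<^sup>2 = (of_int m)\<^sup>2" unfolding m[symmetric] power_mult_distrib using \<tau>(2) by (simp add: power2_eq_square)
  have gd: "g = diag3 (\<sigma> / real d) \<tau> (\<sigma> * real d) ** upper3 N (of_int m)"
    unfolding diag3_def upper3_def
    using g11 g12[unfolded m] g13[unfolded zm2] g32 g33 zm[unfolded z_def]
    by (simp add: vec_eq_iff forall_3 matrix_matrix_mult_def sum_3 \<tau>_def[symmetric])
  have um: "upper3 N (of_int m) \<in> SO0_int (S_mat N)"
    using upper3_int upper3_SO0[OF N(2)] by (simp add: SO0_int_def)
  have "h = v ** g ** u'"
  proof -
    have "v ** g ** u' = (v ** v') ** h ** (u ** u')" unfolding g_def by (simp only: matrix_mul_assoc)
    then show ?thesis using v'(2) u'(2) by simp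
  qed
  also have "\<dots> = v ** diag3 (\<sigma> / real d) \<tau> (\<sigma> * real d) ** (upper3 N (of_int m) ** u')"
    unfolding gd by (simp only: matrix_mul_assoc)
  finally show ?thesis using v(1) SO0_int_mult[OF um u'(1)] \<sigma> \<tau>(1) d dmin by blast
qed

section \<open>The quinary form\<close>

lemma exhaust_5:
  fixes x :: 5
  shows "x = 1 \<or> x = 2 \<or> x = 3 \<or> x = 4 \<or> x = 5"
proof (induct x)
  case (of_int z)
  \<comment> \<open>Representatives run from 0 to 4; the index written 5 is 0.\<close>
  then have "z = 0 \<or> z = 1 \<or> z = 2 \<or> z = 3 \<or> z = 4" by fastforce
  then show ?case by auto
qed

lemma forall_5: "(\<forall>i::5. P i) \<longleftrightarrow> P 1 \<and> P 2 \<and> P 3 \<and> P 4 \<and> P 5"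
  by (metis exhaust_5)

lemma UNIV_5: "UNIV = {1, 2, 3, 4, 5::5}"
  using exhaust_5 by auto

lemma sum_5: "sum f (UNIV::5 set) = f 1 + f 2 + f 3 + f 4 + f 5"
  unfolding UNIV_5 by (simp add: ac_simps)

lemma vector_5 [simp]:
  "(vector [a, b, c, d, e] :: 'a::zero^5) $ 1 = a"
  "(vector [a, b, c, d, e] :: 'a::zero^5) $ 2 = b"
  "(vector [a, b, c, d, e] :: 'a::zero^5) $ 3 = c"
  "(vector [a, b, c, d, e] :: 'a::zero^5) $ 4 = d"
  "(vector [a, b, c, d, e] :: 'a::zero^5) $ 5 = e"
  unfolding vector_def by simp_all

lemma vector_5_eq: "(vector [a, b, c, d, e] :: 'a::zero^5) =
  (\<chi> i. if i = 1 then a else if i = 2 then b else if i = 3 then c else if i = 4 then d else e)"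
  by (simp add: vec_eq_iff forall_5)

lemma continuous_on_vector_5:
  fixes f1 f2 f3 f4 f5 :: "'b::topological_space \<Rightarrow> 'a::{zero,topological_space}"
  assumes "continuous_on X f1" "continuous_on X f2" "continuous_on X f3" "continuous_on X f4" "continuous_on X f5"
  shows "continuous_on X (\<lambda>t. vector [f1 t, f2 t, f3 t, f4 t, f5 t] :: 'a^5)"
  unfolding vector_5_eq
proof (rule continuous_on_vec_lambda)
  show "continuous_on X (\<lambda>t. if i = 1 then f1 t else if i = 2 then f2 t else if i = 3 then f3 t else if i = 4 then f4 t else f5 t)" for i :: 5
    by (cases "i = 1"; cases "i = 2"; cases "i = 3"; cases "i = 4"; simp add: assms)
qed

lemma quad_subst_S_hat:
  "quad_subst (S_hat_mat N) K $ i $ j = K$1$i * K$5$j + K$5$i * K$1$j + K$2$i * K$4$j + K$4$i * K$2$j - 2 * real N * K$3$i * K$3$j"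
  by (simp add: quad_subst_def S_hat_mat_def matrix_matrix_mult_def sum_5 transpose_def algebra_simps)

lemma S_hat_entries:
  "S_hat_mat N $ 1 $ 1 = 0" "S_hat_mat N $ 1 $ 2 = 0" "S_hat_mat N $ 1 $ 3 = 0" "S_hat_mat N $ 1 $ 4 = 0" "S_hat_mat N $ 1 $ 5 = 1"
  "S_hat_mat N $ 2 $ 1 = 0" "S_hat_mat N $ 2 $ 2 = 0" "S_hat_mat N $ 2 $ 3 = 0" "S_hat_mat N $ 2 $ 4 = 1" "S_hat_mat N $ 2 $ 5 = 0"
  "S_hat_mat N $ 3 $ 1 = 0" "S_hat_mat N $ 3 $ 2 = 0" "S_hat_mat N $ 3 $ 3 = - 2 * real N" "S_hat_mat N $ 3 $ 4 = 0" "S_hat_mat N $ 3 $ 5 = 0"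
  "S_hat_mat N $ 4 $ 1 = 0" "S_hat_mat N $ 4 $ 2 = 1" "S_hat_mat N $ 4 $ 3 = 0" "S_hat_mat N $ 4 $ 4 = 0" "S_hat_mat N $ 4 $ 5 = 0"
  "S_hat_mat N $ 5 $ 1 = 1" "S_hat_mat N $ 5 $ 2 = 0" "S_hat_mat N $ 5 $ 3 = 0" "S_hat_mat N $ 5 $ 4 = 0" "S_hat_mat N $ 5 $ 5 = 0"
  by (simp_all add: S_hat_mat_def)

lemma quad_form_S_hat: "x \<bullet> (S_hat_mat N *v x) = 2 * (x$1 * x$5 + x$2 * x$4 - real N * (x$3)\<^sup>2)"
  by (simp add: inner_vec_def sum_5 matrix_vector_mult_def S_hat_mat_def power2_eq_square algebra_simps)

lemma det_S_hat:
  assumes "N > 0" shows "det (S_hat_mat N) \<noteq> 0"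
proof -
  let ?T = "vector [vector [0, 0, 0, 0, 1], vector [0, 0, 0, 1, 0], vector [0, 0, - 1 / (2 * real N), 0, 0],
     vector [0, 1, 0, 0, 0], vector [1, 0, 0, 0, 0]] :: real^5^5"
  have "S_hat_mat N ** ?T = mat 1"
    using assms by (simp add: S_hat_mat_def vec_eq_iff forall_5 matrix_matrix_mult_def sum_5 mat_def)
  then have "det (S_hat_mat N) * det ?T = 1" by (simp only: det_mul[symmetric] det_I)
  then show ?thesis by auto
qed

text \<open>Eichler transformations: the unipotent radical of the stabiliser of the first basis
  line. With \<open>y = (a, b, c)\<close> and \<open>S = S_mat N\<close> the first row is (1, - y'
  S, - S[y] / 2).\<close>

definition upper5 :: "nat \<Rightarrow> real \<Rightarrow> real \<Rightarrow> real \<Rightarrow> real^5^5" where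
  "upper5 N a b c = vector [vector [1, - c, 2 * real N * b, - a, real N * b\<^sup>2 - a * c],
     vector [0, 1, 0, 0, a], vector [0, 0, 1, 0, b], vector [0, 0, 0, 1, c], vector [0, 0, 0, 0, 1]]"

text \<open>The opposite unipotent group. Its first columns are exactly the isotropic vectors with
  first coordinate 1, which makes it the source of test vectors below.\<close>

definition lower5 :: "nat \<Rightarrow> real \<Rightarrow> real \<Rightarrow> real \<Rightarrow> real^5^5" where
  "lower5 N a b c = vector [vector [1, 0, 0, 0, 0],
     vector [a, 1, 0, 0, 0], vector [b, 0, 1, 0, 0], vector [c, 0, 0, 1, 0], vector [real N * b\<^sup>2 - a * c, - c, 2 * real N * b, - a, 1]]"

definition diag5 :: "real \<Rightarrow> real \<Rightarrow> real \<Rightarrow> real \<Rightarrow> real \<Rightarrow> real^5^5" where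
  "diag5 a b c d e = vector [vector [a, 0, 0, 0, 0], vector [0, b, 0, 0, 0], vector [0, 0, c, 0, 0], vector [0, 0, 0, d, 0], vector [0, 0, 0, 0, e]]"

text \<open>Rotation of the isotropic plane of e1, e2 with the contragredient action on the dual
  plane of e5, e4; \<open>rotB5\<close> does the same for e1, e4 and e5, e2. At pi / 2 both are
  signed permutation matrices, that is, integral Weyl elements.\<close>

definition rotA5 :: "real \<Rightarrow> real^5^5" where
  "rotA5 t = vector [vector [cos t, - sin t, 0, 0, 0], vector [sin t, cos t, 0, 0, 0], vector [0, 0, 1, 0, 0],
     vector [0, 0, 0, cos t, sin t], vector [0, 0, 0, - sin t, cos t]]"

definition rotB5 :: "real \<Rightarrow> real^5^5" where
  "rotB5 t = vector [vector [cos t, 0, 0, - sin t, 0], vector [0, cos t, 0, 0, sin t], vector [0, 0, 1, 0, 0],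
     vector [sin t, 0, 0, cos t, 0], vector [0, - sin t, 0, 0, cos t]]"

definition emb5 :: "real \<Rightarrow> real^3^3 \<Rightarrow> real \<Rightarrow> real^5^5" where
  "emb5 a g b = vector [vector [a, 0, 0, 0, 0], vector [0, g$1$1, g$1$2, g$1$3, 0],
     vector [0, g$2$1, g$2$2, g$2$3, 0], vector [0, g$3$1, g$3$2, g$3$3, 0], vector [0, 0, 0, 0, b]]"

lemma upper5_SO0: "N > 0 \<Longrightarrow> upper5 N a b c \<in> SO0 (S_hat_mat N)"
proof -
  assume N: "N > 0"
  have "upper5 N (t * a) (t * b) (t * c) \<in> SO0 (S_hat_mat N)" for t
  proof (rule SO0_path[where f = "\<lambda>t. upper5 N (t * a) (t * b) (t * c)" and X = UNIV and ?x0.0 = 0])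
    show "continuous_on UNIV (\<lambda>t. upper5 N (t * a) (t * b) (t * c))"
      unfolding upper5_def by (intro continuous_on_vector_5 continuous_intros)
    show "upper5 N (0 * a) (0 * b) (0 * c) = mat 1" by (simp add: upper5_def vec_eq_iff forall_5 mat_def)
    show "quad_subst (S_hat_mat N) (upper5 N (x * a) (x * b) (x * c)) = S_hat_mat N" for x
      unfolding vec_eq_iff forall_5 quad_subst_S_hat S_hat_entries
      by (simp add: upper5_def power2_eq_square algebra_simps)
  qed (use det_S_hat[OF N] in auto)
  from this[of 1] show ?thesis by simp
qed

lemma lower5_SO0: "N > 0 \<Longrightarrow> lower5 N a b c \<in> SO0 (S_hat_mat N)"
proof -
  assume N: "N > 0"
  have "lower5 N (t * a) (t * b) (t * c) \<in> SO0 (S_hat_mat N)" for t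
  proof (rule SO0_path[where f = "\<lambda>t. lower5 N (t * a) (t * b) (t * c)" and X = UNIV and ?x0.0 = 0])
    show "continuous_on UNIV (\<lambda>t. lower5 N (t * a) (t * b) (t * c))"
      unfolding lower5_def by (intro continuous_on_vector_5 continuous_intros)
    show "lower5 N (0 * a) (0 * b) (0 * c) = mat 1" by (simp add: lower5_def vec_eq_iff forall_5 mat_def)
    show "quad_subst (S_hat_mat N) (lower5 N (x * a) (x * b) (x * c)) = S_hat_mat N" for x
      unfolding vec_eq_iff forall_5 quad_subst_S_hat S_hat_entries
      by (simp add: lower5_def power2_eq_square algebra_simps)
  qed (use det_S_hat[OF N] in auto)
  from this[of 1] show ?thesis by simp
qed

lemma rotA5_SO0: "N > 0 \<Longrightarrow> rotA5 t \<in> SO0 (S_hat_mat N)"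
proof (rule SO0_path[of _ UNIV rotA5 0])
  show "continuous_on UNIV rotA5"
    unfolding rotA5_def by (intro continuous_on_vector_5 continuous_intros)
  show "rotA5 0 = mat 1" by (simp add: rotA5_def vec_eq_iff forall_5 mat_def)
  show "quad_subst (S_hat_mat N) (rotA5 x) = S_hat_mat N" for x
    unfolding vec_eq_iff forall_5 quad_subst_S_hat S_hat_entries
    by (simp add: rotA5_def flip: power2_eq_square)
qed (use det_S_hat in auto)

lemma rotB5_SO0: "N > 0 \<Longrightarrow> rotB5 t \<in> SO0 (S_hat_mat N)"
proof (rule SO0_path[of _ UNIV rotB5 0])
  show "continuous_on UNIV rotB5"
    unfolding rotB5_def by (intro continuous_on_vector_5 continuous_intros)
  show "rotB5 0 = mat 1" by (simp add: rotB5_def vec_eq_iff forall_5 mat_def)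
  show "quad_subst (S_hat_mat N) (rotB5 x) = S_hat_mat N" for x
    unfolding vec_eq_iff forall_5 quad_subst_S_hat S_hat_entries
    by (simp add: rotB5_def flip: power2_eq_square)
qed (use det_S_hat in auto)

lemma diag5_SO0:
  assumes "N > 0" "a > 0" "b > 0"
  shows "diag5 a b 1 (1 / b) (1 / a) \<in> SO0 (S_hat_mat N)"
proof -
  have "diag5 (a powr t) (b powr t) 1 (b powr - t) (a powr - t) \<in> SO0 (S_hat_mat N)" for t
  proof (rule SO0_path[where f = "\<lambda>t. diag5 (a powr t) (b powr t) 1 (b powr - t) (a powr - t)" and X = UNIV and ?x0.0 = 0])
    show "continuous_on UNIV (\<lambda>t. diag5 (a powr t) (b powr t) 1 (b powr - t) (a powr - t))"
      unfolding diag5_def using assms by (intro continuous_on_vector_5 continuous_intros) auto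
    show "diag5 (a powr 0) (b powr 0) 1 (b powr - 0) (a powr - 0) = mat 1"
      using assms by (simp add: diag5_def vec_eq_iff forall_5 mat_def)
    show "quad_subst (S_hat_mat N) (diag5 (a powr x) (b powr x) 1 (b powr - x) (a powr - x)) = S_hat_mat N" for x
      unfolding vec_eq_iff forall_5 quad_subst_S_hat S_hat_entries
      using assms by (simp add: diag5_def flip: powr_add)
  qed (use det_S_hat[OF assms(1)] in auto)
  from this[of 1] show ?thesis using assms by (simp add: powr_minus divide_inverse)
qed

lemma emb5_mult: "emb5 a g b ** emb5 a' g' b' = emb5 (a * a') (g ** g') (b * b')"
  by (simp add: emb5_def vec_eq_iff forall_5 matrix_matrix_mult_def sum_5 sum_3)

lemma emb5_quad: "quad_subst (S_mat N) g = S_mat N \<Longrightarrow> quad_subst (S_hat_mat N) (emb5 1 g 1) = S_hat_mat N"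
  unfolding vec_eq_iff forall_5 forall_3 quad_subst_S_hat S_hat_entries quad_subst_S_mat S_mat_entries
  by (simp add: emb5_def mult_ac)

text \<open>The ternary identity component itself is the connected parameter space to which
  \<open>SO0_path\<close> is applied.\<close>

lemma emb5_SO0_int:
  assumes N: "N > 0" and u: "u \<in> SO0_int (S_mat N)"
  shows "emb5 1 u 1 \<in> SO0_int (S_hat_mat N)"
proof -
  have "emb5 1 u 1 \<in> SO0 (S_hat_mat N)"
  proof (rule SO0_path[of _ "SO0 (S_mat N)" "\<lambda>u. emb5 1 u 1" "mat 1"])
    show "continuous_on (SO0 (S_mat N)) (\<lambda>u. emb5 1 u 1)"
      unfolding emb5_def by (intro continuous_on_vector_5 continuous_intros)
    show "emb5 1 (mat 1) 1 = mat 1" by (simp add: emb5_def vec_eq_iff forall_5 mat_def)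
    show "quad_subst (S_hat_mat N) (emb5 1 x 1) = S_hat_mat N" if "x \<in> SO0 (S_mat N)" for x
      using that SO0_SO by (intro emb5_quad) (auto simp: SO_def)
  qed (use u det_S_hat[OF N] connected_SO0 one_SO0 in \<open>auto simp: SO0_int_def\<close>)
  moreover have "emb5 1 u 1 \<in> mats_over \<int>"
    using u by (simp add: SO0_int_def mats_over_def emb5_def forall_5)
  ultimately show ?thesis by (simp add: SO0_int_def)
qed

lemma upper5_int: "N > 0 \<Longrightarrow> upper5 N (of_int a) (of_int b) (of_int c) \<in> SO0_int (S_hat_mat N)"
  using upper5_SO0 by (simp add: SO0_int_def mats_over_def upper5_def forall_5)

lemma lower5_int: "N > 0 \<Longrightarrow> lower5 N (of_int a) (of_int b) (of_int c) \<in> SO0_int (S_hat_mat N)"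
  using lower5_SO0 by (simp add: SO0_int_def mats_over_def lower5_def forall_5)

lemma rot5_int:
  assumes "N > 0"
  shows "rotA5 (pi / 2) \<in> SO0_int (S_hat_mat N)" "rotB5 (pi / 2) \<in> SO0_int (S_hat_mat N)"
proof -
  have "rotA5 (pi / 2) \<in> mats_over \<int>" "rotB5 (pi / 2) \<in> mats_over \<int>"
    by (simp_all add: mats_over_def rotA5_def rotB5_def forall_5)
  then show "rotA5 (pi / 2) \<in> SO0_int (S_hat_mat N)" "rotB5 (pi / 2) \<in> SO0_int (S_hat_mat N)"
    using rotA5_SO0[OF assms] rotB5_SO0[OF assms] by (simp_all only: SO0_int_def Int_iff)
qed

text \<open>Descent on the first coordinate. When it has its least nonzero absolute value
  \<open>a\<close> in the orbit, translations reduce the second and fourth coordinates modulo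
  \<open>a\<close>, and a Weyl element would carry a nonzero remainder to the first place; so
  \<open>a\<close> divides both. Squarefreeness extends this to the third coordinate, so
  \<open>a\<close> divides the whole primitive vector.\<close>

lemma orbit5:
  fixes x :: "5 \<Rightarrow> int"
  assumes N: "squarefree N" "N > 0" and iso: "x 1 * x 5 + x 2 * x 4 = int N * (x 3)\<^sup>2"
    and prim: "\<And>p. prime p \<Longrightarrow> \<exists>i. \<not> p dvd x i"
  shows "\<exists>u\<in>SO0_int (S_hat_mat N). \<exists>s\<in>{1, -1}. column 1 u = s *\<^sub>R (\<chi> i. of_int (x i))"
proof -
  let ?U = "SO0_int (S_hat_mat N)"
  define X :: "real^5" where "X = (\<chi> i. of_int (x i))"
  define V :: "int \<Rightarrow> int \<Rightarrow> int \<Rightarrow> int \<Rightarrow> int \<Rightarrow> real^5" where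
    "V a b c d e = vector [of_int a, of_int b, of_int c, of_int d, of_int e]" for a b c d e
  define Orb where "Orb a b c d e \<longleftrightarrow> (\<exists>u\<in>?U. V a b c d e = u *v X)" for a b c d e
  have step: "Orb a' b' c' d' e'" if O: "Orb a b c d e" and "M \<in> ?U" "M *v V a b c d e = V a' b' c' d' e'" for M a b c d e a' b' c' d' e'
  proof -
    obtain u where u: "u \<in> ?U" "V a b c d e = u *v X" using O Orb_def by blast
    have "V a' b' c' d' e' = (M ** u) *v X" using that(3) u(2) by (simp add: matrix_vector_mul_assoc)
    then show ?thesis unfolding Orb_def using SO0_int_mult[OF that(2) u(1)] by blast
  qed
  have W1: "Orb (- b) a c e (- d)" if "Orb a b c d e" for a b c d e
    by (rule step[OF that rot5_int(1)[OF N(2)]]) (simp add: V_def rotA5_def vec_eq_iff forall_5 matrix_vector_mult_def sum_5)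
  have W2: "Orb (- d) e c a (- b)" if "Orb a b c d e" for a b c d e
    by (rule step[OF that rot5_int(2)[OF N(2)]]) (simp add: V_def rotB5_def vec_eq_iff forall_5 matrix_vector_mult_def sum_5)
  have L: "\<exists>e'. Orb a (b + r * a) c (d + t * a) e'" if "Orb a b c d e" for a b c d e r t
  proof
    show "Orb a (b + r * a) c (d + t * a) (e - r * t * a - t * b - r * d)"
      by (rule step[OF that lower5_int[OF N(2), of r 0 t]])
        (simp add: V_def lower5_def vec_eq_iff forall_5 matrix_vector_mult_def sum_5 algebra_simps)
  qed
  have U: "Orb (a - d) (b + e) c d e" if "Orb a b c d e" for a b c d e
    by (rule step[OF that upper5_int[OF N(2), of 1 0 0]])
      (simp add: V_def upper5_def vec_eq_iff forall_5 matrix_vector_mult_def sum_5 algebra_simps)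
  have Oiso: "a * e + b * d = int N * c\<^sup>2" if O: "Orb a b c d e" for a b c d e
  proof -
    obtain u where u: "u \<in> ?U" "V a b c d e = u *v X" using O Orb_def by blast
    have qu: "quad_subst (S_hat_mat N) u = S_hat_mat N" using u(1) SO0_SO by (auto simp: SO0_int_def SO_def)
    have "V a b c d e \<bullet> (S_hat_mat N *v V a b c d e) = X \<bullet> (S_hat_mat N *v X)"
      unfolding u(2) quad_form_subst qu ..
    then have "real_of_int (a * e + b * d - int N * c\<^sup>2) = of_int (x 1 * x 5 + x 2 * x 4 - int N * (x 3)\<^sup>2)"
      unfolding quad_form_S_hat by (simp add: V_def X_def)
    then have "a * e + b * d - int N * c\<^sup>2 = x 1 * x 5 + x 2 * x 4 - int N * (x 3)\<^sup>2" by (simp only: of_int_eq_iff)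
    then show ?thesis using iso by simp
  qed
  have O0: "Orb (x 1) (x 2) (x 3) (x 4) (x 5)"
  proof -
    have "mat 1 \<in> ?U" using one_SO0 mat_1_mats by (auto simp: SO0_int_def)
    moreover have "V (x 1) (x 2) (x 3) (x 4) (x 5) = mat 1 *v X" by (simp add: V_def X_def vec_eq_iff forall_5)
    ultimately show ?thesis unfolding Orb_def by blast
  qed
  have ex: "\<exists>a b c d e. Orb a b c d e \<and> a \<noteq> 0"
  proof (rule ccontr)
    assume "\<nexists>a b c d e. Orb a b c d e \<and> a \<noteq> 0"
    then have no: "Orb a b c d e \<Longrightarrow> a = 0" for a b c d e by blast
    \<comment> \<open>Up to sign, Weyl elements bring each of the coordinates 1, 2, 4, 5 to the
      first place.\<close>
    have "x 1 = 0" "x 2 = 0" "x 4 = 0" "x 5 = 0"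
      using no[OF O0] no[OF W1[OF O0]] no[OF W2[OF O0]] no[OF W1[OF W2[OF O0]]] by auto
    moreover from this have "x 3 = 0" using iso N(2) by simp
    ultimately have "x i = 0" for i using exhaust_5[of i] by auto
    then show False using prim[of 2] by auto
  qed
  define Pm where "Pm m \<longleftrightarrow> (\<exists>a b c d e. Orb a b c d e \<and> a \<noteq> 0 \<and> nat \<bar>a\<bar> = m)" for m
  have "\<exists>m. Pm m" using ex by (auto simp: Pm_def)
  then have "Pm (LEAST m. Pm m)" by (rule LeastI_ex)
  then obtain a b c d e where a: "Orb a b c d e" "a \<noteq> 0" "nat \<bar>a\<bar> = (LEAST m. Pm m)" by (auto simp: Pm_def)
  have min: "\<bar>a\<bar> \<le> \<bar>a'\<bar>" if "Orb a' b' c' d' e'" "a' \<noteq> 0" for a' b' c' d' e'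
  proof -
    have "Pm (nat \<bar>a'\<bar>)" unfolding Pm_def using that by blast
    then have "nat \<bar>a\<bar> \<le> nat \<bar>a'\<bar>" unfolding a(3) by (rule Least_le)
    then show ?thesis by simp
  qed
  have dv: "a dvd b' \<and> a dvd d'" if O: "Orb a b' c' d' e'" for b' c' d' e'
  proof
    obtain e1 where "Orb a (b' + (- (b' div a)) * a) c' (d' + 0 * a) e1" using L[OF O] by blast
    moreover have "b' + (- (b' div a)) * a = b' mod a" by (simp add: minus_div_mult_eq_mod)
    ultimately have "Orb (- (b' mod a)) a c' e1 (- d')" using W1 by fastforce
    then have "b' mod a = 0" using min[of "- (b' mod a)"] abs_mod_less[OF a(2), of b'] by fastforce
    then show "a dvd b'" by auto
    obtain e2 where "Orb a (b' + 0 * a) c' (d' + (- (d' div a)) * a) e2" using L[OF O] by blast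
    moreover have "d' + (- (d' div a)) * a = d' mod a" by (simp add: minus_div_mult_eq_mod)
    ultimately have "Orb (- (d' mod a)) e2 c' a (- b')" using W2 by fastforce
    then have "d' mod a = 0" using min[of "- (d' mod a)"] abs_mod_less[OF a(2), of d'] by fastforce
    then show "a dvd d'" by auto
  qed
  obtain b' d' where bd: "b = a * b'" "d = a * d'" using dv[OF a(1)] unfolding dvd_def by blast
  obtain f where "Orb a (b + (- b') * a) c (d + (- d') * a) f" using L[OF a(1)] by blast
  then have O1: "Orb a 0 c 0 f" using bd by simp
  \<comment> \<open>Once the second and fourth coordinates are cleared, a translation copies the
    fifth into the second place, so that \<open>a\<close> divides \<open>f\<close> as well.\<close>
  have "Orb a f c 0 f" using U[OF O1] by simp
  then have "a dvd f" using dv by blast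
  then obtain f' where f': "f = a * f'" by blast
  have i1: "a * f = int N * c\<^sup>2" using Oiso[OF O1] by simp
  have "a dvd c"
  proof -
    have ar: "(of_int a :: real) \<noteq> 0" using a(2) by simp
    have "of_int a * (of_int a * of_int f') = real N * (of_int c)\<^sup>2"
      using arg_cong[OF i1, of "of_int :: int \<Rightarrow> real"] f' by simp
    then have "of_int f' * (of_int a)\<^sup>2 = real N * (of_int c)\<^sup>2" by (simp add: power2_eq_square mult_ac)
    then have "real N * (of_int c / of_int a)\<^sup>2 = of_int f'" using ar by (simp add: power_divide nonzero_divide_eq_eq)
    then have "real N * (of_int c / of_int a)\<^sup>2 \<in> \<int>" by simp
    then have "(of_int c / of_int a :: real) \<in> \<int>" by (rule squarefree_Rats_Ints[OF N(1), rotated]) auto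
    then obtain z where "(of_int c / of_int a :: real) = of_int z" by (rule Ints_cases)
    then have "(of_int c :: real) = of_int (a * z)" using ar by (simp add: field_simps)
    then have "c = a * z" by (simp only: of_int_eq_iff)
    then show ?thesis by simp
  qed
  then obtain c' where c': "c = a * c'" by blast
  have "a * a * f' = a * a * (int N * c'\<^sup>2)" using i1 f' c' by (simp add: power2_eq_square algebra_simps)
  then have f'': "f' = int N * c'\<^sup>2" using a(2) by simp
  obtain u where u: "u \<in> ?U" "V a 0 c 0 f = u *v X" using O1 Orb_def by blast
  obtain v where v: "v \<in> ?U" "u ** v = mat 1" "v ** u = mat 1" using SO0_int_inverse[OF u(1)] by blast
  have vX: "v *v V a 0 c 0 f = X" unfolding u(2) using v(3) by (simp add: matrix_vector_mul_assoc)
  let ?L = "lower5 N (of_int 0) (of_int c') (of_int 0)"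
  have VL: "V a 0 c 0 f = of_int a *\<^sub>R column 1 ?L"
    unfolding V_def lower5_def using c' f' f'' by (simp add: vec_eq_iff forall_5 column_def)
  have XL: "X = of_int a *\<^sub>R column 1 (v ** ?L)"
    unfolding column_mult vX[symmetric] VL by (simp add: matrix_vector_mult_scaleR)
  have vL: "v ** ?L \<in> ?U" by (rule SO0_int_mult[OF v(1) lower5_int[OF N(2)]])
  have "a = 1 \<or> a = -1"
  proof (rule ccontr)
    assume "\<not> (a = 1 \<or> a = -1)"
    then have "\<bar>a\<bar> \<noteq> 1" by auto
    then obtain p where p: "prime p" "p dvd a" using prime_divisor_exists[of a] a(2) by auto
    have "p dvd x i" for i
    proof -
      obtain k where "(v ** ?L) $ i $ 1 = of_int k" 
        using mats_IntsE[of "v ** ?L" i 1] vL unfolding SO0_int_def by blast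
      then have "(of_int (x i) :: real) = of_int (a * k)"
        using arg_cong[OF XL, of "\<lambda>X. X $ i"] by (simp add: X_def column_def)
      then have "x i = a * k" by (simp only: of_int_eq_iff)
      then show ?thesis using p by simp
    qed
    then show False using prim p(1) by blast
  qed
  then have s: "(of_int a :: real) \<in> {1, -1}" by auto
  then have "column 1 (v ** ?L) = of_int a *\<^sub>R X" unfolding XL by auto
  then show ?thesis using vL s unfolding X_def by blast
qed

text \<open>The vector is the first column of \<open>lower5 N a b c\<close>. For each prime dividing
  \<open>d\<close>, the first column of \<open>k\<close> nonzero modulo \<open>p\<close>, in the
  order 1, 2, 4, 5, 3, prescribes which of \<open>a\<close>, \<open>b\<close>, \<open>c\<close>
  vanish modulo \<open>p\<close>. Column 3 comes last because a nonzero \<open>b\<close> also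
  contributes \<open>N b^2\<close> to the fifth coordinate, which by then meets a zero
  column.\<close>

lemma choose5:
  fixes k :: "5 \<Rightarrow> 5 \<Rightarrow> int" and d :: int
  assumes d: "d \<noteq> 0" and nz: "\<And>p. prime p \<Longrightarrow> p dvd d \<Longrightarrow> \<exists>i j. \<not> p dvd k i j"
  shows "\<exists>a b c. \<forall>p. prime p \<longrightarrow> p dvd d \<longrightarrow>
    (\<exists>i. \<not> p dvd k i 1 + k i 2 * a + k i 3 * b + k i 4 * c + k i 5 * (int N * b\<^sup>2 - a * c))"
proof -
  define z where "z j p \<longleftrightarrow> (\<forall>i. p dvd k i j)" for j p
  let ?F = "prime_factors d"
  define T1 where "T1 = {p \<in> ?F. \<not> z 1 p}"
  define T2 where "T2 = {p \<in> ?F. z 1 p \<and> \<not> z 2 p}"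
  define T4 where "T4 = {p \<in> ?F. z 1 p \<and> z 2 p \<and> \<not> z 4 p}"
  define T5 where "T5 = {p \<in> ?F. z 1 p \<and> z 2 p \<and> z 4 p \<and> \<not> z 5 p}"
  define T3 where "T3 = {p \<in> ?F. z 1 p \<and> z 2 p \<and> z 4 p \<and> z 5 p}"
  note Ts = T1_def T2_def T3_def T4_def T5_def
  define a where "a = \<Prod>(T1 \<union> T4 \<union> T3)"
  define b where "b = \<Prod>(T1 \<union> T2 \<union> T4 \<union> T5)"
  define c where "c = \<Prod>(T1 \<union> T2 \<union> T3)"
  have pa: "p dvd a \<longleftrightarrow> p \<in> T1 \<union> T4 \<union> T3" if "prime p" for p
    unfolding a_def by (rule prime_dvd_prod_primes[OF _ _ that]) (auto simp: Ts)
  have pb: "p dvd b \<longleftrightarrow> p \<in> T1 \<union> T2 \<union> T4 \<union> T5" if "prime p" for p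
    unfolding b_def by (rule prime_dvd_prod_primes[OF _ _ that]) (auto simp: Ts)
  have pc: "p dvd c \<longleftrightarrow> p \<in> T1 \<union> T2 \<union> T3" if "prime p" for p
    unfolding c_def by (rule prime_dvd_prod_primes[OF _ _ that]) (auto simp: Ts)
  have "\<exists>i. \<not> p dvd k i 1 + k i 2 * a + k i 3 * b + k i 4 * c + k i 5 * (int N * b\<^sup>2 - a * c)"
    if p: "prime p" "p dvd d" for p
  proof (rule ccontr)
    assume "\<nexists>i. \<not> p dvd k i 1 + k i 2 * a + k i 3 * b + k i 4 * c + k i 5 * (int N * b\<^sup>2 - a * c)"
    then have h: "p dvd k i 1 + k i 2 * a + k i 3 * b + k i 4 * c + k i 5 * (int N * b\<^sup>2 - a * c)" for i by blast
    have pf: "p \<in> ?F" using p d by (simp add: in_prime_factors_iff)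
    have strip: "p dvd y" if "p dvd y + r" "p dvd r" for y r using that dvd_add_left_iff by blast
    consider "p \<in> T1" | "p \<in> T2" | "p \<in> T4" | "p \<in> T5" | "p \<in> T3" using pf by (auto simp: Ts)
    then show False
    proof cases
      case 1
      then have abc: "p dvd a" "p dvd b" "p dvd c" using pa pb pc p by auto
      have "p dvd k i 1" for i
        by (rule strip[of _ "k i 2 * a + k i 3 * b + k i 4 * c + k i 5 * (int N * b\<^sup>2 - a * c)"])
          (use h[of i] abc in \<open>simp_all add: algebra_simps power2_eq_square\<close>)
      then show False using 1 by (auto simp: T1_def z_def)
    next
      case 2
      then have abc: "\<not> p dvd a" "p dvd b" "p dvd c" using pa[OF p(1)] pb[OF p(1)] pc[OF p(1)] by (auto simp: Ts)
      have "p dvd k i 2" for i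
      proof -
        have kk: "p dvd k i 1" using 2 by (auto simp: T2_def z_def)
        have "p dvd k i 2 * a"
          by (rule strip[of _ "k i 1 + k i 3 * b + k i 4 * c + k i 5 * (int N * b\<^sup>2 - a * c)"])
            (use h[of i] abc kk in \<open>simp_all add: algebra_simps power2_eq_square\<close>)
        then show ?thesis using abc p by (simp add: prime_dvd_mult_iff)
      qed
      then show False using 2 by (auto simp: T2_def z_def)
    next
      case 3
      then have abc: "p dvd a" "p dvd b" "\<not> p dvd c" using pa[OF p(1)] pb[OF p(1)] pc[OF p(1)] by (auto simp: Ts)
      have "p dvd k i 4" for i
      proof -
        have kk: "p dvd k i 1" using 3 by (auto simp: T4_def z_def)
        have "p dvd k i 4 * c"
          by (rule strip[of _ "k i 1 + k i 2 * a + k i 3 * b + k i 5 * (int N * b\<^sup>2 - a * c)"])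
            (use h[of i] abc kk in \<open>simp_all add: algebra_simps power2_eq_square\<close>)
        then show ?thesis using abc p by (simp add: prime_dvd_mult_iff)
      qed
      then show False using 3 by (auto simp: T4_def z_def)
    next
      case 4
      then have abc: "\<not> p dvd a" "p dvd b" "\<not> p dvd c" using pa[OF p(1)] pb[OF p(1)] pc[OF p(1)] by (auto simp: Ts)
      have "p dvd k i 5" for i
      proof -
        have kk: "p dvd k i 1" "p dvd k i 2" "p dvd k i 4" using 4 by (auto simp: T5_def z_def)
        have "p dvd - (k i 5 * a * c)"
          by (rule strip[of _ "k i 1 + k i 2 * a + k i 3 * b + k i 4 * c + k i 5 * (int N * b\<^sup>2)"])
            (use h[of i] abc kk in \<open>simp_all add: algebra_simps power2_eq_square\<close>)
        then show ?thesis using abc p by (simp add: prime_dvd_mult_iff)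
      qed
      then show False using 4 by (auto simp: T5_def z_def)
    next
      case 5
      then have abc: "p dvd a" "\<not> p dvd b" "p dvd c" using pa[OF p(1)] pb[OF p(1)] pc[OF p(1)] by (auto simp: Ts)
      have kk: "p dvd k i 1" "p dvd k i 2" "p dvd k i 4" "p dvd k i 5" for i using 5 by (auto simp: T3_def z_def)
      have k3: "p dvd k i 3" for i
      proof -
        have "p dvd k i 3 * b"
          by (rule strip[of _ "k i 1 + k i 2 * a + k i 4 * c + k i 5 * (int N * b\<^sup>2 - a * c)"])
            (use h[of i] kk[of i] in \<open>simp_all add: algebra_simps power2_eq_square\<close>)
        then show ?thesis using abc p by (simp add: prime_dvd_mult_iff)
      qed
      obtain i j where "\<not> p dvd k i j" using nz p by blast
      then show False using kk k3 exhaust_5[of j] by auto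
    qed
  qed
  then show ?thesis by blast
qed

text \<open>One step of the Cartan decomposition, which leaves a ternary isometry as middle block.
  That \<open>d\<close> still clears the denominators of the block is recorded for the comparison
  with its own least denominator.\<close>

lemma reduce5:
  assumes N: "squarefree N" "N > 0" and h: "h \<in> mats_over \<rat>" "quad_subst (S_hat_mat N) h = S_hat_mat N"
  shows "\<exists>u\<in>SO0_int (S_hat_mat N). \<exists>v\<in>SO0_int (S_hat_mat N). \<exists>d::nat. \<exists>s\<in>{1,-1}. \<exists>g. d > 0 \<and>
    h = u ** emb5 (s / real d) g (s * real d) ** v \<and> quad_subst (S_mat N) g = S_mat N \<and> real d *\<^sub>R g \<in> mats_over \<int>"
proof -
  let ?U = "SO0_int (S_hat_mat N)"
  obtain d :: nat and k :: "5 \<Rightarrow> 5 \<Rightarrow> int" where d: "d > 0" and k: "\<And>i j. real d * h $ i $ j = of_int (k i j)"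
    and kp: "\<And>p. prime p \<Longrightarrow> p dvd int d \<Longrightarrow> \<exists>i j. \<not> p dvd k i j"
    using minimal_denominator[OF h(1)] by metis
  obtain a b c where abc: "\<And>p. prime p \<Longrightarrow> p dvd int d \<Longrightarrow>
      \<exists>i. \<not> p dvd k i 1 + k i 2 * a + k i 3 * b + k i 4 * c + k i 5 * (int N * b\<^sup>2 - a * c)"
    using choose5[of "int d" k N] kp d by auto
  define w where "w i = k i 1 + k i 2 * a + k i 3 * b + k i 4 * c + k i 5 * (int N * b\<^sup>2 - a * c)" for i
  \<comment> \<open>The test vector is by construction a column of an integral group element, so
    transitivity is needed only for its image.\<close>
  define u where "u = lower5 N (of_int a) (of_int b) (of_int c)"
  have u: "u \<in> ?U" unfolding u_def by (rule lower5_int[OF N(2)])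
  define X where "X = column 1 u"
  have Xe: "X$1 = 1" "X$2 = of_int a" "X$3 = of_int b" "X$4 = of_int c" "X$5 = of_int (int N * b\<^sup>2 - a * c)"
    by (simp_all add: X_def u_def lower5_def column_def)
  have wh: "of_int (w i) = real d * (h *v X) $ i" for i
    unfolding w_def by (simp add: k[symmetric] matrix_vector_mult_def sum_5 Xe algebra_simps)
  have wX: "(\<chi> i. of_int (w i)) = real d *\<^sub>R (h *v X)" by (simp add: vec_eq_iff wh)
  have qq: "(h *v X)$1 * (h *v X)$5 + (h *v X)$2 * (h *v X)$4 - real N * ((h *v X)$3)\<^sup>2 = X$1 * X$5 + X$2 * X$4 - real N * (X$3)\<^sup>2"
    using quad_form_subst[of h X "S_hat_mat N"] unfolding h(2) quad_form_S_hat by simp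
  have "of_int (w 1 * w 5 + w 2 * w 4 - int N * (w 3)\<^sup>2)
      = (real d)\<^sup>2 * ((h *v X)$1 * (h *v X)$5 + (h *v X)$2 * (h *v X)$4 - real N * ((h *v X)$3)\<^sup>2)"
    by (simp add: wh power2_eq_square algebra_simps)
  then have "of_int (w 1 * w 5 + w 2 * w 4 - int N * (w 3)\<^sup>2) = (0 :: real)" unfolding qq Xe by simp
  then have wiso: "w 1 * w 5 + w 2 * w 4 = int N * (w 3)\<^sup>2" by (simp only: of_int_eq_0_iff right_minus_eq)
  have wprim: "\<exists>i. \<not> p dvd w i" if p: "prime p" for p
  proof (rule ccontr)
    assume "\<nexists>i. \<not> p dvd w i"
    then have pwi: "p dvd w i" for i by blast
    show False
    proof (cases "p dvd int d")
      case True then show False using abc[OF p True] pwi by (auto simp: w_def)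
    next
      case False
      have dh: "det h = 1 \<or> det h = -1" using det_quad_subst[OF h(2) det_S_hat[OF N(2)]] .
      define xx :: "5 \<Rightarrow> int" where "xx j = (if j = 1 then 1 else if j = 2 then a else if j = 3 then b else if j = 4 then c else int N * b\<^sup>2 - a * c)" for j
      have "\<forall>i. \<exists>c. w i = p * c" using pwi by (auto elim: dvdE)
      then obtain c where c: "\<And>i. w i = p * c i" by metis
      have "(\<Sum>j\<in>UNIV. k i j * xx j) = p * c i" for i
        unfolding c[symmetric] w_def by (simp add: sum_5 xx_def)
      then have "p dvd xx j" for j by (rule dvd_image_dvd[OF k dh p False])
      from this[of 1] show False using prime_gt_1_int[OF p] by (simp add: xx_def)
    qed
  qed
  obtain v t where v: "v \<in> ?U" "t \<in> {1, -1}" "column 1 v = t *\<^sub>R (real d *\<^sub>R (h *v X))"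
    using orbit5[OF N wiso wprim] unfolding wX by blast
  obtain u' where u': "u' \<in> ?U" "u ** u' = mat 1" "u' ** u = mat 1" using SO0_int_inverse[OF u] by blast
  obtain v' where v': "v' \<in> ?U" "v ** v' = mat 1" "v' ** v = mat 1" using SO0_int_inverse[OF v(1)] by blast
  define G where "G = v' ** h ** u"
  have qS: "quad_subst (S_hat_mat N) M = S_hat_mat N" if "M \<in> ?U" for M
    using that SO0_SO by (auto simp: SO0_int_def SO_def)
  have gq: "quad_subst (S_hat_mat N) G = S_hat_mat N"
    unfolding G_def quad_subst_mult qS[OF v'(1)] h(2) qS[OF u] ..
  have hX: "h *v X = (t / real d) *\<^sub>R column 1 v"
    unfolding v(3) using v(2) d by auto
  have "column 1 G = v' *v (h *v column 1 u)" unfolding G_def column_mult by (simp add: matrix_vector_mul_assoc)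
  also have "\<dots> = (t / real d) *\<^sub>R (v' *v column 1 v)"
    unfolding X_def[symmetric] hX by (simp add: matrix_vector_mult_scaleR)
  also have "v' *v column 1 v = column 1 (mat 1)" using v'(3) by (simp flip: column_mult)
  finally have g1: "column 1 G = (t / real d) *\<^sub>R column 1 (mat 1)" .
  have g11: "G $ 1 $ 1 = t / real d" "G $ 2 $ 1 = 0" "G $ 3 $ 1 = 0" "G $ 4 $ 1 = 0" "G $ 5 $ 1 = 0"
    using g1 by (simp_all add: vec_eq_iff forall_5 column_def mat_def)
  have tt: "t \<in> \<int>" using v(2) by auto
  have ee: "G$1$i * G$5$j + G$5$i * G$1$j + G$2$i * G$4$j + G$4$i * G$2$j - 2 * real N * G$3$i * G$3$j = S_hat_mat N $ i $ j" for i j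
    using quad_subst_S_hat[of N G i j] gq by simp
  have g5: "G $ 5 $ 2 = 0" "G $ 5 $ 3 = 0" "G $ 5 $ 4 = 0"
    using ee[of 1 2] ee[of 1 3] ee[of 1 4] v(2) d unfolding g11 S_hat_entries by auto
  have g55: "G $ 5 $ 5 = t * real d"
    using ee[of 1 5] v(2) d unfolding g11 S_hat_entries by (auto simp: field_simps)
  define g :: "real^3^3" where "g = vector [vector [G$2$2, G$2$3, G$2$4], vector [G$3$2, G$3$3, G$3$4], vector [G$4$2, G$4$3, G$4$4]]"
  have gq3: "quad_subst (S_mat N) g = S_mat N"
    unfolding vec_eq_iff forall_3 quad_subst_S_mat S_mat_entries
    using ee[of 2 2] ee[of 2 3] ee[of 2 4] ee[of 3 2] ee[of 3 3] ee[of 3 4] ee[of 4 2] ee[of 4 3] ee[of 4 4]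
    unfolding g5 S_hat_entries by (simp add: g_def mult_ac)
  have dG: "real d *\<^sub>R G \<in> mats_over \<int>"
  proof -
    have "real d *\<^sub>R h \<in> mats_over \<int>" using k by (simp add: mats_over_def)
    moreover have "real d *\<^sub>R G = v' ** (real d *\<^sub>R h) ** u" by (simp add: G_def mat_scaleR_mult)
    ultimately show ?thesis using v'(1) u by (auto simp: SO0_int_def intro!: mats_Ints_mult)
  qed
  then have dGi: "real d * G $ i $ j \<in> \<int>" for i j by (simp add: mats_over_def)
  have dg: "real d *\<^sub>R g \<in> mats_over \<int>" using dGi by (simp add: mats_over_def forall_3 g_def)
  define z1 where "z1 = G $ 2 $ 5"
  define z2 where "z2 = G $ 3 $ 5"
  define z3 where "z3 = G $ 4 $ 5"
  note zd = z1_def[symmetric] z2_def[symmetric] z3_def[symmetric]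
  \<comment> \<open>Read off from the first row of the intended factorisation
    \<open>emb5 (t / d) g (t * d) ** upper5 N y1 y2 y3\<close>, which is \<open>t / d\<close> times
    \<open>(1, - y3, 2 N y2, - y1, N y2^2 - y1 y3)\<close>, using \<open>t^2 = 1\<close>.\<close>
  define y1 where "y1 = - (real d * G$1$4 * t)"
  define y2 where "y2 = real d * G$1$3 * t / (2 * real N)"
  define y3 where "y3 = - (real d * G$1$2 * t)"
  have Nr: "real N \<noteq> 0" using N(2) by simp
  \<comment> \<open>\<open>(y1, y2, y3)\<close> is the preimage of \<open>(z1, z2, z3)\<close> under \<open>g\<close>, namely the vector with \<open>S y = g' S z\<close>.\<close>
  have y: "y3 = G$2$2 * z3 + G$4$2 * z1 - 2 * real N * G$3$2 * z2"
      "- 2 * real N * y2 = G$2$3 * z3 + G$4$3 * z1 - 2 * real N * G$3$3 * z2"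
      "y1 = G$2$4 * z3 + G$4$4 * z1 - 2 * real N * G$3$4 * z2"
    using ee[of 2 5] ee[of 3 5] ee[of 4 5] Nr unfolding g5 g55 S_hat_entries zd
    by (simp_all add: y1_def y2_def y3_def algebra_simps)
  have inv3: "\<exists>L. L ** g = mat 1 \<and> g ** L = mat 1"
  proof -
    have "det g \<noteq> 0" using det_quad_subst[OF gq3 det_S_mat[OF N(2)]] by auto
    then have "invertible g" by (simp add: invertible_det_nz)
    then show ?thesis by (auto simp: invertible_def)
  qed
  define z :: "real^3" where "z = vector [z1, z2, z3]"
  define y' :: "real^3" where "y' = vector [y1, y2, y3]"
  have gy: "g *v y' = z"
  proof -
    obtain L where L: "L ** g = mat 1" "g ** L = mat 1" using inv3 by blast
    have "S_mat N *v y' = transpose g *v (S_mat N *v z)"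
      using y by (simp add: vec_eq_iff forall_3 y'_def z_def g_def S_mat_def matrix_vector_mult_def transpose_def sum_3 vector_matrix_mult_def algebra_simps)
    also have "\<dots> = transpose g ** S_mat N *v (g *v (L *v z))"
      using L(2) by (simp add: matrix_vector_mul_assoc matrix_mul_assoc)
    also have "\<dots> = quad_subst (S_mat N) g *v (L *v z)" by (simp only: quad_subst_def matrix_vector_mul_assoc matrix_mul_assoc)
    finally have "S_mat N *v y' = S_mat N *v (L *v z)" unfolding gq3 .
    moreover obtain T where "T ** S_mat N = mat 1"
      using det_S_mat[OF N(2)] by (auto simp: invertible_det_nz[symmetric] invertible_def)
    ultimately have "y' = L *v z" by (metis matrix_vector_mul_assoc matrix_vector_mul_lid)
    then show ?thesis using L(2) by (simp add: matrix_vector_mul_assoc)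
  qed
  have e15: "G$1$5 * (t * real d) = real N * z2\<^sup>2 - z1 * z3"
    using ee[of 5 5] unfolding g55 S_hat_entries zd by (simp add: power2_eq_square mult_ac)
  have qy: "y1 * y3 - real N * y2\<^sup>2 = z1 * z3 - real N * z2\<^sup>2"
    using quad_form_subst[of g y' "S_mat N"] unfolding gq3 gy quad_form_S_mat by (simp add: z_def y'_def)
  have yi: "y1 \<in> \<int>" "y3 \<in> \<int>" using dGi tt by (auto simp: y1_def y3_def intro!: Ints_mult)
  \<comment> \<open>The first row of \<open>d G\<close> shows directly only that
    \<open>2 N y2\<close> is an integer; its last entry together with \<open>qy\<close> shows that
    \<open>N y2^2\<close> is one, and squarefreeness does the rest.\<close>
  have y2i: "y2 \<in> \<int>"
  proof (rule squarefree_Rats_Ints[OF N(1)])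
    have "real d * G $ 1 $ 3 \<in> \<rat>" "t \<in> \<rat>" using dGi[of 1 3] tt Ints_subset_Rats by auto
    from Rats_mult[OF this] show "y2 \<in> \<rat>" unfolding y2_def by (rule Rats_divide) auto
    have "real N * y2\<^sup>2 = y1 * y3 + (real d * G$1$5) * t" using qy e15 by (simp add: algebra_simps)
    also have "\<dots> \<in> \<int>" by (intro Ints_add[OF Ints_mult[OF yi] Ints_mult[OF dGi tt]])
    finally show "real N * y2\<^sup>2 \<in> \<int>" .
  qed
  obtain m1 m2 m3 where m: "y1 = of_int m1" "y2 = of_int m2" "y3 = of_int m3" 
    using Ints_cases[OF yi(1)] Ints_cases[OF y2i] Ints_cases[OF yi(2)] by metis
  have gz: "z1 = G$2$2 * y1 + G$2$3 * y2 + G$2$4 * y3" "z2 = G$3$2 * y1 + G$3$3 * y2 + G$3$4 * y3" "z3 = G$4$2 * y1 + G$4$3 * y2 + G$4$4 * y3"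
    using gy by (simp_all add: vec_eq_iff forall_3 y'_def z_def g_def matrix_vector_mult_def sum_3)
  have r1: "G$1$2 = t / real d * (- y3)" "G$1$3 = t / real d * (2 * real N * y2)" "G$1$4 = t / real d * (- y1)"
      "G$1$5 = t / real d * (real N * y2\<^sup>2 - y1 * y3)"
  proof -
    show "G$1$2 = t / real d * (- y3)" "G$1$4 = t / real d * (- y1)" using v(2) d by (auto simp: y1_def y3_def)
    show "G$1$3 = t / real d * (2 * real N * y2)" using v(2) d Nr by (auto simp: y2_def)
    have "real N * y2\<^sup>2 - y1 * y3 = G$1$5 * (t * real d)" using qy e15 by simp
    then show "G$1$5 = t / real d * (real N * y2\<^sup>2 - y1 * y3)" using v(2) d by auto
  qed
  have Gd: "G = emb5 (t / real d) g (t * real d) ** upper5 N y1 y2 y3"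
    unfolding emb5_def upper5_def g_def
    using g11 g5 g55 r1 gz
    by (simp add: vec_eq_iff forall_5 matrix_matrix_mult_def sum_5 zd)
  have um: "upper5 N y1 y2 y3 \<in> ?U" unfolding m by (rule upper5_int[OF N(2)])
  have "h = v ** G ** u'"
  proof -
    have "v ** G ** u' = (v ** v') ** h ** (u ** u')" unfolding G_def by (simp only: matrix_mul_assoc)
    then show ?thesis using v'(2) u'(2) by simp
  qed
  also have "\<dots> = v ** emb5 (t / real d) g (t * real d) ** (upper5 N y1 y2 y3 ** u')"
    unfolding Gd by (simp only: matrix_mul_assoc)
  finally show ?thesis using v(1,2) SO0_int_mult[OF um u'(1)] d gq3 dg by blast
qed

section \<open>Cartan decompositions and the theorem\<close>

text \<open>The group axioms, the finiteness of coset numbers and the intersections of the groups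
  \<open>prim S Q\<close> hold for every \<open>S\<close>. What depends on the form is the Cartan
  decomposition with its uniqueness, the Weyl elements and the splitting into prime parts, which are
  the hypotheses here.\<close>

lemma hecke_structure:
  fixes S :: "real^'n^'n"
  assumes T: "T \<subseteq> SO0 S \<inter> mats_over \<rat>"
    and rep: "\<And>g. g \<in> SO0 S \<inter> mats_over \<rat> \<Longrightarrow> \<exists>t\<in>T. \<exists>u\<in>SO0_int S. \<exists>v\<in>SO0_int S. g = u ** t ** v"
    and uniq: "\<And>s t u v. s \<in> T \<Longrightarrow> t \<in> T \<Longrightarrow> u \<in> SO0_int S \<Longrightarrow> v \<in> SO0_int S \<Longrightarrow> s = u ** t ** v \<Longrightarrow> s = t"
    and Tinv: "\<And>t. t \<in> T \<Longrightarrow> \<exists>u\<in>SO0_int S. \<exists>v\<in>SO0_int S. (u ** t ** v) ** t = mat 1"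
    and split: "\<And>P Q t. P \<inter> Q = {} \<Longrightarrow> P \<subseteq> {p. prime p} \<Longrightarrow> Q \<subseteq> {p. prime p} \<Longrightarrow> t \<in> T \<Longrightarrow> t \<in> prim S (P \<union> Q) \<Longrightarrow>
       \<exists>t1\<in>T \<inter> prim S P. \<exists>t2\<in>T \<inter> prim S Q. t = t1 ** t2"
  shows "hecke_pair (SO0_int S) (SO0_rat S) \<and> cring (hecke_algebra (SO0_int S) (SO0_rat S)) \<and>
    coincides_with_tensor_product (hecke_algebra (SO0_int S) (SO0_rat S)) {p. prime p}
      (\<lambda>p. hecke_algebra (SO0_int S) (SO0_primary S p))"
proof -
  have c: "carrier (SO0_rat S) = SO0 S \<inter> mats_over \<rat>" by (simp add: SO0_rat_def matrix_group_simps)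
  have h: "hecke (SO0_rat S) (SO0_int S)"
    unfolding hecke_def hecke_axioms_def using group_SO0_rat[of S] subgroup_SO0_int[of S] finite_cosets[of _ S] by (simp add: c)
  interpret hecke_torus "SO0_rat S" "SO0_int S" T "prim S" "{p. prime p}"
  proof (rule hecke_torus.intro[OF h], rule hecke_torus_axioms.intro)
    show "T \<subseteq> carrier (SO0_rat S)" using T by (simp add: c)
    show "\<exists>t\<in>T. g \<in> double_coset (SO0_rat S) (SO0_int S) t" if "g \<in> carrier (SO0_rat S)" for g
      using rep that unfolding c mem_double_coset_matrix by blast
    show "s = t" if "s \<in> T" "t \<in> T" "s \<in> double_coset (SO0_rat S) (SO0_int S) t" for s t
      using uniq that unfolding mem_double_coset_matrix by blast
    show "inv\<^bsub>SO0_rat S\<^esub> t \<in> double_coset (SO0_rat S) (SO0_int S) t" if t: "t \<in> T" for t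
    proof -
      obtain u v where uv: "u \<in> SO0_int S" "v \<in> SO0_int S" "(u ** t ** v) ** t = mat 1" using Tinv[OF t] by blast
      have "u ** t ** v \<in> SO0 S \<inter> mats_over \<rat>"
      proof -
        have "t \<in> SO0 S" "t \<in> mats_over \<rat>" "u \<in> SO0 S" "u \<in> mats_over \<int>" "v \<in> SO0 S" "v \<in> mats_over \<int>"
          using uv(1,2) T t by (auto simp: SO0_int_def)
        then show ?thesis by (simp add: SO0_mult mats_Rats_mult mats_Ints_Rats)
      qed
      then have "inv\<^bsub>SO0_rat S\<^esub> t = u ** t ** v" using uv T t by (intro inv_SO0_rat) auto
      then show ?thesis unfolding mem_double_coset_matrix using uv by blast
    qed
    show "subgroup (prim S Q) (SO0_rat S)" if "Q \<subseteq> {p. prime p}" for Q by (rule subgroup_prim[OF that])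
    show "prim S P \<inter> prim S Q = SO0_int S" if "P \<subseteq> {p. prime p}" "Q \<subseteq> {p. prime p}" "P \<inter> Q = {}" for P Q
      by (rule prim_disjoint[OF that])
    show "prim S P \<subseteq> prim S Q" if "P \<subseteq> Q" for P Q by (rule prim_mono[OF that])
    show "\<exists>Q. finite Q \<and> Q \<subseteq> {p. prime p} \<and> g \<in> prim S Q" if "g \<in> carrier (SO0_rat S)" for g
      using prim_exhaust that by (simp add: c)
    show "\<exists>t1\<in>T \<inter> prim S P. \<exists>t2\<in>T \<inter> prim S Q. t = t1 \<otimes>\<^bsub>SO0_rat S\<^esub> t2"
      if "P \<subseteq> {p. prime p}" "Q \<subseteq> {p. prime p}" "P \<inter> Q = {}" "t \<in> T" "t \<in> prim S (P \<union> Q)" for P Q t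
      using split[OF that(3,1,2,4,5)] by (simp add: SO0_rat_def matrix_group_simps)
  qed
  have "hecke_pair (SO0_int S) (SO0_rat S)"
    unfolding hecke_pair_def using group_SO0_rat[of S] subgroup_SO0_int[of S] finite_cosets[of _ S] by (simp add: c)
  moreover have "(SO0_rat S)\<lparr>carrier := prim S {p}\<rparr> = SO0_primary S p" for p
    unfolding prim_single[symmetric] by (simp add: SO0_rat_def matrix_group_def)
  ultimately show ?thesis using cring_hecke coincides_with_tensor by simp
qed

section \<open>Sign conditions on the identity component\<close>

lemma SO0_positive:
  assumes c: "continuous_on (SO0 S) \<phi>" and nz: "\<And>K. K \<in> SO S \<Longrightarrow> \<phi> K \<noteq> (0::real)" and one: "\<phi> (mat 1) > 0" and K: "K \<in> SO0 S"
  shows "\<phi> K > 0"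
proof (rule ccontr)
  assume "\<not> \<phi> K > 0"
  then have le: "\<phi> K \<le> 0" by simp
  have "connected (\<phi> ` SO0 S)" by (rule connected_continuous_image[OF c connected_SO0])
  then have "0 \<in> \<phi> ` SO0 S"
    by (rule connectedD_interval[of _ "\<phi> K" "\<phi> (mat 1)"]) (use K one_SO0 le one in auto)
  then show False using nz SO0_SO by fastforce
qed

text \<open>The expression is the sum of the first and third coordinates of \<open>K\<close> applied
  to e1 + e3. That vector keeps its positive norm, so these two coordinates have a positive product
  and cannot cancel.\<close>

lemma SO0_S_mat_positive:
  assumes N: "N > 0" and K: "K \<in> SO0 (S_mat N)"
  shows "K$1$1 + K$1$3 + K$3$1 + K$3$3 > 0"
proof (rule SO0_positive[OF _ _ _ K])
  show "continuous_on (SO0 (S_mat N)) (\<lambda>K. K$1$1 + K$1$3 + K$3$1 + K$3$3)" by (intro continuous_intros)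
  show "(mat 1 :: real^3^3)$1$1 + (mat 1 :: real^3^3)$1$3 + (mat 1 :: real^3^3)$3$1 + (mat 1 :: real^3^3)$3$3 > 0" by (simp add: mat_def)
  fix K assume K: "K \<in> SO (S_mat N)"
  let ?e = "vector [1, 0, 1] :: real^3"
  define x where "x = K *v ?e"
  have "x$1 * x$3 - real N * (x$2)\<^sup>2 = 1"
    using quad_form_subst[of K ?e "S_mat N"] K unfolding x_def SO_def quad_form_S_mat by (simp add: quad_form_S_mat)
  then have p: "x$1 * x$3 = 1 + real N * (x$2)\<^sup>2" by simp
  have "x$1 + x$3 \<noteq> 0"
  proof
    assume "x$1 + x$3 = 0"
    then have "x$3 = - x$1" by simp
    then have "x$1 * x$3 \<le> 0" by simp
    moreover have "1 + real N * (x$2)\<^sup>2 > 0" by (simp add: add_pos_nonneg)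
    ultimately show False using p by simp
  qed
  then show "K$1$1 + K$1$3 + K$3$1 + K$3$3 \<noteq> 0"
    by (simp add: x_def matrix_vector_mult_def sum_3)
qed

text \<open>The determinant of the scalar products of \<open>K (e1 + e5)\<close> and
  \<open>K (e2 + e4)\<close> with e1 + e5 and e2 + e4. Its sign tells whether \<open>K\<close>
  preserves the orientation of positive definite planes.\<close>

lemma SO0_S_hat_positive:
  assumes N: "N > 0" and K: "K \<in> SO0 (S_hat_mat N)"
  shows "(K$1$1 + K$1$5 + K$5$1 + K$5$5) * (K$2$2 + K$2$4 + K$4$2 + K$4$4)
    - (K$1$2 + K$1$4 + K$5$2 + K$5$4) * (K$2$1 + K$2$5 + K$4$1 + K$4$5) > 0"
proof (rule SO0_positive[OF _ _ _ K])
  let ?f = "\<lambda>K::real^5^5. (K$1$1 + K$1$5 + K$5$1 + K$5$5) * (K$2$2 + K$2$4 + K$4$2 + K$4$4)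
    - (K$1$2 + K$1$4 + K$5$2 + K$5$4) * (K$2$1 + K$2$5 + K$4$1 + K$4$5)"
  show "continuous_on (SO0 (S_hat_mat N)) ?f" by (intro continuous_intros)
  show "?f (mat 1) > 0" by (simp add: mat_def)
  fix K assume K: "K \<in> SO (S_hat_mat N)"
  define a where "a = K$1$1 + K$1$5 + K$5$1 + K$5$5"
  define b where "b = K$1$2 + K$1$4 + K$5$2 + K$5$4"
  define c where "c = K$2$1 + K$2$5 + K$4$1 + K$4$5"
  define e where "e = K$2$2 + K$2$4 + K$4$2 + K$4$4"
  \<comment> \<open>The plane spanned by \<open>e1 + e5\<close> and \<open>e2 + e4\<close> is positive definite, its orthogonal complement negative definite.\<close>
  have key: "l = 0 \<and> m = 0" if h: "l * a + m * b = 0" "l * c + m * e = 0" for l m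
  proof -
    let ?w = "vector [l, m, 0, m, l] :: real^5"
    define z where "z = K *v ?w"
    have "z$1 * z$5 + z$2 * z$4 - real N * (z$3)\<^sup>2 = l\<^sup>2 + m\<^sup>2"
      using quad_form_subst[of K ?w "S_hat_mat N"] K unfolding z_def SO_def quad_form_S_hat
      by (simp add: quad_form_S_hat power2_eq_square)
    moreover have "z$5 = - z$1" "z$4 = - z$2"
      using h by (simp_all add: z_def matrix_vector_mult_def sum_5 a_def b_def c_def e_def algebra_simps)
    ultimately have "l\<^sup>2 + m\<^sup>2 + (z$1)\<^sup>2 + (z$2)\<^sup>2 + real N * (z$3)\<^sup>2 = 0" by (simp add: power2_eq_square algebra_simps)
    moreover have "l\<^sup>2 \<ge> 0" "m\<^sup>2 \<ge> 0" "(z$1)\<^sup>2 \<ge> 0" "(z$2)\<^sup>2 \<ge> 0" "real N * (z$3)\<^sup>2 \<ge> 0" by auto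
    ultimately have "l\<^sup>2 = 0" "m\<^sup>2 = 0" by linarith+
    then show ?thesis by simp
  qed
  have "a * e - b * c \<noteq> 0"
  proof
    assume d: "a * e - b * c = 0"
    \<comment> \<open>If the determinant vanished, \<open>(b, - a)\<close> and
      \<open>(e, - c)\<close> would solve the system in \<open>key\<close>, so all four entries
      would be 0; but then \<open>(1, 0)\<close> would solve it as well.\<close>
    have "b = 0 \<and> - a = 0" by (rule key) (use d in \<open>simp_all add: algebra_simps\<close>)
    moreover have "e = 0 \<and> - c = 0" by (rule key) (use d in \<open>simp_all add: algebra_simps\<close>)
    ultimately show False using key[of 1 0] by simp
  qed
  then show "?f K \<noteq> 0" unfolding a_def b_def c_def e_def .
qed

lemma SO0_factor:
  assumes "h \<in> SO0 S" "u \<in> SO0_int S" "v \<in> SO0_int S" "h = u ** D ** v"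
  shows "D \<in> SO0 S"
proof -
  obtain u' where u': "u' \<in> SO0_int S" "u' ** u = mat 1" using SO0_int_inverse[OF assms(2)] by blast
  obtain v' where v': "v' \<in> SO0_int S" "v ** v' = mat 1" using SO0_int_inverse[OF assms(3)] by blast
  have "u' ** h ** v' = (u' ** u) ** D ** (v ** v')" unfolding assms(4) by (simp only: matrix_mul_assoc)
  then have "D = u' ** h ** v'" using u' v' by simp
  then show ?thesis using u' v' assms(1) by (auto simp: SO0_int_def intro!: SO0_mult)
qed

text \<open>The determinant of the diagonal factor forces \<open>t = 1\<close>, and its positivity
  on the identity component forces \<open>s = 1\<close>.\<close>

lemma cartan3:
  assumes N: "squarefree N" "N > 0" and h: "h \<in> SO0 (S_mat N) \<inter> mats_over \<rat>"
  shows "\<exists>u\<in>SO0_int (S_mat N). \<exists>v\<in>SO0_int (S_mat N). \<exists>d::nat. d > 0 \<and> h = u ** diag3 (1 / real d) 1 (real d) ** v"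
proof -
  have q: "quad_subst (S_mat N) h = S_mat N" using h SO0_SO by (auto simp: SO_def)
  obtain u v s t and d :: nat where r: "u \<in> SO0_int (S_mat N)" "v \<in> SO0_int (S_mat N)" "s \<in> {1, -1}" "t \<in> {1, -1}" "d > 0"
    "h = u ** diag3 (s / real d) t (s * real d) ** v"
    using reduce3[OF N _ q] h by blast
  have D: "diag3 (s / real d) t (s * real d) \<in> SO0 (S_mat N)" by (rule SO0_factor[OF _ r(1,2,6)]) (use h in simp)
  then have "det (diag3 (s / real d) t (s * real d)) = 1" using SO0_SO by (auto simp: SO_def)
  then have t: "t = 1" using r(3,5) by (auto simp: det_3 diag3_def)
  have "s / real d + s * real d > 0" using SO0_S_mat_positive[OF N(2) D] by (simp add: diag3_def)
  moreover have "1 / real d + real d > 0" using r(5) by (intro add_pos_pos) auto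
  ultimately have "s = 1" using r(3) by auto
  then show ?thesis using r t by auto
qed

lemma diag5_det: "det (diag5 a b c d e) = a * b * c * d * e"
proof -
  have "det (diag5 a b c d e) = (\<Prod>i\<in>UNIV. diag5 a b c d e $ i $ i)"
  proof (rule det_diagonal)
    fix i j :: 5 assume "i \<noteq> j"
    then show "diag5 a b c d e $ i $ j = 0" using exhaust_5[of i] exhaust_5[of j] by (auto simp: diag5_def)
  qed
  also have "\<dots> = a * b * c * d * e" unfolding UNIV_5 by (simp add: diag5_def mult_ac)
  finally show ?thesis .
qed

lemma emb5_diag3: "emb5 a (diag3 b c d) e = diag5 a b c d e"
  by (simp add: emb5_def diag3_def diag5_def)

text \<open>The middle block from \<open>reduce5\<close> is diagonalised by \<open>reduce3\<close>
  and the outer factors are embedded again. Since \<open>d\<close> clears the denominators of that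
  block and \<open>e\<close> is its least denominator, \<open>e\<close> divides
  \<open>d\<close>.\<close>

lemma cartan5:
  assumes N: "squarefree N" "N > 0" and h: "h \<in> SO0 (S_hat_mat N) \<inter> mats_over \<rat>"
  shows "\<exists>u\<in>SO0_int (S_hat_mat N). \<exists>v\<in>SO0_int (S_hat_mat N). \<exists>d e::nat. d > 0 \<and> e > 0 \<and> e dvd d \<and>
    h = u ** diag5 (1 / real d) (1 / real e) 1 (real e) (real d) ** v"
proof -
  let ?U = "SO0_int (S_hat_mat N)"
  have q: "quad_subst (S_hat_mat N) h = S_hat_mat N" using h SO0_SO by (auto simp: SO_def)
  obtain u v s g and d :: nat where r: "u \<in> ?U" "v \<in> ?U" "s \<in> {1, -1}" "d > 0"
    "h = u ** emb5 (s / real d) g (s * real d) ** v" "quad_subst (S_mat N) g = S_mat N" "real d *\<^sub>R g \<in> mats_over \<int>"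
    using reduce5[OF N _ q] h by blast
  have gr: "g \<in> mats_over \<rat>" by (rule mats_Rats_scale_cancel[OF r(4) mats_Ints_Rats[OF r(7)]])
  obtain u3 v3 s3 t and e :: nat where r3: "u3 \<in> SO0_int (S_mat N)" "v3 \<in> SO0_int (S_mat N)" "s3 \<in> {1, -1}" "t \<in> {1, -1}" "e > 0"
    "g = u3 ** diag3 (s3 / real e) t (s3 * real e) ** v3" "\<And>n. n > 0 \<Longrightarrow> real n *\<^sub>R g \<in> mats_over \<int> \<Longrightarrow> e dvd n"
    using reduce3[OF N gr r(6)] by blast
  have ed: "e dvd d" using r3(7) r(4,7) by blast
  let ?D = "diag5 (s / real d) (s3 / real e) t (s3 * real e) (s * real d)"
  have "emb5 (s / real d) g (s * real d) = emb5 1 u3 1 ** ?D ** emb5 1 v3 1"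
    unfolding r3(6) emb5_diag3[symmetric] emb5_mult by simp
  then have hD: "h = (u ** emb5 1 u3 1) ** ?D ** (emb5 1 v3 1 ** v)" unfolding r(5) by (simp only: matrix_mul_assoc)
  have uU: "u ** emb5 1 u3 1 \<in> ?U" by (rule SO0_int_mult[OF r(1) emb5_SO0_int[OF N(2) r3(1)]])
  have vU: "emb5 1 v3 1 ** v \<in> ?U" by (rule SO0_int_mult[OF emb5_SO0_int[OF N(2) r3(2)] r(2)])
  have D: "?D \<in> SO0 (S_hat_mat N)" by (rule SO0_factor[OF _ uU vU hD]) (use h in simp)
  then have "det ?D = 1" using SO0_SO by (auto simp: SO_def)
  then have t: "t = 1" using r(3,4) r3(3,5) unfolding diag5_det by auto
  have "(s / real d + s * real d) * (s3 / real e + s3 * real e) > 0"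
    using SO0_S_hat_positive[OF N(2) D] by (simp add: diag5_def)
  then have "(s * s3) * ((1 / real d + real d) * (1 / real e + real e)) > 0" by (simp add: algebra_simps)
  moreover have "(1 / real d + real d) * (1 / real e + real e) > 0" using r(4) r3(5) by (intro mult_pos_pos add_pos_pos) auto
  ultimately have "s * s3 > 0" using zero_less_mult_pos2 by blast
  then have s3: "s3 = s" using r(3) r3(3) by auto
  show ?thesis
  proof (cases "s = 1")
    case True
    then show ?thesis using hD uU vU r(4) r3(5) ed t s3 by auto
  next
    case False
    then have s: "s = -1" using r(3) by auto
    \<comment> \<open>Positivity only makes the two signs agree. If both are -1 they are absorbed by
      the square of this Weyl element, the diagonal matrix (-1, -1, 1, -1, -1) of the integral
      group.\<close>
    let ?R = "rotA5 (pi / 2)"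
    have "?D = (?R ** ?R) ** diag5 (1 / real d) (1 / real e) 1 (real e) (real d)"
      unfolding s3 s t by (simp add: rotA5_def diag5_def vec_eq_iff forall_5 matrix_matrix_mult_def sum_5)
    then have "h = (u ** emb5 1 u3 1 ** (?R ** ?R)) ** diag5 (1 / real d) (1 / real e) 1 (real e) (real d) ** (emb5 1 v3 1 ** v)"
      using hD by (simp only: matrix_mul_assoc)
    moreover have "u ** emb5 1 u3 1 ** (?R ** ?R) \<in> ?U"
      by (intro SO0_int_mult uU rot5_int N)
    ultimately show ?thesis using vU r(4) r3(5) ed by blast
  qed
qed

section \<open>Invariants separating the diagonal representatives\<close>

lemma denominator_factor:
  assumes "real n *\<^sub>R t \<in> mats_over \<int>" "u \<in> mats_over \<int>" "v \<in> mats_over \<int>"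
  shows "real n *\<^sub>R (u ** t ** v) \<in> mats_over \<int>"
proof -
  have "real n *\<^sub>R (u ** t ** v) = u ** (real n *\<^sub>R t) ** v" by (simp add: mat_scaleR_mult)
  then show ?thesis using assms by (auto intro!: mats_Ints_mult)
qed

text \<open>The analogue for the second exterior power of clearing the denominators of the entries.
  The entries of a diagonal representative yield \<open>d\<close> alone; the minors yield
  \<open>d * e\<close> and hence \<open>e\<close>.\<close>

definition minors_Ints :: "real \<Rightarrow> real^'n^'n \<Rightarrow> bool" where
  "minors_Ints c M \<longleftrightarrow> (\<forall>i j k l. c * (M$i$k * M$j$l - M$i$l * M$j$k) \<in> \<int>)"

text \<open>Cauchy-Binet for 2 x 2 minors, in the form that sums over all ordered pairs of
  intermediate indices, so that no ordering of the index type is required.\<close>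

lemma minors_Ints_mult_left:
  assumes M: "minors_Ints c M" and u: "u \<in> mats_over \<int>"
  shows "minors_Ints c (u ** M)"
  unfolding minors_Ints_def
proof (intro allI)
  fix i j k l
  have "c * ((u ** M)$i$k * (u ** M)$j$l - (u ** M)$i$l * (u ** M)$j$k)
    = (\<Sum>a\<in>UNIV. \<Sum>b\<in>UNIV. u$i$a * u$j$b * (c * (M$a$k * M$b$l - M$a$l * M$b$k)))"
  proof -
    have e: "(u ** M)$i$k * (u ** M)$j$l = (\<Sum>a\<in>UNIV. \<Sum>b\<in>UNIV. u$i$a * u$j$b * (M$a$k * M$b$l))" for i j k l
      unfolding matrix_matrix_mult_def vec_lambda_beta sum_product by (intro sum.cong refl) (simp add: mult_ac)
    show ?thesis unfolding e by (simp add: sum_distrib_left sum_subtractf right_diff_distrib mult_ac)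
  qed
  also have "\<dots> \<in> \<int>" 
  proof (intro Ints_sum)
    fix a b
    have "u$i$a \<in> \<int>" "u$j$b \<in> \<int>" using u unfolding mats_over_def by blast+
    moreover have "c * (M$a$k * M$b$l - M$a$l * M$b$k) \<in> \<int>" using M unfolding minors_Ints_def by blast
    ultimately show "u$i$a * u$j$b * (c * (M$a$k * M$b$l - M$a$l * M$b$k)) \<in> \<int>" by (meson Ints_mult)
  qed
  finally show "c * ((u ** M)$i$k * (u ** M)$j$l - (u ** M)$i$l * (u ** M)$j$k) \<in> \<int>" .
qed

lemma minors_Ints_transpose: "minors_Ints c (transpose M) \<longleftrightarrow> minors_Ints c M"
  unfolding minors_Ints_def by (simp add: transpose_def mult.commute) (metis mult.commute)

lemma minors_Ints_mult_right:
  assumes M: "minors_Ints c M" and v: "v \<in> mats_over \<int>"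
  shows "minors_Ints c (M ** v)"
proof -
  have "transpose v \<in> mats_over \<int>" using v by (simp add: mats_over_def transpose_def)
  then have "minors_Ints c (transpose v ** transpose M)" using M by (intro minors_Ints_mult_left) (simp_all add: minors_Ints_transpose)
  then show ?thesis by (simp only: matrix_transpose_mul[symmetric] minors_Ints_transpose)
qed

lemma nat_dvd_if_Ints: "n > 0 \<Longrightarrow> real m / real n \<in> \<int> \<Longrightarrow> n dvd m"
proof -
  assume n: "n > 0" and "real m / real n \<in> \<int>"
  then obtain z :: int where "real m / real n = of_int z" by (auto elim: Ints_cases)
  then have "of_int (int m) = (of_int (z * int n) :: real)" using n by (simp add: field_simps)
  then have "int m = z * int n" by (simp only: of_int_eq_iff)
  then have "int n dvd int m" by simp
  then show ?thesis by simp
qed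

lemma prime_factors_split:
  assumes "d > 0" "prime_factors (d::nat) \<subseteq> P \<union> Q"
  obtains a b where "d = a * b" "prime_factors a \<subseteq> P" "prime_factors b \<subseteq> Q" "a > 0" "b > 0"
proof -
  let ?A = "filter_mset (\<lambda>p. p \<in> P) (prime_factorization d)" and ?B = "filter_mset (\<lambda>p. p \<notin> P) (prime_factorization d)"
  have "prod_mset ?A * prod_mset ?B = prod_mset (?A + ?B)" by (rule prod_mset.union[symmetric])
  also have "?A + ?B = prime_factorization d" by (rule multiset_partition[symmetric])
  also have "prod_mset \<dots> = d" using assms(1) prod_mset_prime_factorization_nat by blast
  finally have d: "d = prod_mset ?A * prod_mset ?B" by simp
  have "prime_factorization (prod_mset ?A) = ?A" "prime_factorization (prod_mset ?B) = ?B"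
    by (rule prime_factorization_prod_mset_primes; auto)+
  then have "prime_factors (prod_mset ?A) \<subseteq> P" "prime_factors (prod_mset ?B) \<subseteq> Q" using assms(2) by auto
  moreover have "prod_mset ?A > 0" "prod_mset ?B > 0" using d assms(1) by (metis gr0I mult_is_0)+
  ultimately show ?thesis using that d by blast
qed

lemma prime_factors_dvd_subset: "m dvd n \<Longrightarrow> n > 0 \<Longrightarrow> prime_factors (m::nat) \<subseteq> prime_factors n"
  using dvd_prime_factors[of n m] by simp

lemma hecke_S_mat:
  assumes N: "squarefree N" "N > 0"
  shows "hecke_pair (SO0_int (S_mat N)) (SO0_rat (S_mat N)) \<and> cring (hecke_algebra (SO0_int (S_mat N)) (SO0_rat (S_mat N))) \<and>
    coincides_with_tensor_product (hecke_algebra (SO0_int (S_mat N)) (SO0_rat (S_mat N))) {p. prime p}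
      (\<lambda>p. hecke_algebra (SO0_int (S_mat N)) (SO0_primary (S_mat N) p))"
proof -
  define t where "t d = diag3 (1 / real d) 1 (real d)" for d :: nat
  have t_SO0: "t d \<in> SO0 (S_mat N)" if "d > 0" for d
    using diag3_SO0[OF N(2), of "1 / real d"] that by (simp add: t_def)
  have t_int: "real n *\<^sub>R t d \<in> mats_over \<int> \<longleftrightarrow> d dvd n" if "d > 0" for n d
  proof
    assume "real n *\<^sub>R t d \<in> mats_over \<int>"
    then have "(real n *\<^sub>R t d) $ 1 $ 1 \<in> \<int>" unfolding mats_over_def by blast
    then show "d dvd n" using that by (intro nat_dvd_if_Ints) (simp_all add: t_def diag3_def)
  next
    assume "d dvd n"
    then obtain m where "n = d * m" by blast
    then show "real n *\<^sub>R t d \<in> mats_over \<int>" using that by (simp add: mats_over_def t_def diag3_def forall_3)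
  qed
  have t_rat: "t d \<in> mats_over \<rat>" for d by (simp add: mats_over_def t_def diag3_def forall_3)
  have t_prim: "t d \<in> prim (S_mat N) Q \<longleftrightarrow> prime_factors d \<subseteq> Q" if Q: "Q \<subseteq> {p. prime p}" and d: "d > 0" for Q d
  proof
    assume "t d \<in> prim (S_mat N) Q"
    then obtain n where "n > 0" "prime_factors n \<subseteq> Q" "d dvd n" 
      unfolding prim_iff[OF Q] t_int[OF d] by blast
    then show "prime_factors d \<subseteq> Q" using prime_factors_dvd_subset by blast
  next
    assume "prime_factors d \<subseteq> Q"
    then show "t d \<in> prim (S_mat N) Q"
      unfolding prim_iff[OF Q] t_int[OF d] using t_SO0[OF d] d by (intro conjI exI[of _ d]) simp_all
  qed
  show ?thesis
  proof (rule hecke_structure[where T = "t ` {d. d > 0}"])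
    show "t ` {d. d > 0} \<subseteq> SO0 (S_mat N) \<inter> mats_over \<rat>" using t_SO0 t_rat by blast
    show "\<exists>x\<in>t ` {d. d > 0}. \<exists>u\<in>SO0_int (S_mat N). \<exists>v\<in>SO0_int (S_mat N). g = u ** x ** v"
      if "g \<in> SO0 (S_mat N) \<inter> mats_over \<rat>" for g
      using cartan3[OF N that] unfolding t_def by blast
  next
    fix x y u v assume h: "x \<in> t ` {d. d > 0}" "y \<in> t ` {d. d > 0}" "u \<in> SO0_int (S_mat N)" "v \<in> SO0_int (S_mat N)" "x = u ** y ** v"
    obtain d e where d: "d > 0" "x = t d" and e: "e > 0" "y = t e" using h(1,2) by blast
    \<comment> \<open>Only one divisibility comes out of a relation between \<open>t d\<close> and
      \<open>t e\<close>; the other follows from the inverse relation with \<open>u'\<close> and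
      \<open>v'\<close>.\<close>
    have half: "d dvd e" if "d > 0" "e > 0" "t d = u ** t e ** v" "u \<in> SO0_int (S_mat N)" "v \<in> SO0_int (S_mat N)" for d e u v
    proof -
      have "real e *\<^sub>R t d \<in> mats_over \<int>" unfolding that(3)
        by (rule denominator_factor) (use that t_int[of e e] in \<open>auto simp: SO0_int_def\<close>)
      then show ?thesis using t_int that by blast
    qed
    obtain u' v' where uv: "u' \<in> SO0_int (S_mat N)" "u' ** u = mat 1" "v' \<in> SO0_int (S_mat N)" "v ** v' = mat 1"
      using SO0_int_inverse[OF h(3)] SO0_int_inverse[OF h(4)] by metis
    have "u' ** x ** v' = (u' ** u) ** y ** (v ** v')" unfolding h(5) by (simp only: matrix_mul_assoc)
    then have "t e = u' ** t d ** v'" using uv d e by simp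
    then have "e dvd d" using half d e uv by blast
    moreover have "d dvd e" using half[of d e u v] d e h by simp
    ultimately have "d = e" by (simp only: dvd_antisym)
    then show "x = y" using d e by simp
  next
    fix x assume "x \<in> t ` {d. d > 0}"
    then obtain d where d: "d > 0" "x = t d" by blast
    have "rot3 N (pi / 2) ** t d ** rot3 N (- pi / 2) = diag3 (real d) 1 (1 / real d)"
      unfolding t_def by (rule diag3_rot[OF N(2)])
    moreover have "diag3 (real d) 1 (1 / real d) ** t d = mat 1"
      using d by (simp add: t_def diag3_def vec_eq_iff forall_3 matrix_matrix_mult_def sum_3 mat_def)
    moreover have "rot3 N (pi / 2) \<in> SO0_int (S_mat N)" "rot3 N (- pi / 2) \<in> SO0_int (S_mat N)"
      using rot3_SO0[OF N(2)] rot3_int unfolding SO0_int_def by blast+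
    ultimately show "\<exists>u\<in>SO0_int (S_mat N). \<exists>v\<in>SO0_int (S_mat N). (u ** x ** v) ** x = mat 1" using d by metis
  next
    fix P Q x assume h: "P \<inter> Q = {}" "P \<subseteq> {p. prime p}" "Q \<subseteq> {p. prime p}" "x \<in> t ` {d. d > 0}" "x \<in> prim (S_mat N) (P \<union> Q)"
    obtain d where d: "d > 0" "x = t d" using h(4) by blast
    have PQ: "P \<union> Q \<subseteq> {p. prime p}" using h by blast
    have "prime_factors d \<subseteq> P \<union> Q" using t_prim[OF PQ d(1)] h(5) d(2) by simp
    then obtain a b where ab: "d = a * b" "prime_factors a \<subseteq> P" "prime_factors b \<subseteq> Q" "a > 0" "b > 0"
      using prime_factors_split[OF d(1)] by blast
    have "t d = t a ** t b"
      using ab by (simp add: t_def diag3_def vec_eq_iff forall_3 matrix_matrix_mult_def sum_3)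
    moreover have "t a \<in> t ` {d. d > 0} \<inter> prim (S_mat N) P" "t b \<in> t ` {d. d > 0} \<inter> prim (S_mat N) Q"
      using t_prim[OF h(2) ab(4)] t_prim[OF h(3) ab(5)] ab by auto
    ultimately show "\<exists>t1\<in>t ` {d. d > 0} \<inter> prim (S_mat N) P. \<exists>t2\<in>t ` {d. d > 0} \<inter> prim (S_mat N) Q. x = t1 ** t2"
      using d by blast
  qed
qed

lemma diag5_mult: "diag5 a b c d e ** diag5 a' b' c' d' e' = diag5 (a * a') (b * b') (c * c') (d * d') (e * e')"
  by (simp add: diag5_def vec_eq_iff forall_5 matrix_matrix_mult_def sum_5)

lemma diag5_entries: "diag5 a b c d e $ 1 $ 1 = a" "diag5 a b c d e $ 2 $ 2 = b" "diag5 a b c d e $ 3 $ 3 = c"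
   "diag5 a b c d e $ 4 $ 4 = d" "diag5 a b c d e $ 5 $ 5 = e" "i \<noteq> j \<Longrightarrow> diag5 a b c d e $ i $ j = 0"
  using exhaust_5[of i] exhaust_5[of j] by (auto simp: diag5_def)

lemma minors_Ints_diagonal:
  assumes diag: "\<And>i j. i \<noteq> j \<Longrightarrow> M $ i $ j = 0" and "\<And>i j. i \<noteq> j \<Longrightarrow> c * (M $ i $ i * M $ j $ j) \<in> \<int>"
  shows "minors_Ints c M"
  unfolding minors_Ints_def
proof (intro allI)
  fix i j k l
  show "c * (M$i$k * M$j$l - M$i$l * M$j$k) \<in> \<int>"
  proof (cases "i = j \<or> k = l")
    case True then show ?thesis by (auto simp: mult.commute)
  next
    case False
    consider "k = i" "l = j" | "k = j" "l = i" | "M$i$k * M$j$l = 0" "M$i$l * M$j$k = 0"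
      using diag False by (metis mult_eq_0_iff)
    then show ?thesis
    proof cases
      case 1 then show ?thesis using False diag[of i j] assms(2)[of i j] by simp
    next
      case 2
      then have "c * (M$i$k * M$j$l - M$i$l * M$j$k) = - (c * (M $ i $ i * M $ j $ j))"
        using False diag[of i j] by simp
      then show ?thesis using assms(2)[of i j] False by simp
    next
      case 3 show ?thesis unfolding 3 by simp
    qed
  qed
qed

lemma hecke_S_hat_mat:
  assumes N: "squarefree N" "N > 0"
  shows "hecke_pair (SO0_int (S_hat_mat N)) (SO0_rat (S_hat_mat N)) \<and> cring (hecke_algebra (SO0_int (S_hat_mat N)) (SO0_rat (S_hat_mat N))) \<and>
    coincides_with_tensor_product (hecke_algebra (SO0_int (S_hat_mat N)) (SO0_rat (S_hat_mat N))) {p. prime p}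
      (\<lambda>p. hecke_algebra (SO0_int (S_hat_mat N)) (SO0_primary (S_hat_mat N) p))"
proof -
  let ?S = "S_hat_mat N"
  let ?U = "SO0_int ?S"
  define t where "t d e = diag5 (1 / real d) (1 / real e) 1 (real e) (real d)" for d e :: nat
  define T where "T = {t d e |d e. d > 0 \<and> e > 0 \<and> e dvd d}"
  have t_SO0: "t d e \<in> SO0 ?S" if "d > 0" "e > 0" for d e
    using diag5_SO0[OF N(2), of "1 / real d" "1 / real e"] that by (simp add: t_def)
  have t_int: "real n *\<^sub>R t d e \<in> mats_over \<int> \<longleftrightarrow> d dvd n" if d: "d > 0" "e > 0" "e dvd d" for n d e
  proof
    assume "real n *\<^sub>R t d e \<in> mats_over \<int>"
    then have "(real n *\<^sub>R t d e) $ 1 $ 1 \<in> \<int>" unfolding mats_over_def by blast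
    then show "d dvd n" using d by (intro nat_dvd_if_Ints) (simp_all add: t_def diag5_def)
  next
    assume "d dvd n"
    then obtain m where "n = d * m" by blast
    moreover obtain f where "d = e * f" using d(3) by blast
    ultimately show "real n *\<^sub>R t d e \<in> mats_over \<int>" using d by (simp add: mats_over_def t_def diag5_def forall_5)
  qed
  have t_rat: "t d e \<in> mats_over \<rat>" for d e by (simp add: mats_over_def t_def diag5_def forall_5)
  have t_prim: "t d e \<in> prim ?S Q \<longleftrightarrow> prime_factors d \<subseteq> Q" if Q: "Q \<subseteq> {p. prime p}" and d: "d > 0" "e > 0" "e dvd d" for Q d e
  proof
    assume "t d e \<in> prim ?S Q"
    then obtain n where "n > 0" "prime_factors n \<subseteq> Q" "d dvd n" 
      unfolding prim_iff[OF Q] t_int[OF d] by blast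
    then show "prime_factors d \<subseteq> Q" using prime_factors_dvd_subset by blast
  next
    assume "prime_factors d \<subseteq> Q"
    then show "t d e \<in> prim ?S Q"
      unfolding prim_iff[OF Q] t_int[OF d] using t_SO0[OF d(1,2)] d(1) by (intro conjI exI[of _ d]) simp_all
  qed
  have t_minors: "minors_Ints (real (d * e)) (t d e)" if d: "d > 0" "e > 0" "e dvd d" for d e
  proof (rule minors_Ints_diagonal)
    show "t d e $ i $ j = 0" if "i \<noteq> j" for i j unfolding t_def by (rule diag5_entries(6)[OF that])
    fix i j :: 5 assume "i \<noteq> j"
    obtain f where f: "d = e * f" using d by blast
    show "real (d * e) * (t d e $ i $ i * t d e $ j $ j) \<in> \<int>"
      using exhaust_5[of i] exhaust_5[of j] \<open>i \<noteq> j\<close> d f by (auto simp: t_def diag5_entries)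
  qed
  have t_minors_dvd: "d * e dvd n" if "minors_Ints (real n) (t d e)" "d > 0" "e > 0" for d e n
  proof (rule nat_dvd_if_Ints)
    have "real n * (t d e $ 1 $ 1 * t d e $ 2 $ 2 - t d e $ 1 $ 2 * t d e $ 2 $ 1) \<in> \<int>"
      using that(1) unfolding minors_Ints_def by blast
    then show "real n / real (d * e) \<in> \<int>" by (simp add: t_def diag5_def)
  qed (use that in simp)
  show ?thesis
  proof (rule hecke_structure[where T = T])
    show "T \<subseteq> SO0 ?S \<inter> mats_over \<rat>" unfolding T_def using t_SO0 t_rat by blast
    show "\<exists>x\<in>T. \<exists>u\<in>?U. \<exists>v\<in>?U. g = u ** x ** v" if "g \<in> SO0 ?S \<inter> mats_over \<rat>" for g
      using cartan5[OF N that] unfolding T_def t_def by blast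
  next
    fix x y u v assume h: "x \<in> T" "y \<in> T" "u \<in> ?U" "v \<in> ?U" "x = u ** y ** v"
    obtain d e where d: "d > 0" "e > 0" "e dvd d" "x = t d e" using h(1) by (auto simp: T_def)
    obtain d' e' where d': "d' > 0" "e' > 0" "e' dvd d'" "y = t d' e'" using h(2) by (auto simp: T_def)
    \<comment> \<open>Entries give the divisibility for \<open>d\<close>, minors the one for
      \<open>d * e\<close>; applied in both directions they determine \<open>d\<close> and then
      \<open>e\<close>.\<close>
    have half: "d dvd d' \<and> d * e dvd d' * e'"
      if d: "d > 0" "e > 0" "e dvd d" and d': "d' > 0" "e' > 0" "e' dvd d'" and q: "t d e = u ** t d' e' ** v" "u \<in> ?U" "v \<in> ?U" for d e d' e' u v
    proof
      have uv: "u \<in> mats_over \<int>" "v \<in> mats_over \<int>" using q by (auto simp: SO0_int_def)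
      have "real d' *\<^sub>R t d e \<in> mats_over \<int>" unfolding q(1)
        by (rule denominator_factor[OF _ uv]) (use t_int[OF d', of d'] in simp)
      then show "d dvd d'" using t_int[OF d] by blast
      have "minors_Ints (real (d' * e')) (t d e)" unfolding q(1)
        by (intro minors_Ints_mult_left minors_Ints_mult_right t_minors d' uv)
      then show "d * e dvd d' * e'" by (rule t_minors_dvd[OF _ d(1,2)])
    qed
    obtain u' v' where uv: "u' \<in> ?U" "u' ** u = mat 1" "v' \<in> ?U" "v ** v' = mat 1"
      using SO0_int_inverse[OF h(3)] SO0_int_inverse[OF h(4)] by metis
    have "u' ** x ** v' = (u' ** u) ** y ** (v ** v')" unfolding h(5) by (simp only: matrix_mul_assoc)
    then have "t d' e' = u' ** t d e ** v'" using uv d d' by simp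
    then have "d' dvd d \<and> d' * e' dvd d * e" by (rule half[OF d'(1-3) d(1-3)]) (use uv in auto)
    moreover have "d dvd d' \<and> d * e dvd d' * e'"
      by (rule half[OF d(1-3) d'(1-3) _ h(3,4)]) (use h(5) d(4) d'(4) in simp)
    ultimately have "d = d'" "d * e = d' * e'" by (auto intro: dvd_antisym)
    then show "x = y" using d d' by simp
  next
    fix x assume "x \<in> T"
    then obtain d e where d: "d > 0" "e > 0" "x = t d e" by (auto simp: T_def)
    \<comment> \<open>This product is the involution that exchanges e1 with -e5 and e2 with -e4 and
      fixes e3, so conjugation by it inverts the diagonal matrix.\<close>
    let ?R = "rotA5 (pi / 2) ** rotB5 (pi / 2)"
    have R: "?R \<in> ?U" by (intro SO0_int_mult rot5_int N)
    have "(?R ** x ** ?R) ** x = mat 1"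
      unfolding d(3) t_def rotA5_def rotB5_def diag5_def
      using d by (simp add: vec_eq_iff forall_5 matrix_matrix_mult_def sum_5 mat_def)
    then show "\<exists>u\<in>?U. \<exists>v\<in>?U. (u ** x ** v) ** x = mat 1" using R by blast
  next
    fix P Q x assume h: "P \<inter> Q = {}" "P \<subseteq> {p. prime p}" "Q \<subseteq> {p. prime p}" "x \<in> T" "x \<in> prim ?S (P \<union> Q)"
    obtain d e where d: "d > 0" "e > 0" "e dvd d" "x = t d e" using h(4) by (auto simp: T_def)
    have PQ: "P \<union> Q \<subseteq> {p. prime p}" using h by blast
    have "prime_factors d \<subseteq> P \<union> Q" using t_prim[OF PQ d(1-3)] h(5) d(4) by simp
    then obtain a b where ab: "d = a * b" "prime_factors a \<subseteq> P" "prime_factors b \<subseteq> Q" "a > 0" "b > 0"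
      using prime_factors_split[OF d(1)] by blast
    \<comment> \<open>A divisor of \<open>a * b\<close> splits along the factors, which preserves
      the divisibility condition of \<open>T\<close> in each part.\<close>
    obtain a' b' where ab': "e = a' * b'" "a' dvd a" "b' dvd b" using division_decomp[of e a b] d(3) ab(1) by blast
    have pos: "a' > 0" "b' > 0" using d(2) ab'(1) by auto
    have "t d e = t a a' ** t b b'" unfolding t_def diag5_mult using ab(1) ab'(1) by simp
    moreover have "t a a' \<in> T \<inter> prim ?S P" "t b b' \<in> T \<inter> prim ?S Q"
      using t_prim[OF h(2) ab(4) pos(1) ab'(2)] t_prim[OF h(3) ab(5) pos(2) ab'(3)] ab ab' pos unfolding T_def by blast+
    ultimately show "\<exists>t1\<in>T \<inter> prim ?S P. \<exists>t2\<in>T \<inter> prim ?S Q. x = t1 ** t2" using d(4) by blast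
  qed
qed

theorem theorem2:
  fixes N :: nat
  assumes "squarefree N"
  shows
    "hecke_pair (SO0_int (S_mat N)) (SO0_rat (S_mat N)) \<and>
     cring (hecke_algebra (SO0_int (S_mat N)) (SO0_rat (S_mat N))) \<and>
     coincides_with_tensor_product
       (hecke_algebra (SO0_int (S_mat N)) (SO0_rat (S_mat N)))
       {p. prime p}
       (\<lambda>p. hecke_algebra (SO0_int (S_mat N)) (SO0_primary (S_mat N) p)) \<and>
     hecke_pair (SO0_int (S_hat_mat N)) (SO0_rat (S_hat_mat N)) \<and>
     cring (hecke_algebra (SO0_int (S_hat_mat N)) (SO0_rat (S_hat_mat N))) \<and>
     coincides_with_tensor_product
       (hecke_algebra (SO0_int (S_hat_mat N)) (SO0_rat (S_hat_mat N)))
       {p. prime p}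
       (\<lambda>p. hecke_algebra (SO0_int (S_hat_mat N)) (SO0_primary (S_hat_mat N) p))"
proof -
  have "N > 0" using assms by (metis gr0I not_squarefree_0)
  then show ?thesis using hecke_S_mat hecke_S_hat_mat assms by simp
qed

end
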